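(* Let $Y_n$ be the protection number of a random vertex in a random P\'olya tree of size $n$. Let $T(z)$ be the generating function of P\'olya trees, $\rho$ its dominant singularity, $b>0$ the constant in the expansion $T(z)= 1-b\sqrt{1-z/\rho}+O(1-z/\rho)$ as $z\to\rho$, $T_k(z)$ the generating function of P\'olya trees with protection number at least $k$, and $S_k(z)$ the generating function whose $n$-th coefficient is the total number of $k$-protected vertices in all P\'olya trees of size $n$. Then $$\lim_{n\to\infty}\mathbb{E}Y_n=\sum_{k\ge 1}\frac{2}{b^2}\left(\sum_{i\ge 2}S_k(\rho^i)+T_k(\rho)\right)\approx 0.9953254987$$ and $$\lim_{n\to\infty}\mathbb{V}Y_n\approx 1.3818769746 .$$
   Context: A P\'olya tree is an unlabelled non-plane rooted tree (an isomorphism class of finite rooted trees); its size is its number of vertices. A random P\'olya tree of size $n$ is chosen uniformly among all P\'olya trees with $n$ vertices, and the random vertex is then chosen uniformly among its $n$ vertices. The protection number of a rooted tree is the length (number of edges) of the shortest path from the root to a leaf; a single vertex is a leaf and has protection number $0$. The protection number of a vertex $v$ is the protection number of the maximal subtree rooted at $v$ (consisting of $v$ and all its descendants). A vertex is $k$-protected if $k$ does not exceed its protection number. The generating function $T(z)$ of P\'olya trees (counted by number of vertices) satisfies $T(z)=z\,e^{T(z)}\exp\left(\sum_{i\ge 2}\frac{T(z^i)}{i}\right)$. One has $T_0(z)=T(z)$ and $T_k(z)=z\,e^{T_{k-1}(z)}\exp\left(\sum_{i\ge 2}\frac{T_{k-1}(z^i)}{i}\right)-z$ for $k\ge 1$.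 The series $S_k(z)$ satisfies $T(z)\sum_{i\ge 1}S_k(z^i)=S_k(z)-T_k(z)$. The dominant singularity $\rho\approx 0.3383218568992$ is the (positive) radius of convergence of $T(z)$, where $T$ has a square root singularity with $T(\rho)=1$, and $b\approx 1.55949002037464$. $\mathbb{E}$ and $\mathbb{V}$ denote expectation and variance. The symbol $\approx$ indicates a numerical decimal approximation of the limit. *)

theory Defs
  imports "HOL-Probability.Probability"
begin

text \<open>
  Isomorphism classes of finite rooted trees: such a class is determined by the finite multiset
  of the classes of the branches at the root, so equality on this type is isomorphism.
\<close>

datatype polya_tree = Node "polya_tree multiset"

text \<open>
  A vertex of an unlabelled tree is represented by the maximal subtree rooted at it. Distinct
  vertices may carry isomorphic subtrees, hence a multiset, with one entry for each vertex.
\<close>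

primrec vertices :: "polya_tree \<Rightarrow> polya_tree multiset" where
  "vertices (Node B) = add_mset (Node B) (\<Sum>\<^sub># (image_mset vertices B))"

definition tree_size :: "polya_tree \<Rightarrow> nat" where
  "tree_size t = size (vertices t)"

definition polya_trees :: "nat \<Rightarrow> polya_tree set" where
  "polya_trees n = {t. tree_size t = n}"

text \<open>\<open>root_leaf_path t l\<close>: some path from the root of \<open>t\<close> to a leaf has \<open>l\<close> edges.\<close>

inductive root_leaf_path :: "polya_tree \<Rightarrow> nat \<Rightarrow> bool" where
  leaf: "root_leaf_path (Node {#}) 0"
| edge: "c \<in># B \<Longrightarrow> root_leaf_path c l \<Longrightarrow> root_leaf_path (Node B) (Suc l)"

definition protection :: "polya_tree \<Rightarrow> nat" where
  "protection t = (LEAST l. root_leaf_path t l)"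

definition protected :: "nat \<Rightarrow> polya_tree \<Rightarrow> bool" where
  "protected k t \<longleftrightarrow> k \<le> protection t"

definition gf_T :: "real fps" where
  "gf_T = Abs_fps (\<lambda>n. real (card (polya_trees n)))"

definition gf_Tk :: "nat \<Rightarrow> real fps" where
  "gf_Tk k = Abs_fps (\<lambda>n. real (card {t \<in> polya_trees n. protected k t}))"

definition gf_Sk :: "nat \<Rightarrow> real fps" where
  "gf_Sk k = Abs_fps (\<lambda>n. real (\<Sum>t\<in>polya_trees n. size {#v \<in># vertices t. protected k v#}))"

definition rho :: real where
  "rho = real_of_ereal (fps_conv_radius gf_T)"

text \<open>
  The distribution of the protection number of a uniformly random vertex of a uniformly random
  tree with \<open>n\<close> vertices. There is no tree with 0 vertices, so this is meaningful for \<open>n \<ge> 1\<close> only.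
\<close>

definition Y :: "nat \<Rightarrow> nat pmf" where
  "Y n = do {
     t \<leftarrow> pmf_of_set (polya_trees n);
     v \<leftarrow> pmf_of_multiset (vertices t);
     return_pmf (protection v)
   }"

end

theory Submission
  imports Defs "HOL-Complex_Analysis.Complex_Analysis"
begin

text \<open>
  Let \<open>T\<close> be the generating function of the trees and \<open>\<Phi>(z) = z exp (\<Sum>i\<ge>2. T(z\<^sup>i) / i)\<close>, so that
  \<open>T e\<^sup>-\<^sup>T = \<Phi>\<close> and \<open>e \<Phi>(\<rho>) = 1\<close>. The numbers \<open>e \<rho>\<^sup>n [z\<^sup>n] \<Phi>\<close> form a probability distribution with exponentially
  small tails and a nonzero weight at \<open>1\<close>, hence \<open>1 - e \<Phi>(\<rho> z) = (1 - z) g(z)\<close> with \<open>g\<close> free of zeros on a disc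
  larger than the unit disc. Substituting this into the expansion of \<open>1 / (1 - T) = \<Sum>n. n\<^sup>n \<Phi>\<^sup>n / n!\<close> and comparing
  \<open>n\<^sup>n e\<^sup>-\<^sup>n / n!\<close> with the coefficients of \<open>(1 - z)\<^sup>-\<^sup>1\<^sup>/\<^sup>2\<close>, whose differences are \<open>O(n\<^sup>-\<^sup>3\<^sup>/\<^sup>2)\<close>,
  shows that the coefficients of \<open>1 / (1 - T)\<close> are asymptotic to \<open>L n\<^sup>-\<^sup>1\<^sup>/\<^sup>2 \<rho>\<^sup>-\<^sup>n\<close>.

  Since \<open>(1 - T) S\<^sub>k = T\<^sub>k + T W\<^sub>k\<close> with \<open>W\<^sub>k(z) = \<Sum>i\<ge>2. S\<^sub>k(z\<^sup>i)\<close>, the quotient of the \<open>n\<close>-th coefficients of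
  \<open>S\<^sub>k\<close> and of \<open>S\<^sub>0 = z T'\<close> tends to \<open>(T\<^sub>k(\<rho>) + W\<^sub>k(\<rho>)) / G\<close> with \<open>G = 1 + W\<^sub>0(\<rho>)\<close>, and \<open>b\<^sup>2 = 2 G\<close>.
  The quotients decay geometrically in \<open>k\<close>, uniformly in \<open>n\<close>, so they may be summed over \<open>k\<close> termwise.

  The decimals come from exact integer arithmetic on the first \<open>40\<close> coefficients of \<open>T\<^sub>k\<close> and of weighted sums of
  the \<open>S\<^sub>k\<close>, fixed-point enclosures of \<open>\<rho>\<close> and of the iterates \<open>T\<^sub>k(\<rho>)\<close>, and geometric tail bounds.
\<close>

subsection \<open>Counting trees and forests\<close>

text \<open>A transfer theorem for the square root singularity would need T continued analytically
  to a slit neighbourhood of rho. The argument avoids this by working with coefficients: Phi has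
  nonnegative coefficients, so a bound |F n| <= K G n survives composition with it. What is needed
  is a majorant G whose composition is explicit. The coefficients of 2 - (1 - z)^(1/2) serve,
  because (1 - e Phi(rho z))^(1/2) is (1 - z)^(1/2) times an analytic square root of g. Complex
  analysis enters only through this root and the absence of zeros of g. The expansion of 1 / (1 - T)
  in powers of Phi is Lagrange inversion of w e^-w. The constant L is common to all k, so it cancels
  in the quotients. A second obstacle is that rho is given merely as a radius of convergence, while
  T(rho) = 1 has to be derived. The series Phi involves T only at z^i with i >= 2 and therefore
  converges beyond rho; this makes e Phi(rho) = 1 provable by continuity and turns the enclosure of
  rho into a numerical check on either side.\<close>

lemma tree_size_Node: "tree_size (Node B) = Suc (\<Sum>c\<in>#B. tree_size c)"
proof -
  have "size (\<Sum>\<^sub># (image_mset vertices B)) = (\<Sum>c\<in>#B. size (vertices c))"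
    by (induction B) auto
  then show ?thesis by (simp add: tree_size_def)
qed

lemma tree_size_pos: "tree_size t > 0"
  by (cases t) (simp add: tree_size_Node)

definition forests :: "polya_tree set \<Rightarrow> nat \<Rightarrow> polya_tree multiset set" where
  "forests A n = {B. set_mset B \<subseteq> A \<and> (\<Sum>c\<in>#B. tree_size c) = n}"

lemma size_le_sum_tree_size: "size B \<le> (\<Sum>c\<in>#B. tree_size c)"
proof (induction B)
  case (add x B)
  then show ?case using tree_size_pos[of x] by simp
qed simp

lemma tree_size_le_sum: "c \<in># B \<Longrightarrow> tree_size c \<le> (\<Sum>c\<in>#B. tree_size c)"
  by (metis le_add1 multi_member_split sum_mset.add_mset image_mset_add_mset)

text \<open>Every branch has at least one vertex, so a tree with at most n + 1 vertices has at most
  n branches, each with at most n vertices.\<close>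

lemma finite_trees_le: "finite {t. tree_size t \<le> n}"
proof (induction n)
  case 0
  have "{t. tree_size t \<le> 0} = {}" using tree_size_pos by (auto simp: not_le)
  then show ?case by (metis finite.emptyI)
next
  case (Suc n)
  let ?F = "{t. tree_size t \<le> n}"
  have "finite (\<Union>k\<le>n. {B. set_mset B \<subseteq> ?F \<and> size B = k})"
    using finite_multisets_of_size[OF Suc] by (auto simp: multisets_of_size_def)
  moreover have "{t. tree_size t \<le> Suc n} \<subseteq> Node ` (\<Union>k\<le>n. {B. set_mset B \<subseteq> ?F \<and> size B = k})"
  proof
    fix t assume t: "t \<in> {t. tree_size t \<le> Suc n}"
    obtain B where B: "t = Node B" by (cases t)
    have "(\<Sum>c\<in>#B. tree_size c) \<le> n" using t B by (simp add: tree_size_Node)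
    then have "size B \<le> n" "set_mset B \<subseteq> ?F"
      using size_le_sum_tree_size[of B] tree_size_le_sum[of _ B] by force+
    then show "t \<in> Node ` (\<Union>k\<le>n. {B. set_mset B \<subseteq> ?F \<and> size B = k})" using B by auto
  qed
  ultimately show ?case by (meson finite_imageI finite_subset)
qed

lemma finite_polya_trees [simp]: "finite (polya_trees n)"
  by (rule finite_subset[OF _ finite_trees_le[of n]]) (auto simp: polya_trees_def)

lemma polya_trees_Suc_eq: "polya_trees (Suc n) = Node ` forests UNIV n"
proof (intro set_eqI)
  fix t show "t \<in> polya_trees (Suc n) \<longleftrightarrow> t \<in> Node ` forests UNIV n"
    by (cases t) (auto simp: polya_trees_def forests_def tree_size_Node)
qed

lemma inj_Node: "inj_on Node X" by (auto intro: inj_onI)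

lemma finite_forests [simp]: "finite (forests A n)"
proof -
  have "finite (Node ` forests UNIV n)" using polya_trees_Suc_eq[of n] by (metis finite_polya_trees)
  then have "finite (forests UNIV n)" using inj_Node finite_imageD by blast
  moreover have "forests A n \<subseteq> forests UNIV n" by (auto simp: forests_def)
  ultimately show ?thesis using finite_subset by blast
qed

lemma forests_0: "forests A 0 = {{#}}"
proof -
  have "B = {#}" if "(\<Sum>c\<in>#B. tree_size c) = 0" for B
    using size_le_sum_tree_size[of B] that by simp
  then show ?thesis by (auto simp: forests_def simp del: sum_mset_0_iff)
qed

lemma sum_mset_count: "finite X \<Longrightarrow> set_mset B \<subseteq> X \<Longrightarrow>
   (\<Sum>c\<in>#B. w c) = (\<Sum>c\<in>X. real (count B c) * (w c :: real))"
proof (induction B)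
  case (add x B)
  have "(\<Sum>c\<in>X. real (count (add_mset x B) c) * w c) = (\<Sum>c\<in>X. real (count B c) * w c + (if c = x then w x else 0))"
    by (intro sum.cong) (auto simp: algebra_simps)
  also have "\<dots> = (\<Sum>c\<in>X. real (count B c) * w c) + w x"
    using add by (simp add: sum.distrib)
  finally show ?case using add by simp
qed simp

lemma count_ge_obtain:
  assumes "m \<le> count B c"
  obtains B' where "B = B' + replicate_mset m c"
  using that[of "B - replicate_mset m c"] assms by (auto simp: multiset_eq_iff)

lemma card_forests_count_ge:
  assumes "c \<in> A" "m * tree_size c \<le> n"
  shows "card {B \<in> forests A n. m \<le> count B c} = card (forests A (n - m * tree_size c))"
proof -
  have "{B \<in> forests A n. m \<le> count B c} = (\<lambda>B. B + replicate_mset m c) ` forests A (n - m * tree_size c)"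
  proof (intro equalityI subsetI)
    fix B assume B: "B \<in> {B \<in> forests A n. m \<le> count B c}"
    then have "m \<le> count B c" by simp
    then obtain B' where B': "B = B' + replicate_mset m c" by (rule count_ge_obtain)
    then have "B' \<in> forests A (n - m * tree_size c)" using B by (auto simp: forests_def)
    then show "B \<in> (\<lambda>B. B + replicate_mset m c) ` forests A (n - m * tree_size c)" using B' by blast
  next
    fix B assume "B \<in> (\<lambda>B. B + replicate_mset m c) ` forests A (n - m * tree_size c)"
    then obtain B' where B': "B = B' + replicate_mset m c" "B' \<in> forests A (n - m * tree_size c)" by blast
    have "set_mset (replicate_mset m c) \<subseteq> A" using assms(1) by simp
    then show "B \<in> {B \<in> forests A n. m \<le> count B c}"
      using B' assms(2) by (simp add: forests_def)
  qed
  then show ?thesis by (simp add: card_image inj_on_def)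
qed

lemma card_forests_count_ge_0:
  assumes "\<not> m * tree_size c \<le> n"
  shows "{B \<in> forests A n. m \<le> count B c} = {}"
proof -
  have "m * tree_size c \<le> n" if B: "B \<in> forests A n" "m \<le> count B c" for B
  proof -
    obtain B' where "B = B' + replicate_mset m c" using B(2) by (rule count_ge_obtain)
    then show ?thesis using B(1) by (auto simp: forests_def)
  qed
  then show ?thesis using assms by blast
qed

text \<open>Every branch \<open>c\<close> of a forest contributes once for each \<open>m\<close> up to its multiplicity, and removing
  \<open>m\<close> copies of \<open>c\<close> leaves an arbitrary forest.\<close>
lemma sum_forests:
  fixes w :: "polya_tree \<Rightarrow> real"
  shows "(\<Sum>B\<in>forests A n. \<Sum>c\<in>#B. w c) =
    (\<Sum>j=1..n. (\<Sum>d | d dvd j. \<Sum>c\<in>A \<inter> polya_trees d. w c) * real (card (forests A (n - j))))"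
proof -
  define X where "X = {c\<in>A. tree_size c \<le> n}"
  have finX: "finite X" unfolding X_def by (rule finite_subset[OF _ finite_trees_le[of n]]) auto
  have sub: "set_mset B \<subseteq> X" if "B \<in> forests A n" for B
    using that tree_size_le_sum[of _ B] by (auto simp: X_def forests_def)
  have cnt: "real (count B c) = (\<Sum>m=1..n. if m \<le> count B c then 1 else 0)" if "B \<in> forests A n" for B c
  proof -
    have "count B c \<le> n" using that size_le_sum_tree_size[of B] count_le_size[of B c]
      by (auto simp: forests_def)
    then have "{m\<in>{1..n}. m \<le> count B c} = {1..count B c}" by auto
    then show ?thesis by (simp add: sum.If_cases Int_def)
  qed
  have "(\<Sum>B\<in>forests A n. \<Sum>c\<in>#B. w c) = (\<Sum>B\<in>forests A n. \<Sum>c\<in>X. \<Sum>m=1..n. (if m \<le> count B c then 1 else 0) * w c)"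
  proof (intro sum.cong refl)
    fix B assume B: "B \<in> forests A n"
    have "(\<Sum>c\<in>#B. w c) = (\<Sum>c\<in>X. real (count B c) * w c)" by (rule sum_mset_count[OF finX sub[OF B]])
    also have "\<dots> = (\<Sum>c\<in>X. \<Sum>m=1..n. (if m \<le> count B c then 1 else 0) * w c)"
      by (simp only: cnt[OF B] sum_distrib_right)
    finally show "(\<Sum>c\<in>#B. w c) = (\<Sum>c\<in>X. \<Sum>m=1..n. (if m \<le> count B c then 1 else 0) * w c)" .
  qed
  also have "\<dots> = (\<Sum>c\<in>X. \<Sum>m=1..n. \<Sum>B\<in>forests A n. (if m \<le> count B c then 1 else 0) * w c)"
    by (subst sum.swap, intro sum.cong refl, rule sum.swap)
  also have "\<dots> = (\<Sum>c\<in>X. \<Sum>m=1..n. w c * real (card {B \<in> forests A n. m \<le> count B c}))"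
    by (intro sum.cong refl) (simp add: sum_distrib_right[symmetric] sum.If_cases Int_def)
  \<comment> \<open>Substituting j = m * \<open>tree_size c\<close> turns multiplicities m into
    multiples j of the branch size; after the next exchange of sums these become the divisors of
    j.\<close>
  also have "\<dots> = (\<Sum>c\<in>X. \<Sum>j | j \<in> {1..n} \<and> tree_size c dvd j. w c * real (card (forests A (n - j))))"
  proof (rule sum.cong[OF refl])
    fix c assume c: "c \<in> X"
    have le: "k \<le> tree_size c * k" for k using tree_size_pos[of c] by simp
    have "(\<Sum>m=1..n. w c * real (card {B \<in> forests A n. m \<le> count B c})) =
          (\<Sum>m | m \<in> {1..n} \<and> m * tree_size c \<le> n. w c * real (card {B \<in> forests A n. m \<le> count B c}))"
      by (rule sum.mono_neutral_right) (auto simp: card_forests_count_ge_0)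
    also have "\<dots> = (\<Sum>m | m \<in> {1..n} \<and> m * tree_size c \<le> n. w c * real (card (forests A (n - m * tree_size c))))"
      by (intro sum.cong refl) (use c in \<open>simp add: card_forests_count_ge X_def\<close>)
    also have "\<dots> = (\<Sum>j | j \<in> {1..n} \<and> tree_size c dvd j. w c * real (card (forests A (n - j))))"
      by (rule sum.reindex_bij_witness[where j = "\<lambda>m. m * tree_size c" and i = "\<lambda>j. j div tree_size c"])
         (use tree_size_pos[of c] in \<open>auto simp: Suc_le_eq elim!: dvdE intro: order_trans[OF le]\<close>)
    finally show "(\<Sum>m=1..n. w c * real (card {B \<in> forests A n. m \<le> count B c})) =
      (\<Sum>j | j \<in> {1..n} \<and> tree_size c dvd j. w c * real (card (forests A (n - j))))" .
  qed
  also have "\<dots> = (\<Sum>j=1..n. \<Sum>c | c \<in> X \<and> tree_size c dvd j. w c * real (card (forests A (n - j))))"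
    by (rule sum.swap_restrict) (use finX in auto)
  also have "\<dots> = (\<Sum>j=1..n. (\<Sum>d | d dvd j. \<Sum>c\<in>A \<inter> polya_trees d. w c) * real (card (forests A (n - j))))"
  proof (intro sum.cong refl)
    fix j assume j: "j \<in> {1..n}"
    have "(\<Sum>d | d dvd j. \<Sum>c\<in>A \<inter> polya_trees d. w c) = (\<Sum>c\<in>(\<Union>d\<in>{d. d dvd j}. A \<inter> polya_trees d). w c)"
    proof (rule sum.UNION_disjoint[symmetric])
      show "\<forall>d\<in>{d. d dvd j}. \<forall>e\<in>{d. d dvd j}. d \<noteq> e \<longrightarrow> A \<inter> polya_trees d \<inter> (A \<inter> polya_trees e) = {}"
        by (auto simp: polya_trees_def)
    qed (use j in auto)
    also have "(\<Union>d\<in>{d. d dvd j}. A \<inter> polya_trees d) = {c. c \<in> X \<and> tree_size c dvd j}"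
      using j by (auto simp: X_def polya_trees_def intro: order_trans[OF dvd_imp_le])
    finally show "(\<Sum>c | c \<in> X \<and> tree_size c dvd j. w c * real (card (forests A (n - j)))) =
      (\<Sum>d | d dvd j. \<Sum>c\<in>A \<inter> polya_trees d. w c) * real (card (forests A (n - j)))"
      by (simp add: sum_distrib_right)
  qed
  finally show ?thesis .
qed

subsection \<open>Protection numbers and the functional equations\<close>

lemma root_leaf_path_exists: "\<exists>l. root_leaf_path t l"
proof (induction t)
  case (Node B)
  show ?case
  proof (cases "B = {#}")
    case False
    then obtain c where "c \<in># B" by auto
    with Node show ?thesis by (meson edge)
  qed (auto intro: leaf)
qed

lemma root_leaf_path_Node_iff:
  "root_leaf_path (Node B) l \<longleftrightarrow> (B = {#} \<and> l = 0) \<or> (\<exists>c l'. c \<in># B \<and> l = Suc l' \<and> root_leaf_path c l')"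
  by (subst root_leaf_path.simps) auto

lemma protected_iff: "protected k t \<longleftrightarrow> (\<forall>l. root_leaf_path t l \<longrightarrow> k \<le> l)"
  unfolding protected_def protection_def
  by (metis LeastI_ex Least_le order_trans root_leaf_path_exists)

lemma protected_0 [simp]: "protected 0 t"
  by (simp add: protected_def)

lemma protected_Suc_Node: "protected (Suc k) (Node B) \<longleftrightarrow> B \<noteq> {#} \<and> (\<forall>c\<in>#B. protected k c)"
  unfolding protected_iff[of "Suc k"] protected_iff[of k] root_leaf_path_Node_iff by fastforce

lemma protected_less_size: "protected k t \<Longrightarrow> k < tree_size t"
proof (induction k arbitrary: t)
  case (Suc k)
  obtain B where B: "t = Node B" by (cases t)
  obtain c where c: "c \<in># B" "protected k c" using Suc.prems B by (auto simp: protected_Suc_Node)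
  then show ?case using Suc.IH[of c] tree_size_le_sum[OF c(1)] by (simp add: B tree_size_Node)
qed (simp add: tree_size_pos)

definition tn :: "nat \<Rightarrow> nat \<Rightarrow> real" where
  "tn k n = real (card {t \<in> polya_trees n. protected k t})"

definition sn :: "nat \<Rightarrow> nat \<Rightarrow> real" where
  "sn k n = real (\<Sum>t\<in>polya_trees n. size {#v \<in># vertices t. protected k v#})"

text \<open>\<open>mn k n\<close> counts the trees with \<open>n\<close> vertices all of whose branches are \<open>(k - 1)\<close>-protected;
  compared to \<open>tn k n\<close> this admits the single vertex.\<close>
definition mn :: "nat \<Rightarrow> nat \<Rightarrow> real" where
  "mn k n = tn k n + (if n = 1 then 1 else 0)"

text \<open>Coefficients of the sum of A(z^i) over i >= 1. At j = 0 the index set is infinite and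
  the sum takes the default value 0.\<close>

definition divsum :: "(nat \<Rightarrow> real) \<Rightarrow> nat \<Rightarrow> real" where
  "divsum a j = (\<Sum>d | d dvd j. a d)"

lemma tn_nonneg [simp]: "tn k n \<ge> 0" and sn_nonneg [simp]: "sn k n \<ge> 0"
  by (auto simp: tn_def sn_def intro!: sum_nonneg)

lemma tn_n_0 [simp]: "tn k 0 = 0" and sn_n_0 [simp]: "sn k 0 = 0"
proof -
  have "polya_trees 0 = {}" using tree_size_pos by (auto simp: polya_trees_def)
  then show "tn k 0 = 0" "sn k 0 = 0" by (auto simp: tn_def sn_def)
qed

lemma tn_antimono: "j \<le> k \<Longrightarrow> tn k n \<le> tn j n"
  unfolding tn_def by (auto intro!: card_mono simp: protected_def)

lemma tn_0: "tn 0 n = real (card (polya_trees n))" by (simp add: tn_def)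

lemma tn_zero: "n \<le> k \<Longrightarrow> tn k n = 0"
proof -
  assume "n \<le> k"
  then have "{t \<in> polya_trees n. protected k t} = {}"
    using protected_less_size[of k] by (force simp: polya_trees_def)
  then show ?thesis by (simp add: tn_def)
qed

lemma tn_0_Suc: "tn 0 (Suc n) = real (card (forests UNIV n))"
  by (simp add: tn_0 polya_trees_Suc_eq card_image inj_Node)

lemma mn_Suc: "mn (Suc k) (Suc n) = real (card (forests {t. protected k t} n))"
proof -
  have eq: "{t \<in> polya_trees (Suc n). protected (Suc k) t} = Node ` (forests {t. protected k t} n - {{#}})"
    unfolding polya_trees_Suc_eq by (auto simp: protected_Suc_Node forests_def)
  have emp: "{#} \<in> forests {t. protected k t} n \<longleftrightarrow> n = 0" by (auto simp: forests_def)
  have "tn (Suc k) (Suc n) = real (card (forests {t. protected k t} n - {{#}}))"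
    unfolding tn_def eq by (simp add: card_image inj_Node)
  then show ?thesis using emp
    by (cases "n = 0") (auto simp: mn_def forests_0)
qed

lemma sum_size_trees: "(\<Sum>c\<in>{t. protected k t} \<inter> polya_trees d. real (tree_size c)) = real d * tn k d"
proof -
  have "{t. protected k t} \<inter> polya_trees d = {t \<in> polya_trees d. protected k t}" by auto
  then show ?thesis by (simp add: tn_def polya_trees_def)
qed

text \<open>Double counting of the branches of all forests of total size n, weighted by branch size.
  It is the logarithmic derivative of T_(k+1) + z = z exp(sum of T_k(z^i) / i), and it determines
  the coefficients recursively.\<close>

lemma mn_rec: "real n * mn (Suc k) (Suc n) = (\<Sum>j=1..n. divsum (\<lambda>d. real d * tn k d) j * mn (Suc k) (Suc n - j))"
proof -
  have "real n * mn (Suc k) (Suc n) = (\<Sum>B\<in>forests {t. protected k t} n. \<Sum>c\<in>#B. real (tree_size c))"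
  proof -
    have "(\<Sum>c\<in>#B. real (tree_size c)) = real n" if "B \<in> forests {t. protected k t} n" for B
    proof -
      have "(\<Sum>c\<in>#B. real (tree_size c)) = real (\<Sum>c\<in>#B. tree_size c)" by (induction B) auto
      also have "(\<Sum>c\<in>#B. tree_size c) = n" using that by (simp add: forests_def)
      finally show ?thesis .
    qed
    then show ?thesis by (simp add: mn_Suc)
  qed
  also have "\<dots> = (\<Sum>j=1..n. divsum (\<lambda>d. real d * tn k d) j * mn (Suc k) (Suc (n - j)))"
    by (simp add: sum_forests sum_size_trees divsum_def mn_Suc)
  finally show ?thesis by (simp add: Suc_diff_le)
qed

lemma tn_0_rec: "real n * tn 0 (Suc n) = (\<Sum>j=1..n. divsum (\<lambda>d. real d * tn 0 d) j * tn 0 (Suc n - j))"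
proof -
  have "mn (Suc 0) (Suc n) = tn 0 (Suc n)" for n by (simp add: mn_Suc tn_0_Suc)
  then have "mn (Suc 0) (Suc n - j) = tn 0 (Suc n - j)" if "j \<in> {1..n}" for j n
    using that by (simp add: Suc_diff_le)
  then show ?thesis using mn_rec[of n 0] \<open>\<And>n. mn (Suc 0) (Suc n) = tn 0 (Suc n)\<close> by simp
qed

text \<open>A vertex is the root or lies in exactly one branch, so the number of k-protected
  vertices is additive over the branches and \<open>sum_forests\<close> applies to it. This is the
  coefficient form of S_k = T_k + T * (sum of S_k(z^i) over i >= 1).\<close>

lemma sn_rec: "sn k n = tn k n + (\<Sum>j=1..<n. divsum (sn k) j * tn 0 (n - j))"
proof (cases n)
  case (Suc m)
  define w where "w = (\<lambda>t. real (size {#v \<in># vertices t. protected k v#}))"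
  have w: "w (Node B) = (if protected k (Node B) then 1 else 0) + (\<Sum>c\<in>#B. w c)" for B
  proof -
    have "real (size {#v \<in># \<Sum>\<^sub># (image_mset vertices B). protected k v#}) = (\<Sum>c\<in>#B. w c)"
      by (induction B) (auto simp: w_def)
    then show ?thesis by (simp add: w_def)
  qed
  have sn: "sn k d = (\<Sum>c\<in>UNIV \<inter> polya_trees d. w c)" for d by (simp add: sn_def w_def)
  have "sn k n = (\<Sum>B\<in>forests UNIV m. w (Node B))"
    unfolding sn Suc polya_trees_Suc_eq by (simp add: sum.reindex inj_Node)
  also have "\<dots> = (\<Sum>B\<in>forests UNIV m. if protected k (Node B) then 1 else 0) + (\<Sum>B\<in>forests UNIV m. \<Sum>c\<in>#B. w c)"
    by (simp add: w sum.distrib)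
  also have "(\<Sum>B\<in>forests UNIV m. if protected k (Node B) then 1 else 0) = (\<Sum>t\<in>polya_trees n. if protected k t then 1 else (0::real))"
    unfolding Suc polya_trees_Suc_eq by (simp add: sum.reindex inj_Node)
  also have "\<dots> = tn k n" by (simp add: tn_def sum.If_cases Int_def)
  also have "(\<Sum>B\<in>forests UNIV m. \<Sum>c\<in>#B. w c) = (\<Sum>j=1..m. divsum (sn k) j * tn 0 (Suc (m - j)))"
    unfolding sum_forests divsum_def sn tn_0_Suc by simp
  also have "\<dots> = (\<Sum>j=1..<n. divsum (sn k) j * tn 0 (n - j))"
    by (intro sum.cong) (auto simp: Suc Suc_diff_le)
  finally show ?thesis .
qed (simp)

lemma sn_0: "sn 0 n = real n * tn 0 n"
  by (simp add: sn_def tn_0 polya_trees_def tree_size_def[symmetric])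

subsection \<open>Series satisfying an exponential recurrence\<close>

text \<open>The truncated polynomials f and h satisfy f' <= h' f on the nonnegative axis, because
  the convolution in f' is a part of the product with nonnegative terms; hence f exp(-h) does not
  increase. No convergence is assumed, so this bounds partial sums before a radius is known.\<close>

lemma exp_formula_partial_sums:
  fixes m l :: "nat \<Rightarrow> real"
  assumes nonneg: "\<And>n. m n \<ge> 0" "\<And>n. l n \<ge> 0" and m0: "m 0 = 1"
    and rec: "\<And>n. real n * m n = (\<Sum>j=1..n. real j * l j * m (n - j))"
    and x: "x \<ge> 0"
  shows "(\<Sum>n\<le>D. m n * x ^ n) \<le> exp (\<Sum>j=1..D. l j * x ^ j)"
proof -
  define f where "f = (\<lambda>x. \<Sum>n\<le>D. m n * x ^ n)"
  define h where "h = (\<lambda>x. \<Sum>j=1..D. l j * x ^ j)"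
  define f' where "f' = (\<lambda>x. \<Sum>n\<le>D. m n * (real n * x ^ (n - 1)))"
  define h' where "h' = (\<lambda>x. \<Sum>j=1..D. l j * (real j * x ^ (j - 1)))"
  have df: "(f has_real_derivative f' y) (at y)" for y
    unfolding f_def f'_def by (auto intro!: derivative_eq_intros sum.cong)
  have dh: "(h has_real_derivative h' y) (at y)" for y
    unfolding h_def h'_def by (auto intro!: derivative_eq_intros sum.cong)
  have le: "f' y \<le> h' y * f y" if y: "y \<ge> 0" for y
  proof -
    have "f' y = (\<Sum>n\<le>D. \<Sum>j=1..n. (l j * (real j * y ^ (j - 1))) * (m (n - j) * y ^ (n - j)))"
      unfolding f'_def
    proof (rule sum.cong[OF refl])
      fix n
      have "m n * (real n * y ^ (n - 1)) = (real n * m n) * y ^ (n - 1)" by simp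
      also have "\<dots> = (\<Sum>j=1..n. real j * l j * m (n - j) * y ^ (n - 1))"
        by (simp only: rec sum_distrib_right)
      also have "\<dots> = (\<Sum>j=1..n. (l j * (real j * y ^ (j - 1))) * (m (n - j) * y ^ (n - j)))"
      proof (rule sum.cong[OF refl])
        fix j assume "j \<in> {1..n}"
        then have "n - 1 = (j - 1) + (n - j)" by auto
        then have "y ^ (n - 1) = y ^ (j - 1) * y ^ (n - j)" by (metis power_add)
        then show "real j * l j * m (n - j) * y ^ (n - 1) = (l j * (real j * y ^ (j - 1))) * (m (n - j) * y ^ (n - j))"
          by simp
      qed
      finally show "m n * (real n * y ^ (n - 1)) = (\<Sum>j=1..n. (l j * (real j * y ^ (j - 1))) * (m (n - j) * y ^ (n - j)))" .
    qed
    also have "\<dots> = (\<Sum>(n, j)\<in>Sigma {..D} (\<lambda>n. {1..n}). (l j * (real j * y ^ (j - 1))) * (m (n - j) * y ^ (n - j)))"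
      by (subst sum.Sigma) auto
    also have "\<dots> = (\<Sum>(j, i)\<in>{(j, i). j \<in> {1..D} \<and> i \<le> D - j}. (l j * (real j * y ^ (j - 1))) * (m i * y ^ i))"
      by (rule sum.reindex_bij_witness[where j = "\<lambda>(n, j). (j, n - j)" and i = "\<lambda>(j, i). (j + i, j)"]) auto
    also have "\<dots> \<le> (\<Sum>(j, i)\<in>{1..D} \<times> {..D}. (l j * (real j * y ^ (j - 1))) * (m i * y ^ i))"
      by (rule sum_mono2) (use y nonneg in auto)
    also have "\<dots> = h' y * f y"
      unfolding h'_def f_def by (simp add: sum_product sum.cartesian_product)
    finally show ?thesis .
  qed
  have "f x * exp (- h x) \<le> f 0 * exp (- h 0)"
  proof (rule DERIV_nonpos_imp_nonincreasing[OF x])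
    fix y assume y: "0 \<le> y" "y \<le> x"
    have "((\<lambda>x. f x * exp (- h x)) has_real_derivative (f' y - h' y * f y) * exp (- h y)) (at y)"
      by (auto intro!: derivative_eq_intros df dh simp: algebra_simps)
    moreover have "(f' y - h' y * f y) * exp (- h y) \<le> 0"
      using le[OF y(1)] by (simp add: mult_nonpos_nonneg)
    ultimately show "\<exists>z. ((\<lambda>x. f x * exp (- h x)) has_real_derivative z) (at y) \<and> z \<le> 0" by blast
  qed
  also have "f 0 = 1" unfolding f_def by (simp add: power_0_left m0 if_distrib cong: if_cong)
  also have "h 0 = 0" unfolding h_def by (simp add: power_0_left)
  finally show ?thesis by (simp add: exp_minus field_simps f_def h_def)
qed

text \<open>The recurrence says M' = L' M, so M exp(-L) is constant wherever both series
  converge.\<close>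

lemma exp_formula_suminf:
  fixes m l :: "nat \<Rightarrow> real"
  assumes m0: "m 0 = 1" and l0: "l 0 = 0"
    and rec: "\<And>n. real n * m n = (\<Sum>j=1..n. real j * l j * m (n - j))"
    and x: "0 \<le> x" "x < r" and sm: "summable (\<lambda>n. m n * r ^ n)" and sl: "summable (\<lambda>n. l n * r ^ n)"
  shows "(\<Sum>n. m n * x ^ n) = exp (\<Sum>n. l n * x ^ n)"
proof -
  define M where "M = Abs_fps m"
  define L where "L = Abs_fps l"
  have ode: "fps_deriv M = fps_deriv L * M"
  proof (rule fps_ext)
    fix n
    have "fps_nth (fps_deriv M) n = real (Suc n) * m (Suc n)" by (simp add: M_def)
    also have "\<dots> = (\<Sum>j=1..Suc n. real j * l j * m (Suc n - j))" by (rule rec)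
    also have "\<dots> = (\<Sum>i=0..n. real (Suc i) * l (Suc i) * m (n - i))"
      by (rule sum.reindex_bij_witness[where i = Suc and j = "\<lambda>j. j - 1"]) auto
    finally show "fps_nth (fps_deriv M) n = fps_nth (fps_deriv L * M) n"
      by (simp add: fps_mult_nth M_def L_def)
  qed
  have rM: "ereal r \<le> fps_conv_radius M"
    using conv_radius_geI[of m r] sm x by (simp add: fps_conv_radius_def M_def)
  have rL: "ereal r \<le> fps_conv_radius L"
    using conv_radius_geI[of l r] sl x by (simp add: fps_conv_radius_def L_def)
  define S where "S = {0..x}"
  have lt: "ereal (norm y) < fps_conv_radius M" "ereal (norm y) < fps_conv_radius L"
           "ereal (norm y) < fps_conv_radius (fps_deriv L)" if "y \<in> S" for y
  proof -
    have *: "ereal (norm y) < ereal r" using that x by (auto simp: S_def)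
    show "ereal (norm y) < fps_conv_radius M" "ereal (norm y) < fps_conv_radius L"
      using less_le_trans[OF * rM] less_le_trans[OF * rL] by simp_all
    then show "ereal (norm y) < fps_conv_radius (fps_deriv L)"
      using fps_conv_radius_deriv[of L] by (auto intro: less_le_trans)
  qed
  have "\<exists>c. \<forall>y\<in>S. eval_fps M y * exp (- eval_fps L y) = c"
  proof (rule has_field_derivative_zero_constant)
    fix y assume y: "y \<in> S"
    have "eval_fps (fps_deriv M) y = eval_fps (fps_deriv L) y * eval_fps M y"
      unfolding ode by (rule eval_fps_mult) (use lt[OF y] in auto)
    moreover have "((\<lambda>y. eval_fps M y * exp (- eval_fps L y)) has_real_derivative
        eval_fps (fps_deriv M) y * exp (- eval_fps L y) +
        (exp (- eval_fps L y) * (- eval_fps (fps_deriv L) y)) * eval_fps M y) (at y within S)"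
      by (intro DERIV_mult DERIV_chain2[where f = exp] DERIV_exp DERIV_minus has_field_derivative_eval_fps lt[OF y])
    ultimately show "((\<lambda>y. eval_fps M y * exp (- eval_fps L y)) has_real_derivative 0) (at y within S)"
      by (simp add: algebra_simps)
  qed (simp add: S_def)
  then have "eval_fps M x * exp (- eval_fps L x) = eval_fps M 0 * exp (- eval_fps L 0)"
    using x by (auto simp: S_def)
  also have "\<dots> = 1" by (simp add: eval_fps_at_0 M_def L_def m0 l0)
  finally show ?thesis by (simp add: eval_fps_def M_def L_def exp_minus field_simps)
qed

text \<open>Absolute summability at r makes the convergence uniform on [0, r]. This carries
  identities proved for x < rho to the boundary point rho.\<close>

lemma suminf_continuous_left:
  fixes a :: "nat \<Rightarrow> real"
  assumes r: "r > 0" and s: "summable (\<lambda>n. norm (a n) * r ^ n)"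
  shows "((\<lambda>x. \<Sum>n. a n * x ^ n) \<longlongrightarrow> (\<Sum>n. a n * r ^ n)) (at_left r)"
proof -
  have "uniform_limit {0..r} (\<lambda>N x. \<Sum>n<N. a n * x ^ n) (\<lambda>x. \<Sum>n. a n * x ^ n) sequentially"
    by (rule Weierstrass_m_test[OF _ s])
       (auto simp: abs_mult intro!: mult_left_mono power_mono)
  then have "continuous_on {0..r} (\<lambda>x. \<Sum>n. a n * x ^ n)"
    by (rule uniform_limit_theorem[rotated]) (auto intro!: always_eventually continuous_intros)
  then have "((\<lambda>x. \<Sum>n. a n * x ^ n) \<longlongrightarrow> (\<Sum>n. a n * r ^ n)) (at r within {0..r})"
    using r by (auto simp: continuous_on_def)
  moreover have "at r within {0..r} = at_left r"
    using r by (rule at_within_Icc_at_left)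
  ultimately show ?thesis by simp
qed

subsection \<open>Lambert-type double sums\<close>

text \<open>Coefficients of the sum of g i * A(z^i) over i >= 2: the index i contributes at m = d *
  i, so d runs over the proper divisors of m.\<close>

definition lamb :: "(nat \<Rightarrow> real) \<Rightarrow> (nat \<Rightarrow> real) \<Rightarrow> nat \<Rightarrow> real" where
  "lamb a g m = (\<Sum>d | d dvd m \<and> d < m. a d * g (m div d))"

lemma lamb_nonneg: "(\<And>n. a n \<ge> 0) \<Longrightarrow> (\<And>n. g n \<ge> 0) \<Longrightarrow> lamb a g m \<ge> 0"
  unfolding lamb_def by (intro sum_nonneg) auto

lemma has_sum_geometric_2:
  fixes y :: real
  assumes "0 \<le> y" "y < 1"
  shows "((\<lambda>i. y ^ i) has_sum (y\<^sup>2 / (1 - y))) {2..}"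
proof -
  have "(\<lambda>i. y ^ i * y\<^sup>2) sums (1 / (1 - y) * y\<^sup>2)"
    using assms by (intro sums_mult2 geometric_sums) auto
  then have "((\<lambda>i. y ^ i * y\<^sup>2) has_sum (1 / (1 - y) * y\<^sup>2)) UNIV"
    by (rule sums_nonneg_imp_has_sum) (use assms in auto)
  also have "?this \<longleftrightarrow> ((\<lambda>i. y ^ i) has_sum (y\<^sup>2 / (1 - y))) {2..}"
    by (rule has_sum_reindex_bij_witness[where j = "\<lambda>i. i + 2" and i = "\<lambda>i. i - 2"])
       (auto simp: power_add power2_eq_square)
  finally show ?thesis .
qed

lemma weighted_geometric:
  fixes g :: "nat \<Rightarrow> real"
  assumes g: "\<And>n. g n \<ge> 0" "\<And>n. g n \<le> 1" and y: "0 \<le> y" "y < 1"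
  shows "(\<lambda>i. g i * y ^ i) summable_on {2..}" "(\<Sum>\<^sub>\<infinity>i\<in>{2..}. g i * y ^ i) \<le> y\<^sup>2 / (1 - y)"
proof -
  note geometric = has_sum_geometric_2[OF y]
  show s: "(\<lambda>i. g i * y ^ i) summable_on {2..}"
    by (rule summable_on_comparison_test[OF has_sum_imp_summable[OF geometric]])
       (use g y in \<open>auto intro!: mult_left_le_one_le\<close>)
  show "(\<Sum>\<^sub>\<infinity>i\<in>{2..}. g i * y ^ i) \<le> y\<^sup>2 / (1 - y)"
    by (rule has_sum_mono[OF has_sum_infsum[OF s] geometric]) (use g y in \<open>auto intro!: mult_left_le_one_le\<close>)
qed

text \<open>For fixed d the sum over i >= 2 is at most (x^d)^2 / (1 - x). Summability of
  \<open>a\<close> at x^2 therefore suffices for absolute convergence of the double sum, which may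
  then be arranged by m, by d or by i.\<close>

lemma lambert:
  fixes a g :: "nat \<Rightarrow> real"
  assumes a: "\<And>n. a n \<ge> 0" "a 0 = 0" and g: "\<And>n. g n \<ge> 0" "\<And>n. g n \<le> 1"
    and x: "0 < x" "x < 1" and s: "summable (\<lambda>n. a n * (x\<^sup>2) ^ n)"
  shows "summable (\<lambda>m. lamb a g m * x ^ m)"
    and "((\<lambda>d. a d * (\<Sum>\<^sub>\<infinity>i\<in>{2..}. g i * (x ^ d) ^ i)) sums (\<Sum>m. lamb a g m * x ^ m))"
    and "((\<lambda>i. g i * (\<Sum>d. a d * (x ^ i) ^ d)) has_sum (\<Sum>m. lamb a g m * x ^ m)) {2..}"
proof -
  define P where "P = {1::nat..} \<times> {2::nat..}"
  define f where "f = (\<lambda>(d, i). a d * (g i * x ^ (d * i)))"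
  note gs = weighted_geometric[OF g]
  have xd: "x ^ d \<le> x" "x ^ d < 1" "0 \<le> x ^ d" if "d \<ge> 1" for d
  proof -
    show "x ^ d \<le> x" using power_decreasing[of 1 d x] that x by simp
    then show "x ^ d < 1" using x by linarith
    show "0 \<le> x ^ d" using x by simp
  qed
  define h where "h = (\<lambda>d. \<Sum>\<^sub>\<infinity>i\<in>{2..}. g i * (x ^ d) ^ i)"
  have h0: "0 \<le> h d" for d unfolding h_def by (rule infsum_nonneg) (use g x in auto)
  have row: "((\<lambda>i. f (d, i)) has_sum (a d * h d)) {2..}" if "d \<in> {1..}" for d
    unfolding f_def h_def using has_sum_cmult_right[OF has_sum_infsum[OF gs(1)[of "x ^ d"]]] xd[of d] that
    by (simp add: power_mult)
  have hle: "a d * h d \<le> a d * (x\<^sup>2) ^ d * (1 / (1 - x))" if "d \<ge> 1" for d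
  proof -
    have "h d \<le> (x ^ d)\<^sup>2 / (1 - x ^ d)" unfolding h_def by (rule gs(2)) (use xd[OF that] in auto)
    also have "\<dots> \<le> (x ^ d)\<^sup>2 / (1 - x)" using xd[OF that] x by (intro divide_left_mono) auto
    also have "(x ^ d)\<^sup>2 = (x\<^sup>2) ^ d" by (simp flip: power_mult add: mult.commute)
    finally have "a d * h d \<le> a d * ((x\<^sup>2) ^ d / (1 - x))" using a(1) by (rule mult_left_mono)
    then show ?thesis by simp
  qed
  have sh: "summable (\<lambda>d. a d * h d)"
  proof (rule summable_comparison_test'[where N = 1])
    show "summable (\<lambda>d. a d * (x\<^sup>2) ^ d * (1 / (1 - x)))" by (rule summable_mult2[OF s])
    show "norm (a d * h d) \<le> a d * (x\<^sup>2) ^ d * (1 / (1 - x))" if "d \<ge> 1" for d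
      using hle[OF that] a h0 by simp
  qed
  define S where "S = (\<Sum>d. a d * h d)"
  have S1: "(\<lambda>d. a d * h d) sums S" unfolding S_def using sh by (rule summable_sums)
  have "((\<lambda>d. a d * h d) has_sum S) UNIV"
    by (rule sums_nonneg_imp_has_sum[OF S1]) (use a h0 in auto)
  also have "?this \<longleftrightarrow> ((\<lambda>d. a d * h d) has_sum S) {1..}"
    by (rule has_sum_cong_neutral) (auto simp: a not_le)
  finally have S2: "((\<lambda>d. a d * h d) has_sum S) {1..}" .
  have f0: "f p \<ge> 0" for p using a g x by (auto simp: f_def split: prod.splits)
  have "f summable_on P"
  proof -
    have "(\<lambda>p. norm (f p)) summable_on Sigma {1..} (\<lambda>_. {2..})"
      unfolding Infinite_Sum.abs_summable_on_Sigma_iff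
    proof (intro conjI ballI)
      fix d :: nat assume "d \<in> {1..}"
      then show "(\<lambda>y. norm (f (d, y))) summable_on {2..}"
        using row[of d] f0 by (auto dest: has_sum_imp_summable)
    next
      have "(\<lambda>d. \<Sum>\<^sub>\<infinity>i\<in>{2..}. norm (f (d, i))) summable_on {1..} \<longleftrightarrow> (\<lambda>d. a d * h d) summable_on {1..}"
        by (rule summable_on_cong) (use row f0 in \<open>auto intro!: infsumI\<close>)
      moreover have "(\<Sum>\<^sub>\<infinity>i\<in>{2..}. norm (f (d, i))) \<ge> 0" for d by (rule infsum_nonneg) auto
      ultimately show "(\<lambda>d. norm (\<Sum>\<^sub>\<infinity>i\<in>{2..}. norm (f (d, i)))) summable_on {1..}"
        using S2 by (auto dest: has_sum_imp_summable)
    qed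
    then show ?thesis using f0 by (simp add: P_def)
  qed
  then have fP: "(f has_sum S) P"
    unfolding P_def by (intro has_sum_SigmaI[OF row S2]) auto
  have "((\<lambda>(m, d). a d * g (m div d) * x ^ m) has_sum S) (Sigma {1..} (\<lambda>m. {d. d dvd m \<and> d < m})) \<longleftrightarrow> (f has_sum S) P"
    by (rule has_sum_reindex_bij_witness[where j = "\<lambda>(m, d). (d, m div d)" and i = "\<lambda>(d, i). (d * i, d)"])
       (auto simp: P_def f_def elim!: dvdE)
  then have "((\<lambda>(m, d). a d * g (m div d) * x ^ m) has_sum S) (Sigma {1..} (\<lambda>m. {d. d dvd m \<and> d < m}))"
    using fP by simp
  then have "((\<lambda>m. lamb a g m * x ^ m) has_sum S) {1..}"
    by (rule has_sum_SigmaD) (auto simp: lamb_def sum_distrib_right intro!: has_sum_finiteI)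
  also have "?this \<longleftrightarrow> ((\<lambda>m. lamb a g m * x ^ m) has_sum S) UNIV"
    by (rule has_sum_cong_neutral) (auto simp: lamb_def not_le)
  finally have "(\<lambda>m. lamb a g m * x ^ m) sums S" by (rule has_sum_imp_sums)
  then show "summable (\<lambda>m. lamb a g m * x ^ m)" and Seq: "((\<lambda>d. a d * (\<Sum>\<^sub>\<infinity>i\<in>{2..}. g i * (x ^ d) ^ i)) sums (\<Sum>m. lamb a g m * x ^ m))"
    using S1 by (auto simp: sums_iff h_def)
  have SS: "S = (\<Sum>m. lamb a g m * x ^ m)" using \<open>(\<lambda>m. lamb a g m * x ^ m) sums S\<close> by (simp add: sums_iff)
  have "((\<lambda>(i, d). f (d, i)) has_sum S) ({2..} \<times> {1..}) \<longleftrightarrow> (f has_sum S) P"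
    by (rule has_sum_reindex_bij_witness[where j = "\<lambda>(i, d). (d, i)" and i = "\<lambda>(d, i). (i, d)"]) (auto simp: P_def)
  then have "((\<lambda>(i, d). f (d, i)) has_sum S) (Sigma {2..} (\<lambda>_. {1..}))" using fP by simp
  then have "((\<lambda>i. g i * (\<Sum>d. a d * (x ^ i) ^ d)) has_sum S) {2..}"
  proof (rule has_sum_SigmaD)
    fix i :: nat assume i: "i \<in> {2..}"
    have "summable (\<lambda>d. a d * (x ^ i) ^ d)"
    proof (rule summable_comparison_test'[OF s])
      fix d :: nat
      have "x ^ i \<le> x\<^sup>2" using i x by (auto intro: power_decreasing)
      then show "norm (a d * (x ^ i) ^ d) \<le> a d * (x\<^sup>2) ^ d"
        using a x by (auto intro!: mult_left_mono power_mono simp: abs_mult)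
    qed
    then have "(\<lambda>d. g i * (a d * (x ^ i) ^ d)) sums (g i * (\<Sum>d. a d * (x ^ i) ^ d))"
      by (intro sums_mult summable_sums)
    then have "((\<lambda>d. g i * (a d * (x ^ i) ^ d)) has_sum (g i * (\<Sum>d. a d * (x ^ i) ^ d))) UNIV"
      by (rule sums_nonneg_imp_has_sum) (use a g x in auto)
    also have "?this \<longleftrightarrow> ((\<lambda>d. case (i, d) of (i, d) \<Rightarrow> f (d, i)) has_sum (g i * (\<Sum>d. a d * (x ^ i) ^ d))) {1..}"
      by (rule has_sum_cong_neutral) (auto simp: a f_def not_le mult.commute power_mult[symmetric])
    finally show "((\<lambda>d. case (i, d) of (i, d) \<Rightarrow> f (d, i)) has_sum (g i * (\<Sum>d. a d * (x ^ i) ^ d))) {1..}" .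
  qed
  then show "((\<lambda>i. g i * (\<Sum>d. a d * (x ^ i) ^ d)) has_sum (\<Sum>m. lamb a g m * x ^ m)) {2..}"
    by (simp add: SS)
qed

subsection \<open>The radius of convergence\<close>

definition pser :: "(nat \<Rightarrow> real) \<Rightarrow> real \<Rightarrow> real" where
  "pser a x = (\<Sum>n. a n * x ^ n)"

abbreviation "t \<equiv> tn 0"

text \<open>\<open>Ac k\<close> are the coefficients of \<open>\<Sum>i\<ge>2. T\<^sub>k(z\<^sup>i) / i\<close>, and \<open>Lc k\<close> those of the sum from \<open>i = 1\<close>.\<close>
definition Ac :: "nat \<Rightarrow> nat \<Rightarrow> real" where
  "Ac k = lamb (tn k) (\<lambda>i. 1 / real i)"

definition Lc :: "nat \<Rightarrow> nat \<Rightarrow> real" where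
  "Lc k j = divsum (\<lambda>d. real d * tn k d) j / real j"

lemma Ac_nonneg [simp]: "Ac k n \<ge> 0"
  unfolding Ac_def by (rule lamb_nonneg) auto

lemma divsum_split: "j > 0 \<Longrightarrow> divsum a j = a j + (\<Sum>d | d dvd j \<and> d < j. a d)"
proof -
  assume "j > 0"
  then have "{d. d dvd j} = insert j {d. d dvd j \<and> d < j}" by (auto dest: dvd_imp_le)
  moreover have "finite {d. d dvd j \<and> d < j}" using \<open>j > 0\<close> by simp
  ultimately show ?thesis by (simp add: divsum_def)
qed

lemma Lc_eq: "Lc k j = tn k j + Ac k j"
proof (cases "j = 0")
  case False
  have "(\<Sum>d | d dvd j \<and> d < j. real d * tn k d) / real j = Ac k j"
    unfolding Ac_def lamb_def sum_divide_distrib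
    by (intro sum.cong) (use False in \<open>auto simp: real_of_nat_div\<close>)
  then show ?thesis using False by (simp add: Lc_def divsum_split add_divide_distrib)
qed (simp add: Lc_def Ac_def lamb_def)

lemma Lc_nonneg [simp]: "Lc k j \<ge> 0" by (simp add: Lc_eq)

lemma Ac_le: "Ac k n \<le> Ac 0 n"
  unfolding Ac_def lamb_def by (intro sum_mono mult_right_mono tn_antimono) auto

lemma Suc_mn_rec: "real n * mn (Suc k) (Suc n) = (\<Sum>j=1..n. real j * Lc k j * mn (Suc k) (Suc (n - j)))"
  unfolding mn_rec by (intro sum.cong) (auto simp: Lc_def Suc_diff_le)

lemma Suc_t_rec: "real n * t (Suc n) = (\<Sum>j=1..n. real j * Lc 0 j * t (Suc (n - j)))"
  unfolding tn_0_rec by (intro sum.cong) (auto simp: Lc_def Suc_diff_le)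

lemma mn_1 [simp]: "mn (Suc k) (Suc 0) = 1"
  by (simp add: mn_def tn_zero)

lemma t_1 [simp]: "t (Suc 0) = 1"
  by (simp add: tn_0_Suc forests_0)

lemma t_mono_Suc: "n > 0 \<Longrightarrow> t n \<le> t (Suc n)"
proof -
  assume n: "n > 0"
  have "real n * t n \<le> real n * Lc 0 n * t (Suc (n - n))"
    using n by (simp add: Lc_eq)
  also have "\<dots> \<le> (\<Sum>j=1..n. real j * Lc 0 j * t (Suc (n - j)))"
    by (rule member_le_sum) (use n in auto)
  also have "\<dots> = real n * t (Suc n)" by (simp only: Suc_t_rec)
  finally show ?thesis using n by simp
qed

lemma t_ge_1: "n > 0 \<Longrightarrow> t n \<ge> 1"
proof (induction n rule: nat_induct_non_zero)
  case (Suc n)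
  then show ?case using t_mono_Suc[of n] by linarith
qed simp

lemma t_partial_sums:
  assumes "x \<ge> 0"
  shows "(\<Sum>n\<le>Suc N. t n * x ^ n) \<le> x * exp (\<Sum>j=1..N. Lc 0 j * x ^ j)"
proof -
  have "(\<Sum>n\<le>Suc N. t n * x ^ n) = x * (\<Sum>n\<le>N. t (Suc n) * x ^ n)"
    by (subst sum.atMost_Suc_shift) (simp add: sum_distrib_left mult_ac)
  also have "\<dots> \<le> x * exp (\<Sum>j=1..N. Lc 0 j * x ^ j)"
    by (intro mult_left_mono exp_formula_partial_sums Suc_t_rec assms) auto
  finally show ?thesis .
qed

lemma sum_atLeast1_atMost: "a 0 = (0::real) \<Longrightarrow> (\<Sum>n=1..N. a n) = (\<Sum>n\<le>(N::nat). a n)"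
  by (rule sum.mono_neutral_left) (auto simp: Suc_le_eq)

text \<open>With x = 1/4 and d i >= d + (i - 1), the sum of x^(d i) / i over i is at most x^d (1 +
  (1/4 + 1/16 + ...) / 2) = 7/6 x^d.\<close>

lemma Lc_partial_sums_quarter:
  "(\<Sum>j=1..N. Lc 0 j * (1/4) ^ j) \<le> 7/6 * (\<Sum>n\<le>N. t n * (1/4) ^ n)"
proof -
  let ?x = "1/4 :: real"
  have "(\<Sum>j=1..N. Lc 0 j * ?x ^ j) = (\<Sum>j=1..N. \<Sum>d | d dvd j. t d * (?x ^ j / real (j div d)))"
  proof (rule sum.cong[OF refl])
    fix j assume "j \<in> {1..N}"
    then show "Lc 0 j * ?x ^ j = (\<Sum>d | d dvd j. t d * (?x ^ j / real (j div d)))"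
      unfolding Lc_def divsum_def sum_divide_distrib sum_distrib_right
      by (intro sum.cong) (auto simp: real_of_nat_div)
  qed
  also have "\<dots> = (\<Sum>(j, d)\<in>(SIGMA j:{1..N}. {d. d dvd j}). t d * (?x ^ j / real (j div d)))"
    by (subst sum.Sigma) auto
  also have "\<dots> = (\<Sum>(d, i)\<in>{(d, i). 1 \<le> d \<and> 1 \<le> i \<and> d * i \<le> N}. t d * (?x ^ (d * i) / real i))"
    by (rule sum.reindex_bij_witness[where j = "\<lambda>(j, d). (d, j div d)" and i = "\<lambda>(d, i). (d * i, d)"])
       (auto elim!: dvdE simp: Suc_le_eq)
  also have "\<dots> \<le> (\<Sum>(d, i)\<in>{1..N} \<times> {1..N}. t d * (?x ^ (d * i) / real i))"
  proof (rule sum_mono2)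
    show "{(d, i). 1 \<le> d \<and> 1 \<le> i \<and> d * i \<le> N} \<subseteq> {1..N} \<times> {1..N}"
    proof clarify
      fix d i :: nat assume "1 \<le> d" "1 \<le> i" "d * i \<le> N"
      moreover from this have "d * 1 \<le> d * i" "1 * i \<le> d * i" by (intro mult_le_mono; simp)+
      ultimately have "d \<le> N" "i \<le> N" by linarith+
      with \<open>1 \<le> d\<close> \<open>1 \<le> i\<close> show "d \<in> {1..N} \<and> i \<in> {1..N}" by simp
    qed
  qed auto
  also have "\<dots> = (\<Sum>d=1..N. \<Sum>i=1..N. t d * (?x ^ (d * i) / real i))"
    by (simp add: sum.cartesian_product)
  also have "\<dots> \<le> (\<Sum>d=1..N. t d * ?x ^ d * (7/6))"
  proof (rule sum_mono)
    fix d assume d: "d \<in> {1..N}"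
    have "(\<Sum>i=1..N. ?x ^ (d * i) / real i) \<le> (\<Sum>i=1..N. ?x ^ d * (if i = 1 then 1 else ?x ^ (i - 1) / 2))"
    proof (rule sum_mono)
      fix i assume i: "i \<in> {1..N}"
      have "d + (i - 1) \<le> d * i"
      proof -
        have "(d - 1) * (i - 1) \<ge> 0" by simp
        obtain d' i' where "d = Suc d'" "i = Suc i'" using d i by (cases d; cases i) auto
        then show ?thesis by simp
      qed
      then have "?x ^ (d * i) \<le> ?x ^ (d + (i - 1))" by (intro power_decreasing) auto
      then have le: "?x ^ (d * i) \<le> ?x ^ d * ?x ^ (i - 1)" by (simp add: power_add)
      show "?x ^ (d * i) / real i \<le> ?x ^ d * (if i = 1 then 1 else ?x ^ (i - 1) / 2)"
      proof (cases "i = 1")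
        case False
        then have "?x ^ (d * i) / real i \<le> ?x ^ (d * i) / 2" using i by (intro divide_left_mono) auto
        also have "\<dots> \<le> ?x ^ d * ?x ^ (i - 1) / 2" using le by simp
        finally show ?thesis using False by simp
      qed simp
    qed
    also have "\<dots> = ?x ^ d * (\<Sum>i=1..N. if i = 1 then 1 else ?x ^ (i - 1) / 2)"
      by (simp add: sum_distrib_left)
    also have "(\<Sum>i=1..N. if i = 1 then 1 else ?x ^ (i - 1) / 2) \<le> 7/6"
    proof -
      have N: "N \<ge> 1" using d by simp
      have "(\<Sum>i=1..n. if i = 1 then 1 else ?x ^ (i - 1) / 2) \<le> 7/6 - 1/6 * ?x ^ (n - 1)" if "n \<ge> 1" for n
        using that
      proof (induction n rule: dec_induct)
        case (step n)
        obtain n' where n': "n = Suc n'" using step by (cases n) auto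
        show ?case using step by (simp add: n')
      qed simp
      from this[OF N] zero_le_power[of ?x "N - 1"] show ?thesis by linarith
    qed
    finally have "(\<Sum>i=1..N. ?x ^ (d * i) / real i) \<le> ?x ^ d * (7/6)" by simp
    then have "t d * (\<Sum>i=1..N. ?x ^ (d * i) / real i) \<le> t d * (?x ^ d * (7/6))"
      by (intro mult_left_mono) auto
    then show "(\<Sum>i=1..N. t d * (?x ^ (d * i) / real i)) \<le> t d * ?x ^ d * (7/6)"
      by (simp only: sum_distrib_left mult.assoc)
  qed
  also have "\<dots> = 7/6 * (\<Sum>n\<le>N. t n * ?x ^ n)"
    by (simp add: sum_atLeast1_atMost[of "\<lambda>d. t d * ?x ^ d", symmetric] sum_distrib_left mult.commute)
  finally show ?thesis .
qed

lemma exp_7_12: "exp (7/12 :: real) \<le> 2"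
proof -
  have "exp (7/12 :: real) \<le> 1 + 7/12 + (7/12)\<^sup>2" by (rule exp_bound) auto
  also have "\<dots> \<le> 2" by (simp add: power2_eq_square)
  finally show ?thesis .
qed

text \<open>The bound 1/2 reproduces itself: it makes the exponent at most 7/12, and e^(7/12) / 4 <=
  1/2. This is the a priori estimate that gives T a positive radius.\<close>

lemma t_partial_sums_quarter: "(\<Sum>n\<le>N. t n * (1/4) ^ n) \<le> 1/2"
proof (induction N)
  case (Suc N)
  have "(\<Sum>n\<le>Suc N. t n * (1/4) ^ n) \<le> 1/4 * exp (\<Sum>j=1..N. Lc 0 j * (1/4) ^ j)"
    by (rule t_partial_sums) auto
  also have "\<dots> \<le> 1/4 * exp (7/12)"
    using Lc_partial_sums_quarter[of N] Suc by simp
  also have "\<dots> \<le> 1/2" using exp_7_12 by simp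
  finally show ?case .
qed simp

lemma summable_bounded_nonneg:
  fixes f :: "nat \<Rightarrow> real"
  assumes "\<And>n. f n \<ge> 0" "\<And>N. (\<Sum>n\<le>N. f n) \<le> C"
  shows "summable f"
proof (rule bounded_imp_summable)
  show "\<And>n. 0 \<le> f n" "\<And>n. sum f {..n} \<le> C" using assms by auto
qed

lemma gf_T_nth: "fps_nth gf_T n = t n"
  by (simp add: gf_T_def tn_0)

text \<open>The partial sums at 1/4 and \<open>t n\<close> >= 1 confine the radius to [1/4, 1], so
  that \<open>real_of_ereal\<close> in the definition of \<open>rho\<close> loses nothing.\<close>

lemma rho_conv_radius: "fps_conv_radius gf_T = ereal rho" and rho_ge_quarter: "1/4 \<le> rho" and rho_le_1: "rho \<le> 1"
proof -
  have eq: "fps_nth gf_T = t" by (auto simp: gf_T_nth)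
  have "summable (\<lambda>n. t n * (1/4) ^ n)"
    by (rule summable_bounded_nonneg[OF _ t_partial_sums_quarter]) auto
  then have ge: "ereal (1/4) \<le> fps_conv_radius gf_T"
    using conv_radius_geI[of t "1/4"] by (simp add: fps_conv_radius_def eq)
  have le: "fps_conv_radius gf_T \<le> 1"
  proof (rule ccontr)
    assume "\<not> ?thesis"
    then have "summable (\<lambda>n. t n * 1 ^ n)"
      by (intro summable_in_conv_radius) (simp add: fps_conv_radius_def eq one_ereal_def not_le)
    then have "t \<longlonglongrightarrow> 0" using summable_LIMSEQ_zero by simp
    then have "eventually (\<lambda>n. t n < 1) sequentially" by (rule order_tendstoD) auto
    then obtain N where "t n < 1" if "n \<ge> N" for n by (auto simp: eventually_at_top_linorder)
    then have "t (Suc N) < 1" by simp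
    then show False using t_ge_1[of "Suc N"] by simp
  qed
  show "fps_conv_radius gf_T = ereal rho" unfolding rho_def
    using ge le by (cases "fps_conv_radius gf_T") (auto simp: one_ereal_def)
  then show "1/4 \<le> rho" "rho \<le> 1" using ge le by (auto simp: one_ereal_def)
qed

lemma summable_t: "0 \<le> x \<Longrightarrow> x < rho \<Longrightarrow> summable (\<lambda>n. t n * x ^ n)"
  using summable_in_conv_radius[of x t] rho_conv_radius by (simp add: fps_conv_radius_def gf_T_nth[abs_def])

lemma rho_geI: "0 \<le> x \<Longrightarrow> summable (\<lambda>n. t n * x ^ n) \<Longrightarrow> x \<le> rho"
  using conv_radius_geI[of t x] rho_conv_radius by (simp add: fps_conv_radius_def gf_T_nth[abs_def])

section \<open>Characterising the radius by e Phi(rho) = 1\<close>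

lemma one_div_nat_le: "1 / real n \<le> 1"
  by (cases "n = 0") auto

text \<open>Only the arguments x^i with i >= 2 enter, so the series converges up to sqrt rho, which
  exceeds rho.\<close>

lemma summable_Ac: 
  assumes "0 \<le> x" "x < 1" "x\<^sup>2 < rho"
  shows "summable (\<lambda>n. Ac k n * x ^ n)"
proof (cases "x = 0")
  case True
  then show ?thesis by (simp only: summable_zero_power')
next
  case False
  have "summable (\<lambda>n. Ac 0 n * x ^ n)"
    unfolding Ac_def by (rule lambert) (use assms False in \<open>auto intro!: summable_t one_div_nat_le\<close>)
  then show ?thesis
    by (rule summable_comparison_test') (use assms in \<open>auto intro!: mult_right_mono Ac_le\<close>)
qed

text \<open>Induction on N: partial sums at most 1 give the next partial sum at most x exp(1 + A(x))
  = e Phi(x) <= 1. The bound 1 is the point where u e^-u is maximal.\<close>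

lemma rho_le_exp: "\<And>x. 0 < x \<Longrightarrow> x < 1 \<Longrightarrow> x\<^sup>2 < rho \<Longrightarrow> exp 1 * (x * exp (pser (Ac 0) x)) \<le> 1 \<Longrightarrow> (\<Sum>n\<le>N. t n * x ^ n) \<le> 1"
proof (induction N)
  case (Suc N)
  note x = Suc.prems
  have "(\<Sum>n\<le>Suc N. t n * x ^ n) \<le> x * exp (\<Sum>j=1..N. Lc 0 j * x ^ j)"
    using x by (intro t_partial_sums) auto
  also have "(\<Sum>j=1..N. Lc 0 j * x ^ j) = (\<Sum>j=1..N. t j * x ^ j) + (\<Sum>j=1..N. Ac 0 j * x ^ j)"
    by (simp add: Lc_eq sum.distrib algebra_simps)
  also have "(\<Sum>j=1..N. t j * x ^ j) = (\<Sum>j\<le>N. t j * x ^ j)"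
    by (rule sum_atLeast1_atMost) simp
  also have "\<dots> \<le> 1" by (rule Suc.IH[OF x])
  also have "(\<Sum>j=1..N. Ac 0 j * x ^ j) \<le> pser (Ac 0) x"
    unfolding pser_def by (rule sum_le_suminf) (use x in \<open>auto intro!: summable_Ac\<close>)
  also have "x * exp (1 + pser (Ac 0) x) = exp 1 * (x * exp (pser (Ac 0) x))"
    by (simp add: exp_add)
  finally show ?case using x by simp
qed simp

lemma rho_geI':
  assumes "0 < x" "x < 1" "x\<^sup>2 < rho" "exp 1 * (x * exp (pser (Ac 0) x)) \<le> 1"
  shows "summable (\<lambda>n. t n * x ^ n)" "x \<le> rho"
proof -
  show s: "summable (\<lambda>n. t n * x ^ n)"
    by (rule summable_bounded_nonneg[OF _ rho_le_exp]) (use assms in auto)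
  then show "x \<le> rho" using assms by (intro rho_geI) auto
qed

lemma sq_less_rho: "0 \<le> x \<Longrightarrow> x < rho \<Longrightarrow> x\<^sup>2 < rho" "0 \<le> x \<Longrightarrow> x < rho \<Longrightarrow> x < 1"
proof -
  assume x: "0 \<le> x" "x < rho"
  then show 1: "x < 1" using rho_le_1 by simp
  have "x\<^sup>2 \<le> x * 1" unfolding power2_eq_square using x 1 by (intro mult_left_mono) auto
  then show "x\<^sup>2 < rho" using x by simp
qed

lemma T_eq_interior:
  assumes x: "0 \<le> x" "x < rho"
  shows "pser t x = x * exp (pser t x + pser (Ac 0) x)"
proof -
  define r where "r = (x + rho) / 2"
  have r: "x < r" "0 < r" "r < rho" using x by (auto simp: r_def)
  have st: "summable (\<lambda>n. t n * y ^ n)" and sA: "summable (\<lambda>n. Ac 0 n * y ^ n)" if "0 \<le> y" "y < rho" for y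
    using that by (auto intro!: summable_t summable_Ac sq_less_rho)
  have sm: "summable (\<lambda>n. t (Suc n) * r ^ n)"
    by (rule powser_split_head(3)[OF st]) (use r in auto)
  have sl: "summable (\<lambda>n. Lc 0 n * r ^ n)"
    using summable_add[OF st[of r] sA[of r]] r by (simp add: Lc_eq algebra_simps)
  have "(\<Sum>n. t (Suc n) * x ^ n) = exp (\<Sum>n. Lc 0 n * x ^ n)"
    by (rule exp_formula_suminf[OF _ _ Suc_t_rec _ _ sm sl]) (use x r in \<open>auto simp: Lc_def\<close>)
  also have "(\<Sum>n. Lc 0 n * x ^ n) = pser t x + pser (Ac 0) x"
    unfolding pser_def Lc_eq using suminf_add[OF st[OF x] sA[OF x]] by (simp add: algebra_simps)
  finally have "x * (\<Sum>n. t (Suc n) * x ^ n) = x * exp (pser t x + pser (Ac 0) x)" by simp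
  moreover have "x * (\<Sum>n. t (Suc n) * x ^ n) = pser t x"
    unfolding pser_def by (subst powser_split_head(1)[OF st[OF x]]) simp
  ultimately show ?thesis by simp
qed

lemma u_exp_le_1: "exp 1 * (u * exp (- u)) \<le> (1::real)"
proof -
  have "u \<le> exp (u - 1)" using exp_ge_add_one_self[of "u - 1"] by simp
  then show ?thesis by (simp add: exp_diff exp_minus field_simps)
qed

text \<open>Inside the disc Phi(x) = T e^-T, and u e^-u never exceeds 1/e. Together with
  \<open>rho_geI'\<close> this locates rho between any two points where e Phi lies below and above
  1.\<close>

lemma Phi_le_interior:
  assumes x: "0 \<le> x" "x < rho"
  shows "exp 1 * (x * exp (pser (Ac 0) x)) \<le> 1"
proof -
  have "pser t x * exp (- pser t x) = x * exp (pser (Ac 0) x)"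
    by (subst T_eq_interior[OF x]) (simp add: exp_add exp_minus)
  then show ?thesis using u_exp_le_1[of "pser t x"] by simp
qed

lemma pser_Ac_nonneg: "0 \<le> x \<Longrightarrow> x < 1 \<Longrightarrow> x\<^sup>2 < rho \<Longrightarrow> pser (Ac k) x \<ge> 0"
  unfolding pser_def by (intro suminf_nonneg summable_Ac) auto

text \<open>At x = 44/100 the product e x already exceeds 5/2 * 44/100 = 1.1. The bound leaves room
  for the evaluation point 49/100 used later, which is larger than rho and whose square is below 1/4
  <= rho.\<close>

lemma rho_less: "rho < 9/20"
proof (rule ccontr)
  assume *: "\<not> ?thesis"
  then have "exp 1 * (44/100 * exp (pser (Ac 0) (44/100))) \<le> 1"
    by (intro Phi_le_interior) auto
  moreover have "exp 1 * (44/100 * exp (pser (Ac 0) (44/100))) \<ge> 5/2 * (44/100 * (1::real))"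
  proof (intro mult_mono)
    show "exp 1 \<ge> (5/2 :: real)" using exp_lower_Taylor_quadratic[of 1] by simp
    show "exp (pser (Ac 0) (44/100)) \<ge> 1"
      using * by (intro one_le_exp_iff[THEN iffD2] pser_Ac_nonneg) (auto simp: power2_eq_square)
  qed auto
  ultimately show False by simp
qed

lemma rho_pos: "0 < rho" and rho_lt_1: "rho < 1" and rho_sq_less: "rho\<^sup>2 < rho"
  using rho_ge_quarter rho_less by (auto simp: power2_eq_square)

lemma eventually_at_left_rho:
  "(\<And>x. 0 < x \<Longrightarrow> x < rho \<Longrightarrow> P x) \<Longrightarrow> eventually P (at_left rho)"
  unfolding eventually_at_left[OF rho_pos] using rho_pos by blast

lemma summable_Ac_rho: "summable (\<lambda>n. Ac k n * rho ^ n)"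
  by (rule summable_Ac) (use rho_pos rho_lt_1 rho_sq_less in auto)

text \<open>One inequality is the limit of \<open>Phi_le_interior\<close> from the left. If it were
  strict, then e Phi(x) < 1 would persist slightly to the right of rho, where Phi still converges,
  and \<open>rho_geI'\<close> would place such an x at or below rho.\<close>

lemma Phi_rho: "exp 1 * (rho * exp (pser (Ac 0) rho)) = 1"
proof (rule antisym)
  have "((\<lambda>x. exp 1 * (x * exp (pser (Ac 0) x))) \<longlongrightarrow> exp 1 * (rho * exp (pser (Ac 0) rho))) (at_left rho)"
    unfolding pser_def by (intro tendsto_intros suminf_continuous_left rho_pos) (use summable_Ac_rho in auto)
  moreover have "eventually (\<lambda>x. exp 1 * (x * exp (pser (Ac 0) x)) \<le> 1) (at_left rho)"
    by (rule eventually_at_left_rho) (simp add: Phi_le_interior)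
  ultimately show "exp 1 * (rho * exp (pser (Ac 0) rho)) \<le> 1"
    by (rule tendsto_upperbound) simp
next
  show "1 \<le> exp 1 * (rho * exp (pser (Ac 0) rho))"
  proof (rule ccontr)
    assume "\<not> ?thesis"
    define F where "F = (\<lambda>x. exp 1 * (x * exp (pser (Ac 0) x)))"
    have "ereal (1/2) \<le> conv_radius (Ac 0)"
    proof (rule conv_radius_geI_ex)
      fix r :: real assume r: "0 < r" "ereal r < ereal (1/2)"
      then have "r\<^sup>2 < 1/4" using power_strict_mono[of r "1/2" 2] by (simp add: power2_eq_square)
      then have "r\<^sup>2 < rho" using rho_ge_quarter by linarith
      then show "\<exists>z. norm z = r \<and> summable (\<lambda>n. Ac 0 n * z ^ n)"
        using summable_Ac[of r 0] r by (intro exI[of _ r]) auto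
    qed
    moreover have "ereal rho < ereal (1/2)" using rho_less by simp
    ultimately have "ereal (norm rho) < fps_conv_radius (Abs_fps (Ac 0))"
      using rho_pos less_le_trans[of "ereal rho" "ereal (1/2)" "conv_radius (Ac 0)"] by (simp add: fps_conv_radius_def)
    from continuous_eval_fps[OF this, of UNIV] have "isCont (pser (Ac 0)) rho"
      by (simp add: eval_fps_def[abs_def] pser_def[abs_def])
    then have "isCont F rho" unfolding F_def by (intro continuous_intros)
    then have "(F \<longlongrightarrow> F rho) (at_right rho)" by (simp add: isCont_def filterlim_at_split)
    moreover have "F rho < 1" using \<open>\<not> _\<close> by (simp add: F_def)
    ultimately have "eventually (\<lambda>x. F x < 1) (at_right rho)" by (rule order_tendstoD)
    moreover have "eventually (\<lambda>x. x \<in> {rho<..<1/2}) (at_right rho)"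
      using rho_less by (intro eventually_at_right_real) simp
    ultimately have "eventually (\<lambda>x. F x < 1 \<and> x \<in> {rho<..<1/2}) (at_right rho)" by (rule eventually_conj)
    then obtain x where x: "F x < 1" "rho < x" "x < 1/2"
      using eventually_happens[of _ "at_right rho"] by (auto simp: trivial_limit_at_right_real)
    have "x\<^sup>2 < (1/2)\<^sup>2" using x rho_pos by (intro power_strict_mono) auto
    then have "x\<^sup>2 < rho" using rho_ge_quarter by (simp add: power2_eq_square)
    then have "x \<le> rho" using x rho_pos by (intro rho_geI') (auto simp: F_def)
    then show False using x by simp
  qed
qed

lemma summable_t_rho: "summable (\<lambda>n. t n * rho ^ n)"
  by (rule rho_geI') (use Phi_rho rho_pos rho_lt_1 rho_sq_less in auto)

lemma tendsto_at_left_unique: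
  fixes f :: "real \<Rightarrow> real"
  assumes "(f \<longlongrightarrow> a) (at_left rho)" "(g \<longlongrightarrow> b) (at_left rho)" "\<And>x. 0 \<le> x \<Longrightarrow> x < rho \<Longrightarrow> f x = g x"
  shows "a = b"
proof -
  have "eventually (\<lambda>x. f x = g x) (at_left rho)"
    by (rule eventually_at_left_rho) (simp add: assms(3))
  then have "(g \<longlongrightarrow> a) (at_left rho)" using assms(1) Lim_transform_eventually by blast
  then show ?thesis using assms(2) tendsto_unique by (metis trivial_limit_at_left_real)
qed

lemma pser_tendsto_rho:
  assumes "\<And>n. a n \<ge> 0" "summable (\<lambda>n. a n * rho ^ n)"
  shows "(pser a \<longlongrightarrow> pser a rho) (at_left rho)"
  unfolding pser_def[abs_def] by (rule suminf_continuous_left[OF rho_pos]) (use assms in auto)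

text \<open>In the limit the functional equation and e Phi(rho) = 1 give u = e^(u - 1) for u =
  T(rho), whose only solution is 1.\<close>

lemma T_rho: "pser t rho = 1"
proof -
  have "pser t rho = rho * exp (pser t rho + pser (Ac 0) rho)"
    by (rule tendsto_at_left_unique[where f = "pser t" and g = "\<lambda>x. x * exp (pser t x + pser (Ac 0) x)"])
       (intro tendsto_intros pser_tendsto_rho summable_t_rho summable_Ac_rho tn_nonneg Ac_nonneg T_eq_interior | assumption)+
  also have "\<dots> = exp (pser t rho) * (rho * exp (pser (Ac 0) rho))" by (simp add: exp_add)
  also have "rho * exp (pser (Ac 0) rho) = exp (- 1)"
    using Phi_rho by (simp add: exp_minus field_simps)
  finally have eq: "pser t rho = exp (pser t rho - 1)" by (simp add: exp_diff exp_minus field_simps)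
  then have pos: "pser t rho > 0" by (metis exp_gt_zero)
  have "ln (pser t rho) = pser t rho - 1" by (subst eq) simp
  with pos show ?thesis by (rule ln_eq_minus_one)
qed

lemma summable_tn_rho: "summable (\<lambda>n. tn k n * rho ^ n)"
  by (rule summable_comparison_test'[OF summable_t_rho])
     (use rho_pos in \<open>auto intro!: mult_right_mono tn_antimono\<close>)

text \<open>Follows from the exponential formula for x < rho by continuity at rho. The term -1
  removes the single vertex, which \<open>mn\<close> admits and \<open>tn\<close> does not. Iterated
  from T(rho) = 1, this computes all T_k(rho).\<close>

lemma tn_rho_Suc: "pser (tn (Suc k)) rho = rho * (exp (pser (tn k) rho + pser (Ac k) rho) - 1)"
proof -
  define m where "m = (\<lambda>n. mn (Suc k) (Suc n))"
  have m: "m n = tn (Suc k) (Suc n) + (if n = 0 then 1 else 0)" for n by (simp add: m_def mn_def)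
  have m_nonneg: "m n \<ge> 0" for n by (simp add: m)
  have s1: "summable (\<lambda>n. tn (Suc k) (Suc n) * rho ^ n)"
    by (rule powser_split_head(3)[OF summable_tn_rho])
  have s2: "(\<lambda>n. (if n = 0 then 1 else 0) * rho ^ n) sums 1"
    using sums_finite[of "{0}" "\<lambda>n. (if n = 0 then 1 else 0) * rho ^ n"] by simp
  have ms: "(\<lambda>n. m n * rho ^ n) sums ((\<Sum>n. tn (Suc k) (Suc n) * rho ^ n) + 1)"
    unfolding m distrib_right by (intro sums_add summable_sums s1 s2)
  have sm: "summable (\<lambda>n. m n * rho ^ n)" using ms by (rule sums_summable)
  have sL: "summable (\<lambda>n. Lc k n * rho ^ n)"
    using summable_add[OF summable_tn_rho summable_Ac_rho] by (simp add: Lc_eq algebra_simps)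
  have "pser m rho = exp (pser (Lc k) rho)"
  proof (rule tendsto_at_left_unique[where f = "pser m" and g = "\<lambda>x. exp (pser (Lc k) x)"])
    fix x assume x: "0 \<le> x" "x < rho"
    show "pser m x = exp (pser (Lc k) x)" unfolding pser_def
      by (rule exp_formula_suminf[OF _ _ _ x sm sL]) (auto simp: m_def Suc_mn_rec Lc_def)
  qed (intro tendsto_intros pser_tendsto_rho sm sL m_nonneg Lc_nonneg)+
  also have "pser (Lc k) rho = pser (tn k) rho + pser (Ac k) rho"
    unfolding pser_def Lc_eq using suminf_add[OF summable_tn_rho summable_Ac_rho] by (simp add: algebra_simps)
  finally have "pser m rho = exp (pser (tn k) rho + pser (Ac k) rho)" .
  moreover have "pser m rho = (\<Sum>n. tn (Suc k) (Suc n) * rho ^ n) + 1"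
    using ms by (simp add: pser_def sums_iff)
  moreover have "pser (tn (Suc k)) rho = (\<Sum>n. tn (Suc k) (Suc n) * rho ^ n) * rho"
    unfolding pser_def by (subst powser_split_head(1)[OF summable_tn_rho]) simp
  ultimately have "(\<Sum>n. tn (Suc k) (Suc n) * rho ^ n) = exp (pser (tn k) rho + pser (Ac k) rho) - 1"
    and "pser (tn (Suc k)) rho = rho * (\<Sum>n. tn (Suc k) (Suc n) * rho ^ n)" by simp_all
  then show ?thesis by simp
qed

text \<open>\<open>Wc k\<close> are the coefficients of \<open>\<Sum>i\<ge>2. S\<^sub>k(z\<^sup>i)\<close>.\<close>
definition Wc :: "nat \<Rightarrow> nat \<Rightarrow> real" where
  "Wc k = lamb (sn k) (\<lambda>_. 1)"

lemma Wc_nonneg [simp]: "Wc k n \<ge> 0"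
  unfolding Wc_def by (rule lamb_nonneg) auto

lemma Wc_0 [simp]: "Wc k 0 = 0"
  by (simp add: Wc_def lamb_def)

lemma divsum_sn: "divsum (sn k) j = sn k j + Wc k j"
  by (cases "j = 0") (simp add: divsum_def, simp add: divsum_split Wc_def lamb_def)

lemma sn_conv: "sn k n = tn k n + (\<Sum>j\<le>n. (sn k j + Wc k j) * t (n - j))"
proof -
  have "(\<Sum>j=1..<n. divsum (sn k) j * t (n - j)) = (\<Sum>j\<le>n. (sn k j + Wc k j) * t (n - j))"
    unfolding divsum_sn by (rule sum.mono_neutral_left) (auto simp: not_less Suc_le_eq)
  then show ?thesis using sn_rec[of k n] by simp
qed

lemma sn_le: "sn k n \<le> real n * t n"
proof -
  have "size (filter_mset (protected k) M) \<le> size (filter_mset (protected 0) M)" for M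
    by (rule size_mset_mono) (auto simp: subseteq_mset_def)
  then show ?thesis unfolding sn_0[symmetric] sn_def by (intro of_nat_mono sum_mono)
qed

lemma summable_n_t: "0 \<le> x \<Longrightarrow> x < rho \<Longrightarrow> summable (\<lambda>n. real n * t n * x ^ n)"
proof -
  assume x: "0 \<le> x" "x < rho"
  define q where "q = x / rho"
  have q: "0 \<le> q" "q < 1" "x = q * rho" using x rho_pos by (auto simp: q_def)
  have "(\<lambda>n. real n * q ^ n) \<longlonglongrightarrow> 0" using q by (intro powser_times_n_limit_0) auto
  then have "Bseq (\<lambda>n. real n * q ^ n)" by (intro convergent_imp_Bseq convergentI)
  then obtain C where C: "\<And>n. norm (real n * q ^ n) \<le> C" by (auto simp: Bseq_def)
  show ?thesis
  proof (rule summable_comparison_test')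
    show "summable (\<lambda>n. C * (t n * rho ^ n))" by (intro summable_mult summable_t_rho)
    fix n :: nat
    have "norm (real n * t n * x ^ n) = norm (real n * q ^ n) * (t n * rho ^ n)"
      using q rho_pos by (simp add: power_mult_distrib abs_mult)
    also have "\<dots> \<le> C * (t n * rho ^ n)" using C[of n] rho_pos by (intro mult_right_mono) auto
    finally show "norm (real n * t n * x ^ n) \<le> C * (t n * rho ^ n)" .
  qed
qed

lemma summable_sn: "0 \<le> x \<Longrightarrow> x < rho \<Longrightarrow> summable (\<lambda>n. sn k n * x ^ n)"
  by (rule summable_comparison_test'[OF summable_n_t]) (auto intro!: mult_right_mono sn_le)

lemma
  shows summable_Wc: "\<And>x. 0 < x \<Longrightarrow> x < 1 \<Longrightarrow> x\<^sup>2 < rho \<Longrightarrow> summable (\<lambda>n. Wc k n * x ^ n)"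
    and Wc_has_sum: "((\<lambda>i. pser (sn k) (rho ^ i)) has_sum pser (Wc k) rho) {2..}"
proof -
  show "summable (\<lambda>n. Wc k n * x ^ n)" if "0 < x" "x < 1" "x\<^sup>2 < rho" for x
    unfolding Wc_def by (rule lambert) (use that in \<open>auto intro!: summable_sn\<close>)
  note lb = lambert[of "sn k" "\<lambda>_. 1" rho, folded Wc_def, OF _ _ _ _ rho_pos rho_lt_1 summable_sn[OF _ rho_sq_less]]
  have "((\<lambda>i. 1 * (\<Sum>d. sn k d * (rho ^ i) ^ d)) has_sum pser (Wc k) rho) {2..}"
    unfolding pser_def by (rule lb) auto
  then show "((\<lambda>i. pser (sn k) (rho ^ i)) has_sum pser (Wc k) rho) {2..}" by (simp add: pser_def)
qed

section \<open>The constant of the square root singularity\<close>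

definition GG :: real where "GG = 1 + pser (Wc 0) rho"

lemma summable_Wc_rho: "summable (\<lambda>n. Wc k n * rho ^ n)"
  by (rule summable_Wc) (use rho_pos rho_lt_1 rho_sq_less in auto)

lemma pser_Wc_nonneg: "pser (Wc k) rho \<ge> 0"
  unfolding pser_def by (rule suminf_nonneg[OF summable_Wc_rho]) (use rho_pos in auto)

lemma S0_eq:
  assumes x: "0 < x" "x < rho"
  shows "pser (sn 0) x * (1 - pser t x) = pser t x * (1 + pser (Wc 0) x)"
proof -
  have x': "x\<^sup>2 < rho" "x < 1" using sq_less_rho x by auto
  have s: "summable (\<lambda>n. t n * x ^ n)" "summable (\<lambda>n. sn 0 n * x ^ n)" "summable (\<lambda>n. Wc 0 n * x ^ n)"
    using x x' by (auto intro!: summable_t summable_sn summable_Wc)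
  define c where "c = (\<lambda>n. sn 0 n + Wc 0 n)"
  have sc: "(\<lambda>n. c n * x ^ n) sums (pser (sn 0) x + pser (Wc 0) x)"
    unfolding c_def pser_def distrib_right by (intro sums_add summable_sums s)
  have "(\<lambda>n. \<Sum>j\<le>n. (c j * x ^ j) * (t (n - j) * x ^ (n - j))) sums ((\<Sum>n. c n * x ^ n) * (\<Sum>n. t n * x ^ n))"
    by (rule Cauchy_product_sums)
       (use x sums_summable[OF sc] s in \<open>auto simp: c_def abs_mult\<close>)
  moreover have "(\<Sum>j\<le>n. (c j * x ^ j) * (t (n - j) * x ^ (n - j))) = sn 0 n * x ^ n - t n * x ^ n" for n
  proof -
    have "(\<Sum>j\<le>n. (c j * x ^ j) * (t (n - j) * x ^ (n - j))) = (\<Sum>j\<le>n. (c j * t (n - j)) * x ^ n)"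
    proof (rule sum.cong[OF refl])
      fix j assume "j \<in> {..n}"
      then have "x ^ n = x ^ j * x ^ (n - j)" by (simp flip: power_add)
      then show "(c j * x ^ j) * (t (n - j) * x ^ (n - j)) = (c j * t (n - j)) * x ^ n" by simp
    qed
    also have "\<dots> = (sn 0 n - t n) * x ^ n"
      using sn_conv[of 0 n] by (simp add: c_def sum_distrib_right)
    finally show ?thesis by (simp add: algebra_simps)
  qed
  moreover have "(\<lambda>n. sn 0 n * x ^ n - t n * x ^ n) sums (pser (sn 0) x - pser t x)"
    unfolding pser_def by (intro sums_diff summable_sums s)
  ultimately have "(pser (sn 0) x + pser (Wc 0) x) * pser t x = pser (sn 0) x - pser t x"
    using sc by (simp add: sums_iff pser_def)
  then show ?thesis by (simp add: algebra_simps)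
qed

text \<open>This is z T' = S_0: a tree of size n has n vertices, all of them 0-protected.\<close>

lemma T_deriv:
  assumes x: "0 < x" "x < rho"
  shows "(pser t has_real_derivative pser (sn 0) x / x) (at x)"
proof -
  have "(pser t has_real_derivative (\<Sum>n. diffs t n * x ^ n)) (at x)"
    unfolding pser_def[abs_def] by (rule termdiffs_strong[of t "(x + rho) / 2"]) (use x in \<open>auto intro!: summable_t\<close>)
  moreover have "(\<Sum>n. diffs t n * x ^ n) = pser (sn 0) x / x"
  proof -
    have s: "summable (\<lambda>n. sn 0 n * x ^ n)" using x by (intro summable_sn) auto
    have "pser (sn 0) x = (\<Sum>n. sn 0 (Suc n) * x ^ n) * x"
      unfolding pser_def by (subst powser_split_head(1)[OF s]) simp
    then show ?thesis using x by (simp add: diffs_def sn_0)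
  qed
  ultimately show ?thesis by simp
qed

text \<open>By l'Hopital. The derivative of (1 - T)^2 is -2 (1 - T) S_0 / x, and the functional
  equation of S_0 replaces (1 - T) S_0 by T (1 + W_0), which is continuous at rho.\<close>

lemma one_minus_T_sq_limit: "((\<lambda>x. (1 - pser t x)\<^sup>2 / (1 - x / rho)) \<longlongrightarrow> 2 * GG) (at_left rho)"
proof (rule lhopital_left)
  have pser: "eventually (\<lambda>x. 0 < x \<and> x < rho) (at_left rho)"
    by (rule eventually_at_left_rho) simp
  have Tlim: "(pser t \<longlongrightarrow> 1) (at_left rho)"
    using pser_tendsto_rho[OF _ summable_t_rho] by (simp add: T_rho)
  show "((\<lambda>x. (1 - pser t x)\<^sup>2) \<longlongrightarrow> 0) (at_left rho)"
    by (rule tendsto_eq_intros Tlim refl)+ simp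
  show "((\<lambda>x. 1 - x / rho) \<longlongrightarrow> 0) (at_left rho)"
    using rho_pos by (auto intro!: tendsto_eq_intros)
  show "eventually (\<lambda>x. 1 - x / rho \<noteq> 0) (at_left rho)"
    using pser by eventually_elim auto
  show "eventually (\<lambda>x. - 1 / rho \<noteq> 0) (at_left rho)" using rho_pos by simp
  show "eventually (\<lambda>x. ((\<lambda>x. (1 - pser t x)\<^sup>2) has_real_derivative - 2 * (pser t x * (1 + pser (Wc 0) x)) / x) (at x)) (at_left rho)"
    using pser
  proof eventually_elim
    case (elim x)
    have "((\<lambda>x. 1 - pser t x) has_real_derivative 0 - pser (sn 0) x / x) (at x)"
      using elim by (intro DERIV_diff DERIV_const T_deriv) auto
    from DERIV_power[OF this, of 2]
    have "((\<lambda>x. (1 - pser t x)\<^sup>2) has_real_derivative - 2 * (1 - pser t x) * (pser (sn 0) x / x)) (at x)"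
      by (rule DERIV_cong) (simp add: diff_divide_distrib algebra_simps)
    also have "- 2 * (1 - pser t x) * (pser (sn 0) x / x) = - 2 * (pser (sn 0) x * (1 - pser t x)) / x"
      by (simp only: times_divide_eq_right mult_ac)
    also have "pser (sn 0) x * (1 - pser t x) = pser t x * (1 + pser (Wc 0) x)" by (rule S0_eq) (use elim in auto)
    finally show ?case .
  qed
  show "eventually (\<lambda>x. ((\<lambda>x. 1 - x / rho) has_real_derivative - 1 / rho) (at x)) (at_left rho)"
    by (rule always_eventually, rule allI, rule DERIV_cong, (rule derivative_intros)+)
       (use rho_pos in auto)
  have "((\<lambda>x. (- 2 * (pser t x * (1 + pser (Wc 0) x)) / x) / (- 1 / rho)) \<longlongrightarrow> (- 2 * (1 * (1 + pser (Wc 0) rho)) / rho) / (- 1 / rho)) (at_left rho)"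
    by (intro tendsto_intros Tlim pser_tendsto_rho summable_Wc_rho) (use rho_pos in auto)
  then show "((\<lambda>x. (- 2 * (pser t x * (1 + pser (Wc 0) x)) / x) / (- 1 / rho)) \<longlongrightarrow> 2 * GG) (at_left rho)"
    using rho_pos by (simp add: GG_def add.commute)
qed

text \<open>Divided by sqrt(1 - z/rho), the hypothesis says that (1 - T) / sqrt(1 - z/rho) tends to
  b; the limit of its square is known.\<close>

lemma b_sq_eq:
  assumes "b > 0" and O: "(\<lambda>z. eval_fps gf_T z - (1 - b * sqrt (1 - z / rho))) \<in> O[at_left rho](\<lambda>z. 1 - z / rho)"
  shows "b\<^sup>2 = 2 * GG"
proof -
  define s where "s = (\<lambda>z. sqrt (1 - z / rho))"
  have pser: "eventually (\<lambda>x. 0 < x \<and> x < rho) (at_left rho)"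
    by (rule eventually_at_left_rho) simp
  have evT: "eval_fps gf_T = pser t" by (auto simp: eval_fps_def pser_def gf_T_nth)
  have s0: "(s \<longlongrightarrow> 0) (at_left rho)" unfolding s_def
    using rho_pos by (auto intro!: tendsto_eq_intros)
  obtain C where C: "eventually (\<lambda>z. norm (pser t z - (1 - b * s z)) \<le> C * norm (1 - z / rho)) (at_left rho)"
    using O by (auto simp: evT s_def elim!: landau_o.bigE)
  have "((\<lambda>z. (1 - pser t z) / s z - b) \<longlongrightarrow> 0) (at_left rho)"
  proof (rule Lim_null_comparison)
    show "((\<lambda>z. C * s z) \<longlongrightarrow> 0) (at_left rho)" using s0 by (auto intro!: tendsto_eq_intros)
    show "eventually (\<lambda>z. norm ((1 - pser t z) / s z - b) \<le> C * s z) (at_left rho)"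
      using pser C
    proof eventually_elim
      case (elim z)
      have spos: "s z > 0" and s2: "s z * s z = 1 - z / rho" using elim by (auto simp: s_def)
      have "norm ((1 - pser t z) / s z - b) = norm (pser t z - (1 - b * s z)) / s z"
      proof -
        have "(1 - pser t z) / s z - b = - (pser t z - (1 - b * s z)) / s z" using spos by (simp add: field_simps)
        then show ?thesis using spos by (simp only: norm_divide norm_minus_cancel) simp
      qed
      also have "\<dots> \<le> C * norm (1 - z / rho) / s z" using elim spos by (intro divide_right_mono) auto
      also have "norm (1 - z / rho) = s z * s z" using s2 spos by (metis abs_of_pos mult_pos_pos real_norm_def)
      finally show ?case using spos by simp
    qed
  qed
  then have "((\<lambda>z. (1 - pser t z) / s z) \<longlongrightarrow> b) (at_left rho)" by (simp add: LIM_zero_iff)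
  then have "((\<lambda>z. ((1 - pser t z) / s z)\<^sup>2) \<longlongrightarrow> b\<^sup>2) (at_left rho)" by (intro tendsto_intros)
  moreover have "eventually (\<lambda>z. ((1 - pser t z) / s z)\<^sup>2 = (1 - pser t z)\<^sup>2 / (1 - z / rho)) (at_left rho)"
    using pser by eventually_elim (simp add: s_def power_divide)
  ultimately have "((\<lambda>x. (1 - pser t x)\<^sup>2 / (1 - x / rho)) \<longlongrightarrow> b\<^sup>2) (at_left rho)"
    by (rule Lim_transform_eventually)
  then show ?thesis using one_minus_T_sq_limit tendsto_unique by (metis trivial_limit_at_left_real)
qed

unbundle fps_syntax

subsection \<open>The coefficients of (1 - z) powr (- 1/2)\<close>

fun cc :: "nat \<Rightarrow> real" where
  "cc 0 = 1"
| "cc (Suc n) = cc n * (2 * real n + 1) / (2 * real n + 2)"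

text \<open>The order of magnitude of \<open>cc\<close> in closed form; the shift by 1 keeps it
  finite at n = 0.\<close>

definition ww :: "nat \<Rightarrow> real" where "ww n = 1 / sqrt (real n + 1)"

lemma cc_pos [simp]: "cc n > 0"
  by (induction n) auto

lemma ww_pos [simp]: "ww n > 0"
  by (simp add: ww_def)

lemma ww_sq: "(ww n)\<^sup>2 = 1 / (real n + 1)"
  by (simp add: ww_def power_divide)

text \<open>The quantity (cc n)^2 (2 n + 1) decreases from 1, while in the lower bound below (cc
  n)^2 * 4 n increases from the value 1 at n = 1. Both are Wallis products.\<close>

lemma cc_sq_upper: "(cc n)\<^sup>2 * (2 * real n + 1) \<le> 1"
proof (induction n)
  case (Suc n)
  have "(cc (Suc n))\<^sup>2 * (2 * real (Suc n) + 1) = (cc n)\<^sup>2 * (2 * real n + 1) * ((2 * real n + 1) * (2 * real n + 3) / (2 * real n + 2)\<^sup>2)"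
    by (simp add: power_divide power_mult_distrib power2_eq_square)
  also have "\<dots> \<le> 1 * 1"
  proof (rule mult_mono[OF Suc])
    have pos: "(2 * real n + 2)\<^sup>2 > 0" by (rule zero_less_power) auto
    show "(2 * real n + 1) * (2 * real n + 3) / (2 * real n + 2)\<^sup>2 \<le> 1"
      unfolding divide_le_eq_1_pos[OF pos] by (simp add: power2_eq_square algebra_simps)
  qed auto
  finally show ?case by simp
qed simp

lemma cc_sq_lower: "(cc n)\<^sup>2 * (4 * real n + 4) \<ge> 1"
proof (cases n)
  case (Suc m)
  have "(cc (Suc m))\<^sup>2 * (4 * real (Suc m)) \<ge> 1"
  proof (induction m)
    case (Suc m)
    define c where "c = cc (Suc m)"
    have pos: "real (Suc m) > 0" "real (Suc (Suc m)) > 0" "2 * real (Suc m) + 2 = 2 * real (Suc (Suc m))" by auto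
    have "cc (Suc (Suc m)) = c * (2 * real (Suc m) + 1) / (2 * real (Suc (Suc m)))"
      unfolding cc.simps(2)[of "Suc m"] pos(3) c_def ..
    then have eq: "(cc (Suc (Suc m)))\<^sup>2 * (4 * real (Suc (Suc m))) =
       (cc (Suc m))\<^sup>2 * (4 * real (Suc m)) * ((2 * real (Suc m) + 1)\<^sup>2 / (4 * real (Suc m) * real (Suc (Suc m))))"
      unfolding c_def[symmetric] using pos(1,2) by (simp only: power_divide power_mult_distrib) (simp add: power2_eq_square divide_simps)
    have "1 * 1 \<le> (cc (Suc m))\<^sup>2 * (4 * real (Suc m)) * ((2 * real (Suc m) + 1)\<^sup>2 / (4 * real (Suc m) * real (Suc (Suc m))))"
    proof (rule mult_mono[OF Suc])
      have "4 * real (Suc m) * real (Suc (Suc m)) > 0" by (intro mult_pos_pos) auto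
      then show "1 \<le> (2 * real (Suc m) + 1)\<^sup>2 / (4 * real (Suc m) * real (Suc (Suc m)))"
        by (subst le_divide_eq_1_pos) (auto simp: power2_eq_square algebra_simps)
    qed auto
    then show ?case unfolding eq by simp
  qed (simp add: power2_eq_square)
  also have "\<dots> \<le> (cc (Suc m))\<^sup>2 * (4 * real (Suc m) + 4)" by (intro mult_left_mono) auto
  finally show ?thesis by (simp add: Suc)
qed simp

lemma cc_le_ww: "cc n \<le> ww n"
proof (rule power2_le_imp_le)
  have "(cc n)\<^sup>2 * (real n + 1) \<le> (cc n)\<^sup>2 * (2 * real n + 1)" by (intro mult_left_mono) auto
  then have "(cc n)\<^sup>2 * (real n + 1) \<le> 1" using cc_sq_upper[of n] by linarith
  then show "(cc n)\<^sup>2 \<le> (ww n)\<^sup>2" by (simp add: ww_sq le_divide_eq)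
qed (simp add: less_imp_le)

lemma ww_le_cc: "ww n \<le> 2 * cc n"
proof (rule power2_le_imp_le)
  show "(ww n)\<^sup>2 \<le> (2 * cc n)\<^sup>2"
    using cc_sq_lower[of n] by (simp add: ww_sq power_mult_distrib divide_le_eq algebra_simps)
qed (simp add: less_imp_le)

text \<open>\<open>2 - \<Sum>n. ee n z\<^sup>n = (1 - z)\<^sup>1\<^sup>/\<^sup>2\<close>.\<close>
definition ee :: "nat \<Rightarrow> real" where
  "ee n = (if n = 0 then 1 else cc (n - 1) - cc n)"

lemma ee_Suc: "ee (Suc n) = cc (Suc n) / (2 * real n + 1)"
proof -
  have pos: "2 * real n + 1 > 0" "2 * real n + 2 > 0" by auto
  have "ee (Suc n) = cc n * (1 - (2 * real n + 1) / (2 * real n + 2))" by (simp add: ee_def algebra_simps)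
  also have "1 - (2 * real n + 1) / (2 * real n + 2) = 1 / (2 * real n + 2)" using pos by (simp add: diff_divide_eq_iff)
  also have "cc n * (1 / (2 * real n + 2)) = cc (Suc n) / (2 * real n + 1)" using pos by simp
  finally show ?thesis .
qed

lemma ee_pos [simp]: "ee n > 0"
  by (cases n) (auto simp: ee_Suc simp del: cc.simps, simp add: ee_def)

lemma ww_cube: "ww n ^ 3 = ww n / (real n + 1)"
  using ww_sq[of n] by (simp add: power3_eq_cube power2_eq_square)

lemma ee_upper: "ee n \<le> 2 * ww n ^ 3"
proof (cases n)
  case (Suc m)
  have "ee n \<le> ww n / (2 * real m + 1)"
    unfolding Suc ee_Suc by (intro divide_right_mono cc_le_ww) auto
  also have "\<dots> \<le> ww n / ((real n + 1) / 2)"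
    using ww_pos[of n] by (intro divide_left_mono) (auto simp: Suc less_imp_le)
  finally show ?thesis by (simp add: ww_cube mult.commute)
qed (simp add: ee_def ww_def)

lemma ee_lower: "n > 0 \<Longrightarrow> cc n / (2 * real n) \<le> ee n"
proof (cases n)
  case (Suc m)
  then show ?thesis
    unfolding Suc ee_Suc by (intro divide_left_mono less_imp_le[OF cc_pos]) auto
qed simp

subsection \<open>Sequences of order n powr (- 3/2)\<close>

definition O32 :: "(nat \<Rightarrow> 'a :: real_normed_vector) \<Rightarrow> bool" where
  "O32 r \<longleftrightarrow> (\<exists>C. \<forall>n. norm (r n) \<le> C * ww n ^ 3)"

lemma O32_E:
  assumes "O32 r"
  obtains C where "C \<ge> 0" "\<And>n. norm (r n) \<le> C * ww n ^ 3"
proof -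
  obtain C where C: "\<And>n. norm (r n) \<le> C * ww n ^ 3" using assms by (auto simp: O32_def)
  have "norm (r n) \<le> max C 0 * ww n ^ 3" for n
    by (rule order_trans[OF C]) (auto intro!: mult_right_mono simp: less_imp_le)
  then show ?thesis using that[of "max C 0"] by auto
qed

lemma O32_I: "(\<And>n. norm (r n) \<le> C * ww n ^ 3) \<Longrightarrow> O32 r"
  by (auto simp: O32_def)

lemma O32_mono: "O32 s \<Longrightarrow> (\<And>n. norm (r n) \<le> K * norm (s n)) \<Longrightarrow> K \<ge> 0 \<Longrightarrow> O32 r"
proof -
  assume s: "O32 s" and le: "\<And>n. norm (r n) \<le> K * norm (s n)" and K: "K \<ge> 0"
  obtain C where C: "\<And>n. norm (s n) \<le> C * ww n ^ 3" using s by (auto simp: O32_def)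
  have "norm (r n) \<le> (K * C) * ww n ^ 3" for n
    using le[of n] mult_left_mono[OF C[of n] K] by simp
  then show ?thesis by (rule O32_I)
qed

lemma O32_add: "O32 r \<Longrightarrow> O32 s \<Longrightarrow> O32 (\<lambda>n. r n + s n)"
proof -
  assume "O32 r" "O32 s"
  then obtain C D where C: "\<And>n. norm (r n) \<le> C * ww n ^ 3" and D: "\<And>n. norm (s n) \<le> D * ww n ^ 3"
    by (auto simp: O32_def)
  show ?thesis
    by (rule O32_I[of _ "C + D"]) (use norm_triangle_mono[OF C D] in \<open>simp add: distrib_right\<close>)
qed

lemma summable_ww3: "summable (\<lambda>n. ww n ^ 3)"
proof -
  have "summable (\<lambda>n. real (Suc n) powr (- 3/2))"
    by (subst summable_Suc_iff) (simp add: summable_real_powr_iff)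
  moreover have "real (Suc n) powr (- 3/2) = ww n ^ 3" for n
  proof -
    have "real (Suc n) powr (- 3/2) = (real (Suc n) powr (-1/2)) ^ 3"
      by (subst powr_realpow[symmetric]) (auto simp: powr_powr)
    also have "real (Suc n) powr (-1/2) = ww n"
      by (simp add: powr_minus_divide powr_half_sqrt ww_def add.commute)
    finally show ?thesis .
  qed
  ultimately show ?thesis by simp
qed

lemma O32_summable: "O32 r \<Longrightarrow> summable (\<lambda>n. norm (r n))"
proof -
  assume "O32 r"
  then obtain C where C: "\<And>n. norm (r n) \<le> C * ww n ^ 3" by (auto simp: O32_def)
  show ?thesis by (rule summable_comparison_test'[OF summable_mult[OF summable_ww3, of C]]) (use C in auto)
qed

text \<open>The factor lost is 2^(3/2) = sqrt 8 < 3.\<close>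

lemma ww_half: "n \<le> 2 * m \<Longrightarrow> ww m ^ 3 \<le> 3 * ww n ^ 3"
proof -
  assume n: "n \<le> 2 * m"
  have "(ww m ^ 3)\<^sup>2 = ((ww m)\<^sup>2) ^ 3" by (simp flip: power_mult)
  also have "\<dots> = (1 / (real m + 1)) ^ 3" by (simp add: ww_sq)
  also have "\<dots> \<le> (2 / (real n + 1)) ^ 3"
    using n by (intro power_mono) (auto simp: divide_simps)
  also have "\<dots> = 8 * ((ww n)\<^sup>2) ^ 3" by (simp add: ww_sq power_divide)
  also have "\<dots> \<le> (3 * ww n ^ 3)\<^sup>2" by (simp add: power_mult_distrib flip: power_mult)
  finally show ?thesis by (rule power2_le_imp_le) (simp add: less_imp_le)
qed

text \<open>One of j and n - j is at least n / 2, so one factor is bounded by a multiple of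
  n^(-3/2), while the sum of the other converges.\<close>

lemma O32_conv:
  fixes r s :: "nat \<Rightarrow> 'a :: real_normed_algebra"
  assumes "O32 r" "O32 s"
  shows "O32 (\<lambda>n. \<Sum>j=0..n. r j * s (n - j))"
proof -
  obtain C where C: "C \<ge> 0" "\<And>n. norm (r n) \<le> C * ww n ^ 3" using assms(1) by (rule O32_E) blast
  obtain D where D: "D \<ge> 0" "\<And>n. norm (s n) \<le> D * ww n ^ 3" using assms(2) by (rule O32_E) blast
  define S where "S = (\<Sum>n. ww n ^ 3)"
  have S: "(\<Sum>j=0..n. ww j ^ 3) \<le> S" for n
    unfolding S_def by (rule sum_le_suminf[OF summable_ww3]) (auto simp: less_imp_le)
  show ?thesis
  proof (rule O32_I[of _ "C * D * 6 * S"])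
    fix n
    have "norm (\<Sum>j=0..n. r j * s (n - j)) \<le> (\<Sum>j=0..n. C * D * 3 * ww n ^ 3 * (ww j ^ 3 + ww (n - j) ^ 3))"
    proof (rule sum_norm_le)
      fix j assume "j \<in> {0..n}"
      then have j: "j \<le> n" by simp
      have "norm (r j * s (n - j)) \<le> norm (r j) * norm (s (n - j))" by (rule norm_mult_ineq)
      also have "\<dots> \<le> (C * ww j ^ 3) * (D * ww (n - j) ^ 3)"
        by (intro mult_mono C D) (auto intro: mult_nonneg_nonneg C simp: less_imp_le)
      also have "\<dots> = (C * D) * (ww j ^ 3 * ww (n - j) ^ 3)" by simp
      also have "ww j ^ 3 * ww (n - j) ^ 3 \<le> 3 * ww n ^ 3 * (ww j ^ 3 + ww (n - j) ^ 3)"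
      proof (cases "n \<le> 2 * j")
        case True
        have "ww j ^ 3 * ww (n - j) ^ 3 \<le> 3 * ww n ^ 3 * ww (n - j) ^ 3"
          by (intro mult_right_mono ww_half True) (auto simp: less_imp_le)
        also have "\<dots> \<le> 3 * ww n ^ 3 * (ww j ^ 3 + ww (n - j) ^ 3)"
          by (intro mult_left_mono) (auto simp: less_imp_le)
        finally show ?thesis .
      next
        case False
        then have "ww (n - j) ^ 3 \<le> 3 * ww n ^ 3" by (intro ww_half) auto
        then have "ww j ^ 3 * ww (n - j) ^ 3 \<le> ww j ^ 3 * (3 * ww n ^ 3)"
          by (intro mult_left_mono) (auto simp: less_imp_le)
        also have "\<dots> \<le> (ww j ^ 3 + ww (n - j) ^ 3) * (3 * ww n ^ 3)"
          by (intro mult_right_mono) (auto simp: less_imp_le)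
        finally show ?thesis by (simp add: mult_ac)
      qed
      finally show "norm (r j * s (n - j)) \<le> C * D * 3 * ww n ^ 3 * (ww j ^ 3 + ww (n - j) ^ 3)"
        using C D by (simp add: mult_left_mono mult.assoc)
    qed
    also have "\<dots> = C * D * 3 * ww n ^ 3 * ((\<Sum>j=0..n. ww j ^ 3) + (\<Sum>j=0..n. ww (n - j) ^ 3))"
      by (simp only: sum.distrib[symmetric] sum_distrib_left)
    also have "(\<Sum>j=0..n. ww (n - j) ^ 3) = (\<Sum>j=0..n. ww j ^ 3)"
      using sum.nat_diff_reindex[of "\<lambda>j. ww j ^ 3" "Suc n"] by (simp add: atLeast0AtMost lessThan_Suc_atMost)
    also have "C * D * 3 * ww n ^ 3 * ((\<Sum>j=0..n. ww j ^ 3) + (\<Sum>j=0..n. ww j ^ 3)) \<le> C * D * 3 * ww n ^ 3 * (S + S)"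
      using S[of n] C D by (intro mult_left_mono add_mono) (auto simp: less_imp_le)
    finally show "norm (\<Sum>j=0..n. r j * s (n - j)) \<le> C * D * 6 * S * ww n ^ 3" by (simp add: mult_ac)
  qed
qed

lemma exp_decay_O32:
  fixes r :: "nat \<Rightarrow> 'a :: {real_normed_div_algebra, banach}"
  assumes "conv_radius r > 1"
  shows "O32 r"
proof -
  obtain R where R: "1 < R" "ereal R < conv_radius r"
    using ereal_dense2[OF assms] by (auto simp: one_ereal_def)
  have "summable (\<lambda>n. norm (r n * of_real R ^ n))"
    using R by (intro abs_summable_in_conv_radius) auto
  then have "(\<lambda>n. norm (r n * of_real R ^ n)) \<longlonglongrightarrow> 0" by (rule summable_LIMSEQ_zero)
  then have "Bseq (\<lambda>n. norm (r n * of_real R ^ n))" by (intro convergent_imp_Bseq convergentI)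
  then obtain M where M: "M > 0" "\<And>n. norm (r n * of_real R ^ n) \<le> M" by (auto simp: Bseq_def)
  \<comment> \<open>Since R^-n = s^n * s^n and each s^n absorbs one factor n + 1, the decay is at
    least of order n^-2.\<close>
  define s where "s = 1 / sqrt R"
  have s: "0 < s" "s < 1" "s ^ 2 = 1 / R" using R by (auto simp: s_def power_divide)
  have "(\<lambda>n. real n * s ^ n) \<longlonglongrightarrow> 0" using s by (intro powser_times_n_limit_0) auto
  then have "Bseq (\<lambda>n. real n * s ^ n)" by (intro convergent_imp_Bseq convergentI)
  then obtain K where K: "K > 0" "\<And>n. norm (real n * s ^ n) \<le> K" by (auto simp: Bseq_def)
  have sK: "(real n + 1) * s ^ n \<le> K / s" for n
    using K(2)[of "Suc n"] s by (simp add: field_simps abs_mult)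
  show ?thesis
  proof (rule O32_I[of _ "M * (K / s)\<^sup>2"])
    fix n
    have "norm (r n) * R ^ n \<le> M" using M(2)[of n] R by (simp add: norm_mult norm_power)
    then have "norm (r n) \<le> M * (1 / R) ^ n" using R by (simp add: field_simps power_divide)
    also have "(1 / R) ^ n = (s ^ n)\<^sup>2" by (simp flip: s(3) power_mult add: mult.commute)
    also have "(s ^ n)\<^sup>2 \<le> (K / s)\<^sup>2 * ww n ^ 3"
    proof -
      have "((real n + 1) * s ^ n)\<^sup>2 \<le> (K / s)\<^sup>2" using s by (intro power_mono sK) auto
      then have "(s ^ n)\<^sup>2 * (real n + 1)\<^sup>2 \<le> (K / s)\<^sup>2" by (simp add: power_mult_distrib mult.commute)
      then have "(s ^ n)\<^sup>2 \<le> (K / s)\<^sup>2 * (1 / (real n + 1)\<^sup>2)" by (simp add: pos_le_divide_eq)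
      also have "1 / (real n + 1)\<^sup>2 = (ww n)\<^sup>2 * (ww n)\<^sup>2" unfolding ww_sq by (simp add: power2_eq_square)
      also have "\<dots> = ww n ^ 3 * ww n" by (simp add: power2_eq_square power3_eq_cube)
      also have "\<dots> \<le> ww n ^ 3 * 1" by (intro mult_left_mono) (auto simp: less_imp_le ww_def)
      finally show ?thesis by (simp add: mult_left_mono)
    qed
    finally show "norm (r n) \<le> M * (K / s)\<^sup>2 * ww n ^ 3" using M by (simp add: mult_left_mono mult.assoc)
  qed
qed

lemma cc_ratio: "(\<lambda>n. cc (n - j) / cc n) \<longlonglongrightarrow> 1"
proof (induction j)
  case (Suc j)
  have "(\<lambda>n. (2 * real n + 2) / (2 * real n + 1)) \<longlonglongrightarrow> 1" by real_asymp
  moreover have "filterlim (\<lambda>n. n - Suc j) at_top at_top" by (rule filterlim_minus_const_nat_at_top)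
  ultimately have "(\<lambda>n. (2 * real (n - Suc j) + 2) / (2 * real (n - Suc j) + 1)) \<longlonglongrightarrow> 1"
    by (rule filterlim_compose)
  from tendsto_mult[OF this Suc] have "(\<lambda>n. (2 * real (n - Suc j) + 2) / (2 * real (n - Suc j) + 1) * (cc (n - j) / cc n)) \<longlonglongrightarrow> 1" by simp
  moreover have "eventually (\<lambda>n. (2 * real (n - Suc j) + 2) / (2 * real (n - Suc j) + 1) * (cc (n - j) / cc n) = cc (n - Suc j) / cc n) sequentially"
    using eventually_ge_at_top[of "Suc j"]
  proof eventually_elim
    case (elim n)
    then have "n - j = Suc (n - Suc j)" by simp
    then have "cc (n - j) = cc (n - Suc j) * (2 * real (n - Suc j) + 1) / (2 * real (n - Suc j) + 2)" by (simp only: cc.simps)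
    have pos: "2 * real (n - Suc j) + 1 > 0" "2 * real (n - Suc j) + 2 > 0" by auto
    show ?case unfolding \<open>cc (n - j) = _\<close> using pos by simp
  qed
  ultimately show ?case by (rule Lim_transform_eventually)
qed (simp add: less_imp_neq[OF cc_pos, symmetric])

text \<open>A convolution factor of order n powr (- 3/2) only multiplies sequences of the order of
  \<open>cc\<close> asymptotically by its sum: the terms with \<open>2 j > n\<close> are negligible.\<close>
lemma conv_ratio:
  fixes r u :: "nat \<Rightarrow> real"
  assumes r: "O32 r" and u: "(\<lambda>n. u n / cc n) \<longlonglongrightarrow> U"
  shows "(\<lambda>n. (\<Sum>j=0..n. r j * u (n - j)) / cc n) \<longlonglongrightarrow> U * (\<Sum>n. r n)"
proof -
  obtain C where C: "C \<ge> 0" "\<And>n. norm (r n) \<le> C * ww n ^ 3" using r by (rule O32_E) blast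
  have "Bseq (\<lambda>n. u n / cc n)" using u by (intro convergent_imp_Bseq convergentI)
  then obtain B where B: "B > 0" "\<And>n. norm (u n / cc n) \<le> B" by (auto simp: Bseq_def)
  have uB: "\<bar>u n\<bar> \<le> B * ww n" for n
  proof -
    have "\<bar>u n\<bar> \<le> B * cc n" using B(2)[of n] cc_pos[of n] by (simp add: pos_divide_le_eq)
    also have "\<dots> \<le> B * ww n" using B cc_le_ww by (intro mult_left_mono) auto
    finally show ?thesis .
  qed
  \<comment> \<open>For 2 j <= n the index n - j is of order n, so u (n - j) / cc n is bounded by 4
    B and the summable \<open>r\<close> yields a majorant for Tannery's theorem.\<close>
  define f where "f = (\<lambda>j n. if 2 * j \<le> n then r j * u (n - j) / cc n else 0)"
  define g where "g = (\<lambda>n. \<Sum>j | j \<le> n \<and> n < 2 * j. r j * u (n - j) / cc n)"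
  have bound: "norm (f j n) \<le> B * 4 * norm (r j)" for j n
  proof (cases "2 * j \<le> n")
    case True
    have "(ww (n - j))\<^sup>2 \<le> (2 * ww n)\<^sup>2" using True
      by (simp add: ww_sq power_mult_distrib divide_simps of_nat_diff)
    then have ww: "ww (n - j) \<le> 2 * ww n" by (rule power2_le_imp_le) (simp add: less_imp_le)
    have "\<bar>u (n - j)\<bar> \<le> B * ww (n - j)" by (rule uB)
    also have "\<dots> \<le> B * (2 * ww n)" using ww B by (intro mult_left_mono) auto
    also have "\<dots> \<le> B * (2 * (2 * cc n))" using ww_le_cc B by (intro mult_left_mono) auto
    finally have "\<bar>u (n - j)\<bar> / cc n \<le> B * 4" by (simp add: pos_divide_le_eq)
    then have "\<bar>r j\<bar> * (\<bar>u (n - j)\<bar> / cc n) \<le> \<bar>r j\<bar> * (B * 4)" by (intro mult_left_mono) auto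
    then show ?thesis using True by (simp add: f_def abs_mult mult_ac abs_of_pos[OF cc_pos])
  qed (use B in \<open>auto simp: f_def\<close>)
  have flim: "(\<lambda>n. f j n) \<longlonglongrightarrow> r j * U" for j
  proof -
    have "(\<lambda>n. u (n - j) / cc (n - j)) \<longlonglongrightarrow> U"
      by (rule filterlim_compose[OF u filterlim_minus_const_nat_at_top])
    then have "(\<lambda>n. r j * ((u (n - j) / cc (n - j)) * (cc (n - j) / cc n))) \<longlonglongrightarrow> r j * (U * 1)"
      by (intro tendsto_intros cc_ratio)
    then have "(\<lambda>n. r j * ((u (n - j) / cc (n - j)) * (cc (n - j) / cc n))) \<longlonglongrightarrow> r j * U" by simp
    moreover have "eventually (\<lambda>n. r j * ((u (n - j) / cc (n - j)) * (cc (n - j) / cc n)) = f j n) sequentially"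
      using eventually_ge_at_top[of "2 * j"]
      by eventually_elim (simp add: f_def less_imp_neq[OF cc_pos, symmetric])
    ultimately show ?thesis by (rule Lim_transform_eventually)
  qed
  have "(\<lambda>n. \<Sum>j. f j n) \<longlonglongrightarrow> (\<Sum>j. r j * U)"
    by (rule tannerys_theorem[where M = "\<lambda>j. B * 4 * norm (r j)", THEN conjunct2, THEN conjunct2])
       (use flim bound O32_summable[OF r] in \<open>auto intro!: summable_mult always_eventually\<close>)
  also have "(\<Sum>j. r j * U) = U * (\<Sum>n. r n)"
    using suminf_mult2[OF summable_norm_cancel[OF O32_summable[OF r]], of U] by (simp add: mult.commute)
  finally have lim1: "(\<lambda>n. \<Sum>j. f j n) \<longlonglongrightarrow> U * (\<Sum>n. r n)" .
  have "g \<longlonglongrightarrow> 0"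
  proof (rule Lim_null_comparison)
    \<comment> \<open>The constant is 3 from \<open>ww_half\<close>, times 2 from the partial sums
      of \<open>ww\<close>, times 2 from comparing \<open>ww\<close> with \<open>cc\<close>.\<close>
    show "(\<lambda>n. 12 * C * B * ww n) \<longlonglongrightarrow> 0" unfolding ww_def by real_asymp
    have sww: "(\<Sum>m\<le>n. ww m) \<le> 2 / ww n" for n
    proof -
      have "(\<Sum>m<n. ww m) \<le> 2 * sqrt (real n)" for n
      proof (induction n)
        case (Suc n)
        have "(sqrt (real n + 1) - sqrt (real n)) * (sqrt (real n + 1) + sqrt (real n)) = 1"
          by (simp add: algebra_simps)
        moreover have "(sqrt (real n + 1) - sqrt (real n)) * (sqrt (real n + 1) + sqrt (real n)) \<le> (sqrt (real n + 1) - sqrt (real n)) * (2 * sqrt (real n + 1))"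
          by (intro mult_left_mono) auto
        ultimately have "1 \<le> 2 * (sqrt (real n + 1) - sqrt (real n)) * sqrt (real n + 1)"
          by (simp only: mult_ac)
        then have "ww n \<le> 2 * (sqrt (real n + 1) - sqrt (real n))"
          unfolding ww_def by (subst pos_divide_le_eq) auto
        then show ?case using Suc by (simp add: add.commute)
      qed simp
      from this[of "Suc n"] show ?thesis by (simp add: ww_def lessThan_Suc_atMost add.commute)
    qed
    show "eventually (\<lambda>n. norm (g n) \<le> 12 * C * B * ww n) sequentially"
    proof (rule always_eventually, rule allI)
      fix n
      have "norm (g n) \<le> (\<Sum>j | j \<le> n \<and> n < 2 * j. (C * (3 * ww n ^ 3)) * (B * ww (n - j)) / cc n)"
        unfolding g_def
      proof (rule sum_norm_le)
        fix j assume "j \<in> {j. j \<le> n \<and> n < 2 * j}"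
        then have "ww j ^ 3 \<le> 3 * ww n ^ 3" by (intro ww_half) auto
        then have "\<bar>r j\<bar> \<le> C * (3 * ww n ^ 3)" using C(2)[of j] mult_left_mono[OF _ C(1)] by fastforce
        then have "\<bar>r j\<bar> * \<bar>u (n - j)\<bar> \<le> (C * (3 * ww n ^ 3)) * (B * ww (n - j))"
          by (intro mult_mono uB) (auto intro!: mult_nonneg_nonneg C simp: less_imp_le)
        then show "norm (r j * u (n - j) / cc n) \<le> (C * (3 * ww n ^ 3)) * (B * ww (n - j)) / cc n"
          by (simp add: abs_mult divide_right_mono less_imp_le)
      qed
      also have "\<dots> = (C * (3 * ww n ^ 3)) * B / cc n * (\<Sum>j | j \<le> n \<and> n < 2 * j. ww (n - j))"
        by (simp add: sum_distrib_left mult_ac)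
      also have "\<dots> \<le> (C * (3 * ww n ^ 3)) * B / cc n * (2 / ww n)"
      proof (rule mult_left_mono)
        have "(\<Sum>j | j \<le> n \<and> n < 2 * j. ww (n - j)) \<le> (\<Sum>j\<le>n. ww (n - j))"
          by (rule sum_mono2) (auto simp: less_imp_le)
        also have "\<dots> = (\<Sum>j\<le>n. ww j)"
          using sum.nat_diff_reindex[of ww "Suc n"] by (simp add: lessThan_Suc_atMost)
        also have "\<dots> \<le> 2 / ww n" by (rule sww)
        finally show "(\<Sum>j | j \<le> n \<and> n < 2 * j. ww (n - j)) \<le> 2 / ww n" .
      qed (use C B in \<open>auto simp: less_imp_le\<close>)
      also have "(C * (3 * ww n ^ 3)) * B / cc n * (2 / ww n) \<le> (C * (3 * ww n ^ 3)) * B / (ww n / 2) * (2 / ww n)"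
        using ww_le_cc[of n] C B by (intro mult_right_mono divide_left_mono) (auto simp: less_imp_le)
      also have "\<dots> = 12 * C * B * ww n"
        using less_imp_neq[OF ww_pos, of n, symmetric] by (simp add: power3_eq_cube field_simps)
      finally show "norm (g n) \<le> 12 * C * B * ww n" .
    qed
  qed
  from tendsto_add[OF lim1 this] have "(\<lambda>n. (\<Sum>j. f j n) + g n) \<longlonglongrightarrow> U * (\<Sum>n. r n)" by simp
  moreover have "(\<Sum>j. f j n) + g n = (\<Sum>j=0..n. r j * u (n - j)) / cc n" for n
  proof -
    have "(\<Sum>j. f j n) = (\<Sum>j | 2 * j \<le> n. r j * u (n - j) / cc n)"
    proof -
      have "finite {j. 2 * j \<le> n}" by (rule finite_subset[of _ "{..n}"]) auto
      then have "(\<Sum>j. f j n) = (\<Sum>j | 2 * j \<le> n. f j n)" by (intro suminf_finite) (auto simp: f_def)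
      then show ?thesis by (simp add: f_def)
    qed
    moreover have "{0..n} = {j. 2 * j \<le> n} \<union> {j. j \<le> n \<and> n < 2 * j}" by auto
    moreover have "finite {j. 2 * j \<le> n}" by (rule finite_subset[of _ "{..n}"]) auto
    ultimately show ?thesis
      by (simp add: g_def sum_divide_distrib) (subst sum.union_disjoint, auto)
  qed
  ultimately show ?thesis by simp
qed

lemma cc_rec: "(2 * real n + 2) * cc (Suc n) = (2 * real n + 1) * cc n"
proof -
  have "2 * real n + 2 \<noteq> 0" by linarith
  then show ?thesis by simp
qed

text \<open>With C the series of \<open>cc\<close>, the recurrence reads 2 (1 - z) C' = C, so (1 -
  z) C^2 has derivative 0.\<close>

lemma one_minus_X_cc: "(1 - fps_X) * Abs_fps cc ^ 2 = 1"
proof -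
  define C where "C = Abs_fps cc"
  have d: "2 * ((1 - fps_X) * fps_deriv C) = C"
  proof (rule fps_ext)
    fix n show "(2 * ((1 - fps_X) * fps_deriv C)) $ n = C $ n"
    proof (cases n)
      case (Suc m)
      then show ?thesis using cc_rec[of "Suc m"]
        by (simp add: C_def algebra_simps numeral_fps_const fps_mult_left_const_nth del: cc.simps)
    qed (simp add: C_def numeral_fps_const fps_mult_left_const_nth)
  qed
  have "fps_deriv ((1 - fps_X) * C ^ 2) = C * (2 * ((1 - fps_X) * fps_deriv C)) - C ^ 2"
    by (simp add: fps_deriv_power power2_eq_square algebra_simps)
  also have "\<dots> = 0" unfolding d by (simp add: power2_eq_square)
  finally have "(1 - fps_X) * C ^ 2 = fps_const (((1 - fps_X) * C ^ 2) $ 0)"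
    by (simp only: fps_deriv_eq_0_iff)
  then show ?thesis by (simp add: C_def power2_eq_square)
qed

lemma one_minus_X_times_cc: "(1 - fps_X) * Abs_fps cc = 2 - Abs_fps ee"
proof (rule fps_ext)
  fix n show "((1 - fps_X) * Abs_fps cc) $ n = (2 - Abs_fps ee) $ n"
    by (cases n) (auto simp: ee_def algebra_simps numeral_fps_const simp del: cc.simps(2))
qed

lemma O32_finite_support:
  assumes "\<And>n. n > N \<Longrightarrow> r n = 0"
  shows "O32 (r :: nat \<Rightarrow> real)"
proof (rule O32_I[of _ "Max ((\<lambda>n. \<bar>r n\<bar> / ww n ^ 3) ` {..N})"])
  fix n
  show "norm (r n) \<le> Max ((\<lambda>n. \<bar>r n\<bar> / ww n ^ 3) ` {..N}) * ww n ^ 3"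
  proof (cases "n \<le> N")
    case True
    then have "\<bar>r n\<bar> / ww n ^ 3 \<le> Max ((\<lambda>n. \<bar>r n\<bar> / ww n ^ 3) ` {..N})" by (intro Max_ge) auto
    then show ?thesis by (simp add: pos_divide_le_eq)
  next
    case False
    have "0 \<le> \<bar>r 0\<bar> / ww 0 ^ 3" by (simp add: less_imp_le)
    also have "\<dots> \<le> Max ((\<lambda>n. \<bar>r n\<bar> / ww n ^ 3) ` {..N})" by (intro Max_ge) auto
    finally show ?thesis using False assms[of n] by (simp add: less_imp_le)
  qed
qed

subsection \<open>Composition with a probability generating function\<close>

definition fc :: "real fps \<Rightarrow> complex fps" where "fc f = Abs_fps (\<lambda>n. complex_of_real (f $ n))"

lemma fc_nth [simp]: "fc f $ n = complex_of_real (f $ n)" by (simp add: fc_def)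

lemma fc_mult: "fc (f * g) = fc f * fc g"
  by (rule fps_ext) (simp add: fps_mult_nth)

lemma fc_1 [simp]: "fc 1 = 1" by (rule fps_ext) simp

lemma fc_radius: "fps_conv_radius (fc f) = fps_conv_radius f"
proof -
  have "conv_radius (\<lambda>n. norm (fc f $ n)) = conv_radius (\<lambda>n. norm (f $ n))" by simp
  then show ?thesis by (simp only: conv_radius_norm fps_conv_radius_def)
qed

locale pgf =
  fixes phi :: "nat \<Rightarrow> real" and r :: real
  assumes phi_nonneg: "\<And>n. phi n \<ge> 0" and phi_0: "phi 0 = 0" and phi_1: "phi 1 > 0"
    and phi_sums: "phi sums 1" and r: "r > 1" and phi_summable: "summable (\<lambda>n. phi n * r ^ n)"
begin

text \<open>\<open>Gf\<close> is \<open>(1 - \<Phi>) / (1 - z)\<close>, \<open>Ct\<close> is \<open>(1 - \<Phi>)\<^sup>-\<^sup>1\<^sup>/\<^sup>2\<close>, and \<open>Qr\<close> is \<open>Gf\<^sup>-\<^sup>1\<^sup>/\<^sup>2\<close>.\<close>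
definition Phi where "Phi = Abs_fps phi"
definition Gf where "Gf = Abs_fps (\<lambda>j. 1 - (\<Sum>i\<le>j. phi i))"
definition Ct where "Ct = Abs_fps cc oo Phi"
definition Qr where "Qr = Ct * inverse (Abs_fps cc)"

lemma Phi_0 [simp]: "Phi $ 0 = 0" by (simp add: Phi_def phi_0)

lemma power_nonneg: "(Phi ^ i) $ n \<ge> 0"
proof (induction i arbitrary: n)
  case (Suc i)
  then show ?case by (auto simp: fps_mult_nth Phi_def phi_nonneg intro!: sum_nonneg mult_nonneg_nonneg)
qed simp

text \<open>All powers of \<open>Phi\<close> have nonnegative coefficients, so domination of
  coefficients passes through the composition. Errors can thus be transported without knowing the
  composed error series.\<close>

lemma compose_bound:
  assumes "\<And>n. \<bar>F n\<bar> \<le> C * G n"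
  shows "\<bar>(Abs_fps F oo Phi) $ n\<bar> \<le> C * (Abs_fps G oo Phi) $ n"
proof -
  have "\<bar>(Abs_fps F oo Phi) $ n\<bar> \<le> (\<Sum>i=0..n. \<bar>F i\<bar> * (Phi ^ i) $ n)"
    unfolding fps_compose_nth by (rule order_trans[OF sum_abs]) (simp add: abs_mult power_nonneg)
  also have "\<dots> \<le> (\<Sum>i=0..n. C * G i * (Phi ^ i) $ n)"
    by (intro sum_mono mult_right_mono assms power_nonneg)
  finally show ?thesis by (simp add: fps_compose_nth sum_distrib_left mult.assoc)
qed

lemma Gf_eq: "(1 - fps_X) * Gf = 1 - Phi"
proof (rule fps_ext)
  fix n show "((1 - fps_X) * Gf) $ n = (1 - Phi) $ n"
    by (cases n) (auto simp: Gf_def Phi_def algebra_simps phi_0)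
qed

lemma Ct_eq: "(1 - Phi) * Ct ^ 2 = 1"
proof -
  have "((1 - fps_X) * Abs_fps cc ^ 2) oo Phi = 1" by (simp add: one_minus_X_cc)
  then show ?thesis
    by (simp add: fps_compose_mult_distrib fps_compose_sub_distrib fps_compose_power Ct_def)
qed

lemma Ct_eq_mult: "Ct = Qr * Abs_fps cc"
  by (simp add: Qr_def mult.assoc inverse_mult_eq_1)

lemma Qr_sq: "Qr ^ 2 * Gf = 1"
proof -
  let ?C = "Abs_fps cc"
  have "(1 - fps_X) * Gf * (Qr * ?C) ^ 2 = 1"
    using Ct_eq unfolding Gf_eq[symmetric] Ct_eq_mult .
  then have "((1 - fps_X) * ?C ^ 2) * (Qr ^ 2 * Gf) = 1"
    by (simp add: power_mult_distrib mult_ac)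
  then show ?thesis by (simp only: one_minus_X_cc mult_1_left)
qed

lemma Gf_nonneg: "Gf $ n \<ge> 0"
proof -
  have "(\<Sum>i\<le>n. phi i) \<le> suminf phi"
    by (rule sum_le_suminf) (use phi_sums phi_nonneg in \<open>auto simp: sums_iff\<close>)
  then show ?thesis using phi_sums by (simp add: Gf_def sums_iff)
qed

text \<open>The coefficient \<open>Gf $ n\<close> is the tail probability, the sum of phi i over i >
  n; this is Markov's inequality for r^i.\<close>

lemma Gf_le: "Gf $ n * r ^ n \<le> (\<Sum>n. phi n * r ^ n)"
proof -
  have s: "summable phi" using phi_sums by (rule sums_summable)
  have eq: "Gf $ n = (\<Sum>i. phi (i + Suc n))"
    using suminf_minus_initial_segment[OF s, of "Suc n"] phi_sums by (simp add: Gf_def sums_iff lessThan_Suc_atMost)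
  have s1: "summable (\<lambda>i. phi (i + Suc n))" using s by (rule summable_ignore_initial_segment)
  have s2: "summable (\<lambda>i. phi (i + Suc n) * r ^ (i + Suc n))" using phi_summable by (rule summable_ignore_initial_segment)
  have "Gf $ n * r ^ n = (\<Sum>i. phi (i + Suc n) * r ^ n)" unfolding eq using s1 by (simp add: suminf_mult2)
  also have "\<dots> \<le> (\<Sum>i. phi (i + Suc n) * r ^ (i + Suc n))"
    by (rule suminf_le[OF _ summable_mult2[OF s1] s2])
       (use r in \<open>intro mult_left_mono power_increasing phi_nonneg; simp\<close>)
  also have "\<dots> \<le> (\<Sum>n. phi n * r ^ n)"
  proof -
    have "(\<Sum>i<Suc n. phi i * r ^ i) \<ge> 0"
      by (intro sum_nonneg mult_nonneg_nonneg phi_nonneg) (use r in auto)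
    then show ?thesis using suminf_minus_initial_segment[OF phi_summable, of "Suc n"] by linarith
  qed
  finally show ?thesis .
qed

lemma radius_Phi: "fps_conv_radius Phi \<ge> r"
  using conv_radius_geI[of phi r] phi_summable r by (simp add: fps_conv_radius_def Phi_def)

lemma radius_Gf: "fps_conv_radius Gf \<ge> r"
  unfolding fps_conv_radius_def
proof (rule conv_radius_geI_ex)
  fix s :: real assume s: "0 < s" "ereal s < ereal r"
  define K where "K = (\<Sum>n. phi n * r ^ n)"
  have "summable (\<lambda>n. Gf $ n * s ^ n)"
  proof (rule summable_comparison_test')
    show "summable (\<lambda>n. K * (s / r) ^ n)" using s by (intro summable_mult summable_geometric) auto
    fix n
    have "Gf $ n * r ^ n * (s / r) ^ n \<le> K * (s / r) ^ n"
      unfolding K_def using s r by (intro mult_right_mono Gf_le) auto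
    then show "norm (Gf $ n * s ^ n) \<le> K * (s / r) ^ n"
      using s r Gf_nonneg[of n] by (simp add: power_divide)
  qed
  then show "\<exists>z. norm z = s \<and> summable (\<lambda>n. Gf $ n * z ^ n)" using s by (intro exI[of _ s]) auto
qed

text \<open>The numbers phi n * (1 - Re (z^n)) are nonnegative and sum to 0. The one with n = 1
  forces Re z = 1, and then |z| <= 1 leaves only z = 1.\<close>

lemma Phi_eq_1_imp:
  assumes z: "norm z \<le> 1" and eq: "eval_fps (fc Phi) z = 1"
  shows "z = 1"
proof -
  have "ereal (norm z) < fps_conv_radius (fc Phi)"
    unfolding fc_radius using radius_Phi z r by (meson ereal_less(4) le_ereal_less order_le_less_trans less_le_trans less_ereal.simps(1))
  then have "(\<lambda>n. fc Phi $ n * z ^ n) sums 1"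
    using sums_eval_fps[of z "fc Phi"] eq by simp
  then have "(\<lambda>n. complex_of_real (phi n) * z ^ n) sums 1" by (simp add: Phi_def)
  then have "(\<lambda>n. Re (complex_of_real (phi n) * z ^ n)) sums Re 1" by (rule sums_Re)
  then have "(\<lambda>n. phi n - phi n * Re (z ^ n)) sums (1 - 1)"
    using phi_sums by (intro sums_diff) simp_all
  then have s: "(\<lambda>n. phi n * (1 - Re (z ^ n))) sums 0" by (simp add: algebra_simps)
  have nn: "phi n * (1 - Re (z ^ n)) \<ge> 0" for n
  proof -
    have "Re (z ^ n) \<le> norm (z ^ n)" by (rule complex_Re_le_cmod)
    also have "\<dots> \<le> 1" using z by (simp add: norm_power power_le_one)
    finally show ?thesis using phi_nonneg by simp
  qed
  have "phi n * (1 - Re (z ^ n)) = 0" for n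
    using s nn suminf_eq_zero_iff[OF sums_summable[OF s] nn] by (simp add: sums_iff)
  from this[of 1] have "Re z = 1" using phi_1 by auto
  moreover have "(Re z)\<^sup>2 + (Im z)\<^sup>2 \<le> 1"
    using z power_mono[OF z, of 2] by (simp add: cmod_power2)
  ultimately show ?thesis by (simp add: complex_eq_iff)
qed

text \<open>A zero of \<open>Gf\<close> is a point where Phi = 1, hence z = 1. There the value is a
  sum of nonnegative tail probabilities whose first one equals 1.\<close>

lemma eval_Gf_neq_0:
  assumes z: "norm z \<le> 1"
  shows "eval_fps (fc Gf) z \<noteq> 0"
proof
  assume 0: "eval_fps (fc Gf) z = 0"
  have lt: "ereal (norm z) < ereal r" using z r by simp
  have "fc ((1 - fps_X) * Gf) = fc (1 - Phi)" by (simp only: Gf_eq)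
  moreover have "fc (1 - fps_X) = 1 - fps_X" by (rule fps_ext) simp
  moreover have "fc (1 - Phi) = 1 - fc Phi" by (rule fps_ext) simp
  ultimately have eq: "(1 - fps_X) * fc Gf = 1 - fc Phi" by (simp add: fc_mult)
  have rP: "ereal (norm z) < fps_conv_radius (fc Phi)" and rG: "ereal (norm z) < fps_conv_radius (fc Gf)"
    unfolding fc_radius using less_le_trans[OF lt radius_Phi] less_le_trans[OF lt radius_Gf] by auto
  have rX: "fps_conv_radius (1 - fps_X :: complex fps) = \<infinity>"
    using fps_conv_radius_diff[of "1 :: complex fps" fps_X] by simp
  have "eval_fps ((1 - fps_X) * fc Gf) z = eval_fps (1 - fps_X) z * eval_fps (fc Gf) z"
    by (rule eval_fps_mult) (use rX rG in auto)
  then have "eval_fps (1 - fc Phi) z = 0" by (simp add: eq 0)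
  also have "eval_fps (1 - fc Phi) z = 1 - eval_fps (fc Phi) z"
    by (subst eval_fps_diff) (use rP in auto)
  finally have z1: "z = 1" using Phi_eq_1_imp[OF z] by simp
  have "(\<lambda>n. complex_of_real (Gf $ n)) sums 0"
    using sums_eval_fps[OF rG] 0 z1 by simp
  then have s: "(\<lambda>n. Gf $ n) sums 0" using sums_Re by fastforce
  have "Gf $ 0 = 0"
    using s suminf_eq_zero_iff[OF sums_summable[OF s] Gf_nonneg] by (simp add: sums_iff)
  then show False by (simp add: Gf_def phi_0)
qed

text \<open>By compactness \<open>Gf\<close> is free of zeros on a disc of radius 1 + e. There it
  has a holomorphic square root q, and the Taylor series of 1/q has radius at least 1 + e. Its
  square and that of \<open>Qr\<close> are both the inverse of \<open>Gf\<close>.\<close>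

lemma radius_Qr: "fps_conv_radius Qr > 1"
proof -
  define G where "G = eval_fps (fc Gf)"
  define U where "U = {z \<in> ball 0 r. G z \<noteq> 0}"
  have sub: "ball (0 :: complex) r \<subseteq> eball 0 (fps_conv_radius (fc Gf))"
  proof
    fix z :: complex assume "z \<in> ball 0 r"
    then have "ereal (norm z) < ereal r" by simp
    from less_le_trans[OF this radius_Gf] show "z \<in> eball 0 (fps_conv_radius (fc Gf))"
      by (simp add: fc_radius)
  qed
  have hol: "G holomorphic_on ball 0 r" unfolding G_def by (rule holomorphic_on_eval_fps[OF sub])
  have "open U"
  proof -
    have "U = ball 0 r \<inter> G -` (- {0})" by (auto simp: U_def)
    moreover have "open (ball 0 r \<inter> G -` (- {0}))"
      by (intro continuous_open_preimage holomorphic_on_imp_continuous_on hol) auto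
    ultimately show ?thesis by simp
  qed
  moreover have "cball 0 1 \<subseteq> U" using eval_Gf_neq_0 r by (auto simp: U_def G_def)
  ultimately obtain e where e: "e > 0" "(\<Union>x\<in>cball 0 1. ball x e) \<subseteq> U"
    using compact_subset_open_imp_ball_epsilon_subset[of "cball 0 1" U] by auto
  define B where "B = ball (0::complex) (1 + e)"
  have BU: "B \<subseteq> U"
  proof
    fix z assume z: "z \<in> B"
    show "z \<in> U"
    proof (cases "norm z \<le> 1")
      case True
      then show ?thesis using \<open>cball 0 1 \<subseteq> U\<close> by auto
    next
      case False
      \<comment> \<open>A point outside the unit disc is compared with its radial projection z /
        |z|, from which its distance is |z| - 1 < e.\<close>
      have "z - z / of_real (norm z) = z * of_real ((norm z - 1) / norm z)"
      proof -
        have "complex_of_real (norm z) \<noteq> 0" using False by auto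
        then show ?thesis by (simp add: diff_divide_distrib right_diff_distrib)
      qed
      then have "norm (z - z / of_real (norm z)) = norm z * \<bar>(norm z - 1) / norm z\<bar>"
        by (simp only: norm_mult norm_of_real)
      also have "\<bar>(norm z - 1) / norm z\<bar> = (norm z - 1) / norm z" using False by (intro abs_of_nonneg) auto
      also have "norm z * ((norm z - 1) / norm z) = norm z - 1"
      proof -
        have "norm z \<noteq> 0" using False by linarith
        then show ?thesis by (metis nonzero_mult_div_cancel_left times_divide_eq_right)
      qed
      finally have "norm (z - z / of_real (norm z)) = norm z - 1" .
      then have "z \<in> ball (z / of_real (norm z)) e" using z by (simp add: B_def dist_norm norm_minus_commute)
      moreover have "z / of_real (norm z) \<in> cball 0 1" by (simp add: norm_divide)
      ultimately show ?thesis using e by blast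
    qed
  qed
  have "G holomorphic_on B" by (rule holomorphic_on_subset[OF hol]) (use BU in \<open>auto simp: U_def\<close>)
  then obtain q where q: "q holomorphic_on B" "\<And>z. z \<in> B \<Longrightarrow> G z = q z ^ 2"
    by (rule contractible_imp_holomorphic_sqrt) (use BU in \<open>auto simp: B_def U_def convex_imp_contractible\<close>)
  have q0: "q z \<noteq> 0" if "z \<in> B" for z using q(2)[OF that] BU that by (auto simp: U_def)
  have holi: "(\<lambda>z. inverse (q z)) holomorphic_on B" using q q0 by (intro holomorphic_intros)
  define Q where "Q = fps_expansion (\<lambda>z. inverse (q z)) 0"
  have 0: "0 \<in> B" "open B" using e by (auto simp: B_def)
  have Qexp: "(\<lambda>z. inverse (q z)) has_fps_expansion Q"
    unfolding Q_def by (rule has_fps_expansion_fps_expansion[OF 0(2,1) holi])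
  have radQ: "fps_conv_radius Q \<ge> ereal (1 + e)"
    unfolding Q_def by (rule conv_radius_fps_expansion) (use holi in \<open>simp add: B_def\<close>)
  have Gexp: "G has_fps_expansion fc Gf"
    unfolding G_def using radius_Gf r
    by (intro eval_fps_has_fps_expansion) (auto simp: fc_radius intro: less_le_trans[of 0 "ereal r"])
  have "(\<lambda>z. (inverse (q z) * inverse (q z)) * G z) has_fps_expansion (Q * Q) * fc Gf"
    by (intro has_fps_expansion_mult Qexp Gexp)
  moreover have "eventually (\<lambda>z. (inverse (q z) * inverse (q z)) * G z = 1) (nhds 0)"
    using eventually_nhds_in_open[OF 0(2,1)]
    by eventually_elim (use q q0 in \<open>auto simp: power2_eq_square field_simps\<close>)
  ultimately have "(\<lambda>_. 1 :: complex) has_fps_expansion (Q * Q) * fc Gf"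
    by (subst (asm) has_fps_expansion_cong[OF _ refl]) auto
  then have "(Q * Q) * fc Gf = 1"
    using fps_expansion_unique_complex[OF _ has_fps_expansion_1] by blast
  moreover have "fc Qr * fc Qr * fc Gf = 1"
    using arg_cong[OF Qr_sq, of fc] by (simp add: fc_mult power2_eq_square)
  moreover have "fc Gf \<noteq> 0" using calculation(1) by auto
  ultimately have "fc Qr ^ 2 = Q ^ 2" by (metis mult_right_cancel power2_eq_square)
  \<comment> \<open>Formal power series over a field form an integral domain, so square roots agree
    up to a sign; the sign does not change the radius.\<close>
  then have "fc Qr = Q \<or> fc Qr = - Q" by (rule power2_eq_iff[THEN iffD1])
  then have "fps_conv_radius (fc Qr) = fps_conv_radius Q" by auto
  then show ?thesis
    using radQ e by (simp add: fc_radius) (auto intro: less_le_trans[of _ "ereal (1 + e)"] simp: one_ereal_def)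
qed

lemma O32_Qr: "O32 (fps_nth Qr)" and O32_Gf: "O32 (fps_nth Gf)"
proof -
  have "1 < fps_conv_radius Gf"
    using radius_Gf r by (auto intro: less_le_trans[of _ "ereal r"] simp: one_ereal_def)
  then show "O32 (fps_nth Qr)" "O32 (fps_nth Gf)"
    using radius_Qr by (auto intro!: exp_decay_O32 simp: fps_conv_radius_def)
qed

text \<open>Since \<open>Ct\<close> is \<open>Qr\<close> times the series of \<open>cc\<close>, the
  quotient tends to Qr(1). This is nonnegative as a limit of nonnegative terms and nonzero because
  Qr(1)^2 Gf(1) = 1.\<close>

lemma Ct_asymp: obtains l where "l > 0" "(\<lambda>n. Ct $ n / cc n) \<longlonglongrightarrow> l"
proof -
  define l where "l = (\<Sum>n. Qr $ n)"
  have "(\<lambda>n. cc n / cc n) \<longlonglongrightarrow> 1" by (simp add: less_imp_neq[OF cc_pos, symmetric])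
  from conv_ratio[OF O32_Qr this] have lim: "(\<lambda>n. Ct $ n / cc n) \<longlonglongrightarrow> l"
    by (simp add: Ct_eq_mult fps_mult_nth l_def)
  have "Ct $ n \<ge> 0" for n
    by (auto simp: Ct_def fps_compose_nth power_nonneg less_imp_le intro!: sum_nonneg mult_nonneg_nonneg)
  then have "l \<ge> 0" by (intro tendsto_lowerbound[OF lim]) (auto intro!: always_eventually divide_nonneg_pos)
  moreover have "l \<noteq> 0"
  proof
    assume "l = 0"
    then have e0: "eval_fps Qr 1 = 0" by (simp add: l_def eval_fps_def)
    have rG: "1 < fps_conv_radius Gf"
      using radius_Gf r by (auto intro: less_le_trans[of _ "ereal r"] simp: one_ereal_def)
    have rQ2: "1 < fps_conv_radius (Qr ^ 2)"
      unfolding power2_eq_square using fps_conv_radius_mult[of Qr Qr] radius_Qr by (auto intro: less_le_trans)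
    have "eval_fps (Qr ^ 2 * Gf) 1 = eval_fps (Qr ^ 2) 1 * eval_fps Gf 1"
      by (rule eval_fps_mult) (use rG rQ2 in \<open>auto simp: one_ereal_def\<close>)
    also have "eval_fps (Qr ^ 2) 1 = eval_fps Qr 1 ^ 2"
      by (rule eval_fps_power) (use radius_Qr in \<open>auto simp: one_ereal_def\<close>)
    finally show False by (simp add: Qr_sq e0)
  qed
  ultimately have "l > 0" by simp
  then show ?thesis using lim by (rule that)
qed

lemma O32_const: "O32 (fps_nth (fps_const c))" for c :: real
  by (rule O32_finite_support[of 0]) auto

text \<open>Composing (1 - z)^(1/2) with Phi gives (1 - z)^(1/2) Gf^(1/2), and Gf^(1/2) = Gf * Qr.
  Every factor has coefficients of order n^(-3/2), a class closed under convolution. This is why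
  \<open>ee\<close> is the majorant for the error terms.\<close>

lemma ee_compose_O32: "O32 (fps_nth (Abs_fps ee oo Phi))"
proof -
  have two: "(2 :: real fps) $ n = fps_const 2 $ n" for n by (simp add: numeral_fps_const)
  have ee: "O32 (fps_nth (2 - Abs_fps ee))"
  proof -
    have "O32 ee" by (rule O32_I[of _ 2]) (use ee_upper in \<open>auto simp: less_imp_le\<close>)
    then have "O32 (\<lambda>n. - ee n)" by (rule O32_mono[where K = 1]) auto
    then have "O32 (\<lambda>n. fps_const 2 $ n + - ee n)" by (rule O32_add[OF O32_const])
    also have "(\<lambda>n. fps_const 2 $ n + - ee n) = fps_nth (2 - Abs_fps ee)"
      by (rule ext) (simp add: two)
    finally show ?thesis .
  qed
  have "((1 - fps_X) * Abs_fps cc) oo Phi = 2 - (Abs_fps ee oo Phi)"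
    by (simp add: one_minus_X_times_cc fps_compose_sub_distrib)
  then have "(1 - Phi) * Ct = 2 - (Abs_fps ee oo Phi)"
    by (simp add: fps_compose_mult_distrib fps_compose_sub_distrib Ct_def)
  moreover have "(1 - Phi) * Ct = (Gf * Qr) * ((1 - fps_X) * Abs_fps cc)"
    unfolding Gf_eq[symmetric] Ct_eq_mult by (simp add: mult_ac)
  ultimately have eq': "2 - (Abs_fps ee oo Phi) = (Gf * Qr) * (2 - Abs_fps ee)"
    by (simp only: one_minus_X_times_cc)
  have eq: "Abs_fps ee oo Phi = 2 - (Gf * Qr) * (2 - Abs_fps ee)"
    unfolding eq'[symmetric] by simp
  have "O32 (fps_nth (Gf * Qr))"
    unfolding fps_mult_nth[abs_def] using O32_conv[OF O32_Gf O32_Qr] by simp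
  from O32_conv[OF this ee] have "O32 (\<lambda>n. - fps_nth ((Gf * Qr) * (2 - Abs_fps ee)) n)"
    unfolding fps_mult_nth[of "Gf * Qr"] by (rule O32_mono[where K = 1]) auto
  then have "O32 (\<lambda>n. fps_const 2 $ n + - fps_nth ((Gf * Qr) * (2 - Abs_fps ee)) n)" by (rule O32_add[OF O32_const])
  also have "(\<lambda>n. fps_const 2 $ n + - fps_nth ((Gf * Qr) * (2 - Abs_fps ee)) n) = fps_nth (Abs_fps ee oo Phi)"
    unfolding eq by (rule ext) (simp add: two)
  finally show ?thesis .
qed

end

subsection \<open>Formal inversion of w exp (-w)\<close>

text \<open>The sum is j! times the coefficient of x^j in (e^x - 1)^m, a series that starts with
  x^m.\<close>

lemma alternating_binomial_sum:
  assumes "j \<le> m"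
  shows "(\<Sum>n=0..m. real (m choose n) * (- 1) ^ (m - n) * real n ^ j) = (if j = m then fact m else 0)"
proof -
  define h where "h = Abs_fps (\<lambda>n. 1 / fact (Suc n) :: real)"
  have X: "fps_exp 1 - 1 = fps_X * h"
  proof (rule fps_ext)
    fix n show "(fps_exp 1 - 1 :: real fps) $ n = (fps_X * h) $ n"
      by (cases n) (auto simp: h_def algebra_simps)
  qed
  have h0: "(h ^ m) $ 0 = 1" by (induction m) (auto simp: h_def)
  have "((fps_exp 1 - 1 :: real fps) ^ m) $ j = (if j = m then 1 else 0)"
    unfolding X power_mult_distrib fps_X_power_mult_nth using assms h0 by auto
  moreover have "((fps_exp 1 - 1 :: real fps) ^ m) $ j = (\<Sum>n\<le>m. real (m choose n) * (- 1) ^ (m - n) * (real n ^ j / fact j))"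
  proof -
    have "(fps_exp 1 + (- 1) :: real fps) ^ m = (\<Sum>n\<le>m. of_nat (m choose n) * fps_exp 1 ^ n * (- 1) ^ (m - n))"
      by (rule binomial_ring)
    also have "\<dots> = (\<Sum>n\<le>m. fps_const (real (m choose n) * (- 1) ^ (m - n)) * fps_exp (real n))"
    proof (rule sum.cong[OF refl])
      fix n
      have "(- 1 :: real fps) ^ (m - n) = fps_const ((- 1) ^ (m - n))"
        by (simp flip: fps_const_power fps_const_neg)
      then show "of_nat (m choose n) * fps_exp 1 ^ n * (- 1) ^ (m - n) = fps_const (real (m choose n) * (- 1) ^ (m - n)) * fps_exp (real n)"
        by (simp add: fps_exp_power_mult fps_of_nat[symmetric] mult_ac flip: fps_const_mult)
    qed
    finally show ?thesis by (simp add: fps_sum_nth)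
  qed
  ultimately have "(\<Sum>n\<le>m. real (m choose n) * (- 1) ^ (m - n) * (real n ^ j / fact j)) = (if j = m then 1 else 0)"
    by simp
  then have "(\<Sum>n\<le>m. real (m choose n) * (- 1) ^ (m - n) * real n ^ j) / fact j = (if j = m then 1 else 0)"
    by (simp add: sum_divide_distrib)
  then show ?thesis by (auto simp: atLeast0AtMost split: if_splits)
qed

abbreviation "XE \<equiv> fps_X * fps_exp (- 1) :: real fps"

lemma XE_power_nth: "(XE ^ i) $ m = (if m < i then 0 else (- real i) ^ (m - i) / fact (m - i))"
  by (simp add: power_mult_distrib fps_X_power_mult_nth fps_exp_power_mult)

lemma choose_term:
  assumes "i \<le> m"
  shows "1 / fact i * ((- real i) ^ (m - i) / fact (m - i)) * real i ^ k = 1 / fact m * (real (m choose i) * (- 1) ^ (m - i) * real i ^ (m - i + k))"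
proof -
  have "real (m choose i) = fact m / (fact i * fact (m - i))" using assms by (rule binomial_fact)
  moreover have "(- real i) ^ (m - i) = (- 1) ^ (m - i) * real i ^ (m - i)"
    by (metis mult_minus1 power_mult_distrib)
  ultimately show ?thesis by (simp add: power_add)
qed

text \<open>The m-th coefficient is 1/m! times the m-th finite difference of n^m, which is m!. Hence
  the sum of n^n w^n / n! equals 1 / (1 - T) at w = T e^-T.\<close>

lemma geometric_compose: "Abs_fps (\<lambda>n. real n ^ n / fact n) oo XE = Abs_fps (\<lambda>_. 1)"
proof (rule fps_ext)
  fix m
  have "(Abs_fps (\<lambda>n. real n ^ n / fact n) oo XE) $ m = (\<Sum>i=0..m. 1 / fact m * (real (m choose i) * (- 1) ^ (m - i) * real i ^ m))"
    unfolding fps_compose_nth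
  proof (rule sum.cong[OF refl])
    fix i assume "i \<in> {0..m}"
    then show "Abs_fps (\<lambda>n. real n ^ n / fact n) $ i * (XE ^ i) $ m = 1 / fact m * (real (m choose i) * (- 1) ^ (m - i) * real i ^ m)"
      using choose_term[of i m i] by (simp add: XE_power_nth mult_ac)
  qed
  also have "\<dots> = 1" unfolding sum_distrib_left[symmetric] by (subst alternating_binomial_sum) auto
  finally show "(Abs_fps (\<lambda>n. real n ^ n / fact n) oo XE) $ m = Abs_fps (\<lambda>_. 1) $ m" by simp
qed

text \<open>The left series is the generating function of labelled rooted trees, the inverse of z
  e^-z. For m >= 2 the coefficient is an m-th difference of the polynomial n^(m-1) and
  vanishes.\<close>

lemma tree_series_compose: "Abs_fps (\<lambda>n. if n = 0 then 0 else real n ^ (n - 1) / fact n) oo XE = fps_X"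
  (is "?W oo XE = _")
proof (rule fps_ext)
  fix m :: nat
  consider "m = 0" | "m = 1" | "m \<ge> 2" by linarith
  then show "(?W oo XE) $ m = fps_X $ m"
  proof cases
    case 2
    then show ?thesis by (simp add: fps_compose_nth)
  next
    case 3
    have "(?W oo XE) $ m = (\<Sum>i=0..m. 1 / fact m * (real (m choose i) * (- 1) ^ (m - i) * real i ^ (m - 1)))"
      unfolding fps_compose_nth
    proof (rule sum.cong[OF refl])
      fix i assume i: "i \<in> {0..m}"
      show "?W $ i * (XE ^ i) $ m = 1 / fact m * (real (m choose i) * (- 1) ^ (m - i) * real i ^ (m - 1))"
      proof (cases "i = 0")
        case False
        then have "m - i + (i - 1) = m - 1" using i by simp
        then show ?thesis using choose_term[of i m "i - 1"] i False by (simp add: XE_power_nth mult_ac)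
      qed (use 3 in \<open>simp add: power_0_left\<close>)
    qed
    also have "\<dots> = 0" unfolding sum_distrib_left[symmetric] using 3 by (subst alternating_binomial_sum) auto
    finally show ?thesis using 3 by simp
  qed simp
qed

subsection \<open>The coefficients of the inverse function\<close>

text \<open>The weight of n under the Poisson distribution with mean n.\<close>

definition aa :: "nat \<Rightarrow> real" where "aa n = real n ^ n * exp (- real n) / fact n"

lemma aa_pos [simp]: "aa n > 0"
  by (cases "n = 0") (auto simp: aa_def)

text \<open>The logarithm of aa n / cc n has increments of order n^-2. It therefore converges with
  error of order 1/n, and cc n / n is of the order of \<open>ee n\<close>. This is Stirling's
  formula with an error term, the constant being left as a limit.\<close>

lemma aa_cc: obtains al K where "al > 0" "K > 0" "\<And>n. \<bar>aa n - al * cc n\<bar> \<le> K * ee n"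
proof -
  define l where "l = (\<lambda>n. ln (aa n / cc n))"
  define d where "d = (\<lambda>n. real n * ln (1 + 1 / real n) - 1 + ln (1 + 1 / (2 * real n + 1)))"
  have ld: "l (Suc n) - l n = d n" if n: "n > 0" for n
  proof -
    have q: "aa (Suc n) / cc (Suc n) = aa n / cc n * ((1 + 1 / real n) ^ n * exp (- 1) * (1 + 1 / (2 * real n + 1)))"
    proof -
      have p: "real (Suc n) ^ n = real n ^ n * (1 + 1 / real n) ^ n"
        using n by (simp add: field_simps flip: power_mult_distrib)
      have "aa (Suc n) = real (Suc n) ^ n * exp (- real n) * exp (- 1) / fact n"
      proof -
        have "exp (- real (Suc n)) = exp (- real n) * exp (- 1)" by (simp flip: exp_add)
        then show ?thesis by (simp add: aa_def del: of_nat_Suc)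
      qed
      then have "aa (Suc n) = aa n * ((1 + 1 / real n) ^ n * exp (- 1))"
        unfolding p by (simp add: aa_def)
      moreover define e where "e = 1 + 1 / (2 * real n + 1)"
      have "e > 0" unfolding e_def by (intro add_pos_nonneg) auto
      moreover have "cc n = cc (Suc n) * e"
      proof -
        have pos: "2 * real n + 1 > 0" by linarith
        then have ed: "e * (2 * real n + 1) = 2 * real n + 2" by (simp add: e_def field_simps)
        have "(2 * real n + 1) * cc n = (e * (2 * real n + 1)) * cc (Suc n)"
          unfolding ed by (rule cc_rec[symmetric])
        also have "\<dots> = (2 * real n + 1) * (cc (Suc n) * e)" by (simp only: mult_ac)
        finally show ?thesis using pos by (simp only: mult_left_cancel[OF less_imp_neq[OF pos, symmetric]])
      qed
      ultimately show ?thesis unfolding e_def[symmetric]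
        using less_imp_neq[OF cc_pos, of "Suc n"] by (simp add: field_simps del: cc.simps)
    qed
    have pos: "1 + 1 / real n > 0" "1 + 1 / (2 * real n + 1) > 0" "aa n / cc n > 0" using n by (auto intro: add_pos_nonneg)
    have lnq: "ln (X * (p ^ n * exp (- 1) * Q)) = ln X + (real n * ln p - 1 + ln Q)"
      if "X > 0" "p > 0" "Q > 0" for X p Q :: real
      using that by (simp add: ln_mult ln_realpow)
    have "l (Suc n) = l n + (real n * ln (1 + 1 / real n) - 1 + ln (1 + 1 / (2 * real n + 1)))"
      unfolding l_def q by (rule lnq[OF pos(3,1,2)])
    then show ?thesis by (simp add: d_def)
  qed
  have "d \<in> O(\<lambda>n. 1 / (real n)\<^sup>2)" unfolding d_def by real_asymp
  then obtain C where C: "C > 0" "eventually (\<lambda>n. norm (d n) \<le> C * norm (1 / (real n)\<^sup>2)) at_top"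
    by (elim landau_o.bigE) blast
  then obtain N0 where N0: "\<And>n. n \<ge> N0 \<Longrightarrow> \<bar>d n\<bar> \<le> C / (real n)\<^sup>2"
    by (auto simp: eventually_at_top_linorder)
  define N where "N = max N0 1"
  have db: "\<bar>d n\<bar> \<le> 2 * C / real n - 2 * C / real (Suc n)" if "n \<ge> N" for n
  proof -
    have n: "n \<ge> 1" "n \<ge> N0" using that by (auto simp: N_def)
    have "\<bar>d n\<bar> \<le> C / (real n)\<^sup>2" by (rule N0) fact
    also have "\<dots> = C / (real n * real n)" by (simp add: power2_eq_square)
    \<comment> \<open>Weakening 1 / n^2 to 2 / (n (n + 1)) makes the bound telescope.\<close>
    also have "\<dots> \<le> C / (real n * (real (Suc n) / 2))"
      using n C by (intro divide_left_mono mult_left_mono mult_pos_pos) auto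
    also have "\<dots> = 2 * C / real n - 2 * C / real (Suc n)" using n by (simp add: field_simps)
    finally show ?thesis .
  qed
  \<comment> \<open>Subtracting and adding a bound for all later increments gives an increasing and
    a decreasing sequence; \<open>la\<close> lies between them, which yields the limit together with
    its rate.\<close>
  define x where "x = (\<lambda>n. l (n + N) - 2 * C / real (n + N))"
  define y where "y = (\<lambda>n. l (n + N) + 2 * C / real (n + N))"
  have "N \<ge> 1" by (simp add: N_def)
  then have Npos: "n + N > 0" for n by simp
  have x: "x n \<le> x (Suc n)" and y: "y (Suc n) \<le> y n" for n
    using db[of "n + N"] ld[OF Npos[of n]] unfolding x_def y_def add_Suc by linarith+
  have xy: "x n \<le> y n" for n using C by (auto simp: x_def y_def)
  have incx: "incseq x" and decy: "decseq y" using x y by (auto intro: incseq_SucI decseq_SucI)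
  have le: "x n \<le> y m" for n m
    using order_trans[OF order_trans[OF incseqD[OF incx, of n "max n m"] xy] decseqD[OF decy, of m "max n m"]] by simp
  define la where "la = (SUP n. x n)"
  have la: "x n \<le> la" "la \<le> y n" for n
  proof -
    have "bdd_above (range x)" using le[of _ 0] by (auto intro!: bdd_aboveI)
    then show "x n \<le> la" unfolding la_def by (rule cSUP_upper[OF UNIV_I])
    show "la \<le> y n" unfolding la_def by (rule cSUP_least) (use le in auto)
  qed
  have dist: "\<bar>l n - la\<bar> \<le> 2 * C / real n" if "n \<ge> N" for n
    using la[of "n - N"] that by (auto simp: x_def y_def)
  have main: "\<bar>aa n - exp la * cc n\<bar> \<le> exp la * (exp (2 * C) * (2 * C)) * 2 * ee n" if n: "n \<ge> N" for n
  proof -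
    have n1: "n \<ge> 1" using n by (simp add: N_def)
    define u where "u = l n - la"
    have u: "\<bar>u\<bar> \<le> 2 * C / real n" "\<bar>u\<bar> \<le> 2 * C"
    proof -
      show "\<bar>u\<bar> \<le> 2 * C / real n" unfolding u_def by (rule dist[OF n])
      also have "\<dots> \<le> 2 * C" using n1 C by (simp add: divide_le_eq)
      finally show "\<bar>u\<bar> \<le> 2 * C" .
    qed
    have "\<bar>exp u - 1\<bar> \<le> exp (2 * C) * \<bar>u\<bar>"
    proof (cases "u \<ge> 0")
      case True
      have "1 - u \<le> exp (- u)" using exp_ge_add_one_self[of "- u"] by simp
      then have "(1 - u) * exp u \<le> exp (- u) * exp u" by (intro mult_right_mono) auto
      then have "exp u - 1 \<le> u * exp u" by (simp add: algebra_simps exp_minus)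
      also have "\<dots> \<le> u * exp (2 * C)" using u True by (intro mult_left_mono) auto
      finally show ?thesis using True by (simp add: mult.commute)
    next
      case False
      have "1 - exp u \<le> - u" using exp_ge_add_one_self[of u] by linarith
      also have "\<dots> \<le> exp (2 * C) * (- u)" using False C mult_right_mono[of 1 "exp (2 * C)" "- u"] by simp
      finally show ?thesis using False by simp
    qed
    also have "\<dots> \<le> exp (2 * C) * (2 * C / real n)" using u by (intro mult_left_mono) auto
    finally have e: "\<bar>exp u - 1\<bar> \<le> exp (2 * C) * (2 * C / real n)" .
    have "exp (l n) = aa n / cc n" by (simp add: l_def)
    then have aeq: "aa n = exp la * exp u * cc n" by (simp add: u_def exp_diff less_imp_neq[OF cc_pos, symmetric])
    have "\<bar>aa n - exp la * cc n\<bar> = exp la * cc n * \<bar>exp u - 1\<bar>"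
    proof -
      have "aa n - exp la * cc n = exp la * cc n * (exp u - 1)" by (simp add: aeq algebra_simps)
      then show ?thesis by (simp add: abs_mult abs_of_pos[OF cc_pos])
    qed
    also have "\<dots> \<le> exp la * cc n * (exp (2 * C) * (2 * C / real n))"
      by (intro mult_left_mono e) (auto simp: less_imp_le)
    also have "\<dots> = exp la * (exp (2 * C) * (2 * C)) * 2 * (cc n / (2 * real n))" by simp
    also have "\<dots> \<le> exp la * (exp (2 * C) * (2 * C)) * 2 * ee n"
      using n1 C by (intro mult_left_mono ee_lower) auto
    finally show ?thesis .
  qed
  define K0 where "K0 = exp la * (exp (2 * C) * (2 * C)) * 2"
  define K1 where "K1 = (\<Sum>n<N. \<bar>aa n - exp la * cc n\<bar> / ee n)"
  have K0: "K0 > 0" using C by (simp add: K0_def)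
  have K1: "K1 \<ge> 0" unfolding K1_def by (intro sum_nonneg) (auto simp: less_imp_le)
  show ?thesis
  proof (rule that[of "exp la" "K0 + K1"])
    fix n
    show "\<bar>aa n - exp la * cc n\<bar> \<le> (K0 + K1) * ee n"
    proof (cases "n \<ge> N")
      case True
      have "\<bar>aa n - exp la * cc n\<bar> \<le> K0 * ee n" unfolding K0_def by (rule main[OF True])
      also have "\<dots> \<le> (K0 + K1) * ee n" using K1 by (intro mult_right_mono) (auto simp: less_imp_le)
      finally show ?thesis .
    next
      case False
      then have "\<bar>aa n - exp la * cc n\<bar> / ee n \<le> K1"
        unfolding K1_def by (intro member_le_sum) (auto simp: less_imp_le)
      then have "\<bar>aa n - exp la * cc n\<bar> \<le> K1 * ee n" by (simp add: pos_divide_le_eq)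
      also have "\<dots> \<le> (K0 + K1) * ee n" using K0 by (intro mult_right_mono) (auto simp: less_imp_le)
      finally show ?thesis .
    qed
  qed (use K0 K1 in auto)
qed

subsection \<open>The generating function of trees as a composition\<close>

text \<open>\<open>z PP = T e\<^sup>-\<^sup>T\<close>; the recurrence below identifies \<open>PP\<close> as \<open>exp (\<Sum>i\<ge>2. T(z\<^sup>i) / i)\<close>.\<close>
definition PP :: "real fps" where
  "PP = Abs_fps (\<lambda>n. t (Suc n)) * (fps_exp (- 1) oo Abs_fps t)"

lemma X_PP: "fps_X * PP = XE oo Abs_fps t"
proof -
  have "Abs_fps t = fps_X * Abs_fps (\<lambda>n. t (Suc n))"
  proof (rule fps_ext)
    fix n show "Abs_fps t $ n = (fps_X * Abs_fps (\<lambda>n. t (Suc n))) $ n" by (cases n) auto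
  qed
  then show ?thesis by (simp add: fps_compose_mult_distrib PP_def mult.assoc)
qed

lemma PP_0: "PP $ 0 = 1"
  by (simp add: PP_def)

text \<open>With M = T / z and E = e^-T one has M' = (T + A)' M and E' = -T' E, so the terms with T'
  cancel and (M E)' = A' (M E). The recurrence also shows that the coefficients are nonnegative,
  which the definition hides.\<close>

lemma PP_rec: "real n * PP $ n = (\<Sum>j=1..n. real j * Ac 0 j * PP $ (n - j))"
proof (cases n)
  case (Suc k)
  define M where "M = Abs_fps (\<lambda>n. t (Suc n))"
  define T where "T = Abs_fps t"
  define L where "L = Abs_fps (Lc 0)"
  define A where "A = Abs_fps (Ac 0)"
  define E where "E = fps_exp (- 1) oo T"
  have neg: "fps_const (- 1 :: real) = - 1" by (metis fps_const_neg fps_const_1_eq_1)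
  have L: "L = T + A" by (rule fps_ext) (simp add: L_def T_def A_def Lc_eq)
  have "fps_deriv M = fps_deriv L * M"
  proof (rule fps_ext)
    fix n
    have "fps_deriv M $ n = real (Suc n) * t (Suc (Suc n))" by (simp add: M_def)
    also have "\<dots> = (\<Sum>j=1..Suc n. real j * Lc 0 j * t (Suc (Suc n - j)))" by (rule Suc_t_rec)
    also have "\<dots> = (\<Sum>i=0..n. real (Suc i) * Lc 0 (Suc i) * t (Suc (n - i)))"
      by (rule sum.reindex_bij_witness[where i = Suc and j = "\<lambda>j. j - 1"]) auto
    finally show "fps_deriv M $ n = (fps_deriv L * M) $ n"
      by (simp add: fps_mult_nth M_def L_def)
  qed
  moreover have "fps_deriv E = - (E * fps_deriv T)"
    unfolding E_def by (subst fps_compose_deriv) (auto simp: T_def fps_compose_mult_distrib fps_compose_uminus neg)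
  ultimately have "fps_deriv (M * E) = fps_deriv A * (M * E)"
    by (simp add: L algebra_simps)
  then have "fps_deriv PP $ k = (fps_deriv A * PP) $ k" by (simp add: PP_def M_def E_def T_def)
  then have "real (Suc k) * PP $ Suc k = (\<Sum>i=0..k. real (Suc i) * Ac 0 (Suc i) * PP $ (k - i))"
    by (simp add: fps_mult_nth A_def)
  also have "\<dots> = (\<Sum>j=1..Suc k. real j * Ac 0 j * PP $ (Suc k - j))"
    by (rule sum.reindex_bij_witness[where j = Suc and i = "\<lambda>j. j - 1"]) auto
  finally show ?thesis by (simp add: Suc)
qed simp

lemma PP_nonneg: "PP $ n \<ge> 0"
proof (induction n rule: less_induct)
  case (less n)
  show ?case
  proof (cases "n = 0")
    case False
    have "real n * PP $ n \<ge> 0" unfolding PP_rec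
      by (intro sum_nonneg mult_nonneg_nonneg less.IH) auto
    then show ?thesis using False by (simp add: zero_le_mult_iff)
  qed (simp add: PP_0)
qed

lemma summable_PP: "summable (\<lambda>n. PP $ n * (49/100) ^ n)"
proof (rule summable_bounded_nonneg)
  have sA: "summable (\<lambda>n. Ac 0 n * (49/100) ^ n)"
    by (rule summable_Ac) (use rho_ge_quarter in \<open>auto simp: power2_eq_square\<close>)
  fix N
  have "(\<Sum>n\<le>N. PP $ n * (49/100) ^ n) \<le> exp (\<Sum>j=1..N. Ac 0 j * (49/100) ^ j)"
    by (rule exp_formula_partial_sums) (auto simp: PP_0 PP_nonneg PP_rec)
  also have "(\<Sum>j=1..N. Ac 0 j * (49/100) ^ j) \<le> pser (Ac 0) (49/100)"
    unfolding pser_def by (rule sum_le_suminf[OF sA]) auto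
  finally show "(\<Sum>n\<le>N. PP $ n * (49/100) ^ n) \<le> exp (pser (Ac 0) (49/100))" by simp
qed (simp add: PP_nonneg)

definition phi :: "nat \<Rightarrow> real" where
  "phi n = (if n = 0 then 0 else exp 1 * rho ^ n * PP $ (n - 1))"

lemma PP_rho: "pser (fps_nth PP) rho = exp (pser (Ac 0) rho)"
  unfolding pser_def
proof (rule exp_formula_suminf[where r = "49/100"])
  show "summable (\<lambda>n. Ac 0 n * (49/100) ^ n)"
    by (rule summable_Ac) (use rho_ge_quarter in \<open>auto simp: power2_eq_square\<close>)
qed (use rho_pos rho_less summable_PP in \<open>auto simp: PP_0 PP_rec Ac_def lamb_def\<close>)

lemma summable_PP_rho: "summable (\<lambda>n. PP $ n * rho ^ n)"
  by (rule summable_comparison_test'[OF summable_PP])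
     (use rho_pos rho_less in \<open>auto simp: PP_nonneg intro!: mult_left_mono power_mono\<close>)

text \<open>The weights \<open>phi\<close> contain rho^n, so convergence at 49 / (100 rho) is
  convergence of \<open>PP\<close> at 49/100. This point exceeds 1 because rho < 9/20.\<close>

interpretation tree: pgf phi "49 / (100 * rho)"
proof
  show "phi n \<ge> 0" for n using rho_pos by (auto simp: phi_def PP_nonneg)
  show "phi 0 = 0" by (simp add: phi_def)
  show "phi 1 > 0" using rho_pos by (simp add: phi_def PP_0)
  show "1 < 49 / (100 * rho)" using rho_pos rho_less by (simp add: divide_simps)
  have "(\<lambda>n. exp 1 * rho * (PP $ n * rho ^ n)) sums (exp 1 * rho * pser (fps_nth PP) rho)"
    unfolding pser_def by (intro sums_mult summable_sums summable_PP_rho)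
  then have "(\<lambda>n. phi (Suc n)) sums (exp 1 * (rho * exp (pser (Ac 0) rho)))"
    by (simp add: phi_def PP_rho mult_ac)
  then have "(\<lambda>n. phi (Suc n)) sums 1" by (simp add: Phi_rho)
  then show "phi sums 1" using sums_Suc[of phi 1] by (simp add: phi_def)
  have "summable (\<lambda>n. (exp 1 * 49/100) * (PP $ n * (49/100) ^ n))"
    by (intro summable_mult summable_PP)
  moreover have "(exp 1 * 49/100) * (PP $ n * (49/100) ^ n) = phi (Suc n) * (49 / (100 * rho)) ^ Suc n" for n
  proof -
    have "rho ^ Suc n * (49 / (100 * rho)) ^ Suc n = (49/100) ^ Suc n"
      using rho_pos by (subst power_mult_distrib[symmetric]) simp
    moreover have "phi (Suc n) * (49 / (100 * rho)) ^ Suc n = exp 1 * PP $ n * (rho ^ Suc n * (49 / (100 * rho)) ^ Suc n)"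
      by (simp add: phi_def del: power_Suc)
    ultimately show ?thesis by (simp only:) simp
  qed
  ultimately have "summable (\<lambda>n. phi (Suc n) * (49 / (100 * rho)) ^ Suc n)" by (simp only:)
  then show "summable (\<lambda>n. phi n * (49 / (100 * rho)) ^ n)"
    by (subst (asm) summable_Suc_iff)
qed

definition scl :: "real fps \<Rightarrow> real fps" where "scl f = Abs_fps (\<lambda>n. f $ n * rho ^ n)"

lemma scl_nth [simp]: "scl f $ n = f $ n * rho ^ n" by (simp add: scl_def)

lemma scl_mult: "scl (f * g) = scl f * scl g"
proof (rule fps_ext)
  fix n
  have "(\<Sum>i=0..n. f $ i * g $ (n - i)) * rho ^ n = (\<Sum>i=0..n. (f $ i * rho ^ i) * (g $ (n - i) * rho ^ (n - i)))"
    unfolding sum_distrib_right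
  proof (rule sum.cong[OF refl])
    fix i assume "i \<in> {0..n}"
    then have "rho ^ n = rho ^ i * rho ^ (n - i)" by (simp flip: power_add)
    then show "f $ i * g $ (n - i) * rho ^ n = (f $ i * rho ^ i) * (g $ (n - i) * rho ^ (n - i))" by simp
  qed
  then show "scl (f * g) $ n = (scl f * scl g) $ n" by (simp add: fps_mult_nth)
qed

lemma scl_power: "scl (f ^ n) = scl f ^ n"
proof (induction n)
  case 0
  show ?case by (rule fps_ext) simp
qed (simp add: scl_mult)

lemma Phi_eq: "tree.Phi = fps_const (exp 1) * scl (fps_X * PP)"
proof (rule fps_ext)
  fix n show "tree.Phi $ n = (fps_const (exp 1) * scl (fps_X * PP)) $ n"
    by (cases n) (auto simp: tree.Phi_def phi_def)
qed

text \<open>The weights e^-n cancel the factor e that normalises Phi, so the composition is F(T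
  e^-T) with rho z in place of z.\<close>

lemma compose_Phi: "(Abs_fps (\<lambda>n. F $ n * exp (- real n)) oo tree.Phi) $ N = ((F oo XE) oo Abs_fps t) $ N * rho ^ N"
proof -
  have "(Abs_fps (\<lambda>n. F $ n * exp (- real n)) oo tree.Phi) $ N = (\<Sum>i=0..N. F $ i * ((fps_X * PP) ^ i) $ N * rho ^ N)"
    unfolding fps_compose_nth
  proof (rule sum.cong[OF refl])
    fix i
    have "tree.Phi ^ i = fps_const (exp 1 ^ i) * scl ((fps_X * PP) ^ i)"
      unfolding Phi_eq by (subst power_mult_distrib) (simp only: scl_power fps_const_power)
    moreover have "exp (- real i) * exp 1 ^ i = 1"
      by (simp flip: exp_of_nat_mult exp_add)
    ultimately show "Abs_fps (\<lambda>n. F $ n * exp (- real n)) $ i * (tree.Phi ^ i) $ N = F $ i * ((fps_X * PP) ^ i) $ N * rho ^ N"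
      by (simp add: mult_ac)
  qed
  also have "\<dots> = (F oo (XE oo Abs_fps t)) $ N * rho ^ N"
    by (simp add: X_PP[symmetric] fps_compose_nth sum_distrib_right)
  also have "F oo (XE oo Abs_fps t) = (F oo XE) oo Abs_fps t"
    by (rule fps_compose_assoc) auto
  finally show ?thesis .
qed

definition HH :: "real fps" where "HH = Abs_fps (\<lambda>_. 1) oo Abs_fps t"

lemma HH_eq: "(1 - Abs_fps t) * HH = 1"
proof -
  have "(1 - fps_X) * Abs_fps (\<lambda>_. 1 :: real) = 1"
  proof (rule fps_ext)
    fix n show "((1 - fps_X) * Abs_fps (\<lambda>_. 1 :: real)) $ n = 1 $ n" by (cases n) (auto simp: algebra_simps)
  qed
  then have "((1 - fps_X) * Abs_fps (\<lambda>_. 1 :: real)) oo Abs_fps t = 1" by simp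
  then show ?thesis by (simp add: HH_def fps_compose_mult_distrib fps_compose_sub_distrib)
qed

text \<open>The weights \<open>aa\<close> split into a multiple of \<open>cc\<close>, whose
  composition is \<open>Ct\<close>, and an error dominated by \<open>ee\<close>. The composed error
  is of order n^(-3/2) and disappears after division by \<open>cc n\<close>.\<close>

lemma HH_asymp: obtains L where "L > 0" "(\<lambda>n. HH $ n * rho ^ n / cc n) \<longlonglongrightarrow> L"
proof -
  obtain al K where K: "al > 0" "K > 0" "\<And>n. \<bar>aa n - al * cc n\<bar> \<le> K * ee n" by (rule aa_cc) blast
  obtain l where l: "l > 0" "(\<lambda>n. tree.Ct $ n / cc n) \<longlonglongrightarrow> l" by (rule tree.Ct_asymp) blast
  define D where "D = Abs_fps (\<lambda>n. aa n - al * cc n) oo tree.Phi"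
  have "Abs_fps aa = fps_const al * Abs_fps cc + Abs_fps (\<lambda>n. aa n - al * cc n)" by (rule fps_ext) simp
  then have eq: "Abs_fps aa oo tree.Phi = fps_const al * tree.Ct + D"
    by (simp add: fps_compose_add_distrib fps_compose_mult_distrib D_def tree.Ct_def)
  define F where "F = Abs_fps (\<lambda>n. real n ^ n / fact n :: real)"
  have F: "Abs_fps aa = Abs_fps (\<lambda>n. F $ n * exp (- real n))"
    by (rule fps_ext) (simp add: aa_def F_def)
  have HH: "HH $ n * rho ^ n = (Abs_fps aa oo tree.Phi) $ n" for n
    unfolding F compose_Phi by (simp add: F_def geometric_compose HH_def)
  obtain C where C: "C \<ge> 0" "\<And>n. norm ((Abs_fps ee oo tree.Phi) $ n) \<le> C * ww n ^ 3"
    using tree.ee_compose_O32 by (rule O32_E) blast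
  have Dle: "\<bar>D $ n\<bar> \<le> K * C * ww n ^ 3" for n
  proof -
    have "\<bar>D $ n\<bar> \<le> K * (Abs_fps ee oo tree.Phi) $ n"
      unfolding D_def by (rule tree.compose_bound) (rule K)
    also have "\<dots> \<le> K * (C * ww n ^ 3)" using C(2)[of n] K by (intro mult_left_mono) auto
    finally show ?thesis by simp
  qed
  have "(\<lambda>n. D $ n / cc n) \<longlonglongrightarrow> 0"
  proof (rule Lim_null_comparison)
    show "(\<lambda>n. 2 * K * C * (ww n)\<^sup>2) \<longlonglongrightarrow> 0" unfolding ww_def by real_asymp
    show "eventually (\<lambda>n. norm (D $ n / cc n) \<le> 2 * K * C * (ww n)\<^sup>2) sequentially"
    proof (rule always_eventually, rule allI)
      fix n
      have "\<bar>D $ n\<bar> \<le> K * C * (ww n)\<^sup>2 * ww n" using Dle[of n] by (simp add: power2_eq_square power3_eq_cube)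
      also have "\<dots> \<le> K * C * (ww n)\<^sup>2 * (2 * cc n)" using K C by (intro mult_left_mono ww_le_cc) auto
      finally show "norm (D $ n / cc n) \<le> 2 * K * C * (ww n)\<^sup>2"
        by (simp add: abs_of_pos[OF cc_pos] pos_divide_le_eq mult_ac)
    qed
  qed
  from tendsto_add[OF tendsto_mult[OF tendsto_const[of al] l(2)] this]
  have "(\<lambda>n. HH $ n * rho ^ n / cc n) \<longlonglongrightarrow> al * l"
    by (simp add: HH eq add_divide_distrib)
  moreover have "al * l > 0" using K l by simp
  ultimately show ?thesis by (intro that)
qed

text \<open>T is the labelled tree series composed with T e^-T. Its weights e^-n n^(n-1) / n! are aa
  n / n, hence bounded by a multiple of \<open>ee n\<close>, and \<open>compose_bound\<close>
  applies.\<close>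

lemma O32_t: "O32 (\<lambda>n. t n * rho ^ n)"
proof -
  obtain al K where K: "al > 0" "K > 0" "\<And>n. \<bar>aa n - al * cc n\<bar> \<le> K * ee n" by (rule aa_cc) blast
  define W where "W = Abs_fps (\<lambda>n. if n = 0 then 0 else real n ^ (n - 1) / fact n :: real)"
  have tt: "t n * rho ^ n = (Abs_fps (\<lambda>n. W $ n * exp (- real n)) oo tree.Phi) $ n" for n
    unfolding compose_Phi by (simp add: tree_series_compose W_def)
  have bound: "\<bar>W $ n * exp (- real n)\<bar> \<le> (2 * al + K) * ee n" for n
  proof (cases "n = 0")
    case False
    then have n: "real n \<ge> 1" by simp
    have "W $ n * exp (- real n) = aa n / real n"
      using False by (cases n) (auto simp: W_def aa_def)
    also have "\<dots> \<le> (al * cc n + K * ee n) / real n" using K(3)[of n] n by (intro divide_right_mono) auto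
    also have "\<dots> = 2 * al * (cc n / (2 * real n)) + K * ee n / real n" by (simp add: add_divide_distrib)
    also have "\<dots> \<le> 2 * al * ee n + K * ee n"
    proof (intro add_mono)
      show "2 * al * (cc n / (2 * real n)) \<le> 2 * al * ee n" using K False by (intro mult_left_mono ee_lower) auto
      have "K * ee n / real n \<le> K * ee n / 1" using K n by (intro divide_left_mono) (auto simp: less_imp_le)
      then show "K * ee n / real n \<le> K * ee n" by simp
    qed
    also have "\<dots> = (2 * al + K) * ee n" by (simp add: algebra_simps)
    finally have "W $ n * exp (- real n) \<le> (2 * al + K) * ee n" .
    moreover have "W $ n * exp (- real n) \<ge> 0" by (simp add: W_def)
    ultimately show ?thesis by simp
  qed (use K in \<open>simp add: W_def less_imp_le\<close>)
  have "\<bar>t n * rho ^ n\<bar> \<le> (2 * al + K) * (Abs_fps ee oo tree.Phi) $ n" for n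
    unfolding tt by (rule tree.compose_bound) (rule bound)
  then have "norm (t n * rho ^ n) \<le> (2 * al + K) * norm ((Abs_fps ee oo tree.Phi) $ n)" for n
  proof -
    have "\<bar>t n * rho ^ n\<bar> \<le> (2 * al + K) * (Abs_fps ee oo tree.Phi) $ n" by fact
    also have "\<dots> \<le> (2 * al + K) * \<bar>(Abs_fps ee oo tree.Phi) $ n\<bar>"
      using K by (intro mult_left_mono) auto
    finally show ?thesis by simp
  qed
  then show ?thesis by (rule O32_mono[OF tree.ee_compose_O32]) (use K in auto)
qed

section \<open>Asymptotics of the coefficients of S_k\<close>

definition Uk :: "nat \<Rightarrow> real" where "Uk k = pser (tn k) rho + pser (Wc k) rho"

lemma pser_tn_nonneg: "pser (tn k) rho \<ge> 0"
  unfolding pser_def by (rule suminf_nonneg[OF summable_tn_rho]) (use rho_pos in auto)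

lemma Uk_nonneg: "Uk k \<ge> 0"
  using pser_tn_nonneg pser_Wc_nonneg by (simp add: Uk_def)

lemma Uk_0: "Uk 0 = GG"
  by (simp add: Uk_def GG_def T_rho)

lemma GG_pos: "GG > 0"
  using pser_Wc_nonneg[of 0] by (simp add: GG_def)

lemma O32_tn: "O32 (\<lambda>n. tn k n * rho ^ n)"
  by (rule O32_mono[OF O32_t, where K = 1])
     (use rho_pos in \<open>auto intro!: mult_right_mono tn_antimono\<close>)

lemma O32_Wc: "O32 (\<lambda>n. Wc k n * rho ^ n)"
proof (rule exp_decay_O32)
  have "summable (\<lambda>n. Wc k n * (49/100) ^ n)"
    by (rule summable_Wc) (use rho_ge_quarter in \<open>auto simp: power2_eq_square\<close>)
  moreover have "Wc k n * (49/100) ^ n = (Wc k n * rho ^ n) * (49 / (100 * rho)) ^ n" for n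
  proof -
    have "rho ^ n * (49 / (100 * rho)) ^ n = (49/100) ^ n"
      using rho_pos by (subst power_mult_distrib[symmetric]) simp
    then show ?thesis by (simp add: mult.assoc)
  qed
  ultimately have "ereal (norm (49 / (100 * rho))) \<le> conv_radius (\<lambda>n. Wc k n * rho ^ n)"
    by (intro conv_radius_geI) simp
  moreover have "1 < ereal (norm (49 / (100 * rho)))"
    using rho_pos rho_less by (simp add: divide_simps)
  ultimately show "1 < conv_radius (\<lambda>n. Wc k n * rho ^ n)" by (rule less_le_trans[rotated])
qed

lemma sn_fps: "Abs_fps (sn k) = (Abs_fps (tn k) + Abs_fps (Wc k) * Abs_fps t) * HH"
proof -
  let ?S = "Abs_fps (sn k)" and ?W = "Abs_fps (Wc k)" and ?T = "Abs_fps t" and ?Tk = "Abs_fps (tn k)"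
  have "?S = ?Tk + (?S + ?W) * ?T"
  proof (rule fps_ext)
    fix n show "?S $ n = (?Tk + (?S + ?W) * ?T) $ n"
      using sn_conv[of k n] by (simp add: fps_mult_nth atLeast0AtMost)
  qed
  then have "?S * (1 - ?T) = ?Tk + ?W * ?T" by (simp add: algebra_simps)
  then have "?S * ((1 - ?T) * HH) = (?Tk + ?W * ?T) * HH" by (simp only: mult.assoc[symmetric])
  then show ?thesis by (simp only: HH_eq mult_1_right)
qed

text \<open>In S_k = (T_k + W_k T) / (1 - T) the first factor has scaled coefficients of order
  n^(-3/2), so \<open>conv_ratio\<close> multiplies the constant L of 1 / (1 - T) by the value of
  that factor at rho, which is \<open>Uk k\<close> as T(rho) = 1. The same L serves all k.\<close>

lemma sn_asymp: "\<exists>L>0. \<forall>k. (\<lambda>n. sn k n * rho ^ n / cc n) \<longlonglongrightarrow> L * Uk k"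
proof -
  obtain L where L: "L > 0" "(\<lambda>n. HH $ n * rho ^ n / cc n) \<longlonglongrightarrow> L" by (rule HH_asymp)
  have "(\<lambda>n. sn k n * rho ^ n / cc n) \<longlonglongrightarrow> L * Uk k" for k
  proof -
    define w where "w = (\<lambda>n. \<Sum>j=0..n. (Wc k j * rho ^ j) * (t (n - j) * rho ^ (n - j)))"
    define r where "r = (\<lambda>n. tn k n * rho ^ n + w n)"
    have Ow: "O32 w" unfolding w_def by (rule O32_conv[OF O32_Wc O32_t])
    have Or: "O32 r" unfolding r_def by (rule O32_add[OF O32_tn Ow])
    have r: "scl (Abs_fps (tn k) + Abs_fps (Wc k) * Abs_fps t) $ n = r n" for n
    proof -
      have "scl (Abs_fps (Wc k) * Abs_fps t) $ n = w n"
        unfolding scl_mult by (simp add: fps_mult_nth w_def)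
      then show ?thesis by (simp add: r_def distrib_right)
    qed
    have "sn k n * rho ^ n = (\<Sum>j=0..n. r j * (HH $ (n - j) * rho ^ (n - j)))" for n
    proof -
      have "sn k n * rho ^ n = scl (Abs_fps (sn k)) $ n" by simp
      also have "\<dots> = (scl (Abs_fps (tn k) + Abs_fps (Wc k) * Abs_fps t) * scl HH) $ n"
        by (simp only: sn_fps scl_mult)
      also have "\<dots> = (\<Sum>j=0..n. r j * (HH $ (n - j) * rho ^ (n - j)))"
        by (subst fps_mult_nth) (simp only: r, simp)
      finally show ?thesis .
    qed
    then have "(\<lambda>n. sn k n * rho ^ n / cc n) \<longlonglongrightarrow> L * (\<Sum>n. r n)"
      using conv_ratio[OF Or L(2)] by simp
    moreover have "(\<Sum>n. r n) = Uk k"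
    proof -
      have sw: "w sums ((\<Sum>n. Wc k n * rho ^ n) * (\<Sum>n. t n * rho ^ n))"
        unfolding w_def atLeast0AtMost
        by (rule Cauchy_product_sums) (use summable_Wc_rho summable_t_rho rho_pos in \<open>auto simp: abs_mult\<close>)
      have "r sums (pser (tn k) rho + (\<Sum>n. Wc k n * rho ^ n) * (\<Sum>n. t n * rho ^ n))"
        unfolding r_def pser_def by (intro sums_add summable_sums summable_tn_rho sw)
      then show ?thesis using T_rho by (simp add: sums_iff Uk_def pser_def)
    qed
    ultimately show ?thesis by simp
  qed
  then show ?thesis using L by blast
qed

lemma sn_ratio: "(\<lambda>n. sn k n / (real n * t n)) \<longlonglongrightarrow> Uk k / GG"
proof -
  obtain L where L: "L > 0" "\<And>k. (\<lambda>n. sn k n * rho ^ n / cc n) \<longlonglongrightarrow> L * Uk k" using sn_asymp by blast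
  have "(\<lambda>n. (sn k n * rho ^ n / cc n) / (sn 0 n * rho ^ n / cc n)) \<longlonglongrightarrow> (L * Uk k) / (L * Uk 0)"
    by (intro tendsto_divide L) (use L GG_pos in \<open>auto simp: Uk_0\<close>)
  moreover have "(sn k n * rho ^ n / cc n) / (sn 0 n * rho ^ n / cc n) = sn k n / (real n * t n)" for n
    using rho_pos less_imp_neq[OF cc_pos, of n] by (simp add: sn_0)
  ultimately show ?thesis using L by (simp add: Uk_0)
qed

section \<open>Geometric decay in k, uniformly in n\<close>

lemma t_growth: obtains C where "C \<ge> 1" "\<And>n. n > 0 \<Longrightarrow> t (Suc n) \<le> C * t n"
proof -
  obtain L where L: "L > 0" "\<And>k. (\<lambda>n. sn k n * rho ^ n / cc n) \<longlonglongrightarrow> L * Uk k" using sn_asymp by blast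
  define f where "f = (\<lambda>n. sn 0 n * rho ^ n / cc n)"
  have f: "f \<longlonglongrightarrow> L * GG" using L(2)[of 0] by (simp add: f_def Uk_0)
  have fS: "(\<lambda>n. f (Suc n)) \<longlonglongrightarrow> L * GG" using f by (rule LIMSEQ_Suc)
  have c: "(\<lambda>n. (2 * real n + 1) / (2 * real n + 2)) \<longlonglongrightarrow> 1" by real_asymp
  have d: "(\<lambda>n. real n / real (Suc n)) \<longlonglongrightarrow> 1" by real_asymp
  have "(\<lambda>n. (f (Suc n) / f n) * ((2 * real n + 1) / (2 * real n + 2)) * (real n / real (Suc n)) / rho) \<longlonglongrightarrow> (L * GG / (L * GG)) * 1 * 1 / rho"
    by (intro tendsto_intros f fS c d) (use L GG_pos rho_pos in auto)
  moreover have "eventually (\<lambda>n. (f (Suc n) / f n) * ((2 * real n + 1) / (2 * real n + 2)) * (real n / real (Suc n)) / rho = t (Suc n) / t n) sequentially"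
    using eventually_gt_at_top[of 0]
  proof eventually_elim
    case (elim n)
    have cS: "cc (Suc n) = cc n * ((2 * real n + 1) / (2 * real n + 2))" by simp
    define q where "q = (2 * real n + 1) / (2 * real n + 2)"
    have "q \<noteq> 0" unfolding q_def by (simp add: add_pos_nonneg divide_simps)
    have tpos: "t n > 0" "t (Suc n) > 0" using t_ge_1[of n] t_ge_1[of "Suc n"] elim by auto
    have n: "real n \<noteq> 0" "real (Suc n) \<noteq> 0" using elim by auto
    show ?case unfolding f_def sn_0 cS q_def[symmetric]
      using \<open>q \<noteq> 0\<close> tpos n rho_pos less_imp_neq[OF cc_pos, of n] by (simp add: divide_simps del: of_nat_Suc)
  qed
  ultimately have "(\<lambda>n. t (Suc n) / t n) \<longlonglongrightarrow> (L * GG / (L * GG)) * 1 * 1 / rho" by (rule Lim_transform_eventually)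
  then have "Bseq (\<lambda>n. t (Suc n) / t n)" by (intro convergent_imp_Bseq convergentI)
  then obtain C where C: "C > 0" "\<And>n. norm (t (Suc n) / t n) \<le> C" by (auto simp: Bseq_def)
  show ?thesis
  proof (rule that[of "max C 1"])
    fix n :: nat assume n: "n > 0"
    then have "t n > 0" using t_ge_1[of n] by simp
    then have "t (Suc n) \<le> C * t n" using C(2)[of n] by (simp add: pos_divide_le_eq)
    also have "\<dots> \<le> max C 1 * t n" by (intro mult_right_mono) auto
    finally show "t (Suc n) \<le> max C 1 * t n" .
  qed simp
qed

text \<open>The left side counts the trees whose root has no leaf as a branch. Deleting one leaf
  branch identifies the other trees of size n + 1 with the trees of size n.\<close>

lemma tn_2: "n > 0 \<Longrightarrow> mn 2 (Suc n) = t (Suc n) - t n"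
proof -
  assume n: "n > 0"
  let ?l = "Node {#}"
  have p1: "protected (Suc 0) c \<longleftrightarrow> c \<noteq> ?l" for c
    by (cases c) (auto simp: protected_Suc_Node)
  have "forests UNIV n = forests {c. protected (Suc 0) c} n \<union> {B \<in> forests UNIV n. 1 \<le> count B ?l}"
    by (auto simp: forests_def p1 Suc_le_eq)
  moreover have "forests {c. protected (Suc 0) c} n \<inter> {B \<in> forests UNIV n. 1 \<le> count B ?l} = {}"
    by (auto simp: forests_def p1 Suc_le_eq)
  ultimately have "card (forests UNIV n) = card (forests {c. protected (Suc 0) c} n) + card {B \<in> forests UNIV n. 1 \<le> count B ?l}"
    by (subst card_Un_disjoint[symmetric]) auto
  also have "card {B \<in> forests UNIV n. 1 \<le> count B ?l} = card (forests UNIV (n - 1))"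
    using card_forests_count_ge[of ?l UNIV 1 n] n by (simp add: tree_size_Node)
  finally show ?thesis using mn_Suc[of "Suc 0" n] tn_0_Suc[of n] n tn_0_Suc[of "n - 1"] by (simp add: numeral_2_eq_2)
qed

lemma mn_le: "k \<ge> 2 \<Longrightarrow> n > 0 \<Longrightarrow> mn k n \<le> t n - t (n - 1)"
proof -
  assume k: "k \<ge> 2" and n: "n > 0"
  have "mn k n \<le> mn 2 n" unfolding mn_def using tn_antimono[OF k, of n] by simp
  also have "mn 2 n = t n - t (n - 1)"
  proof (cases "n = 1")
    case True
    then show ?thesis by (simp add: mn_def tn_zero)
  next
    case False
    then show ?thesis using n tn_2[of "n - 1"] by simp
  qed
  finally show ?thesis .
qed

lemma divsum_mono: "(\<And>d. a d \<le> b d) \<Longrightarrow> divsum a j \<le> divsum b j"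
  unfolding divsum_def by (rule sum_mono)

lemma divsum_cmult: "divsum (\<lambda>d. c * a d) j = c * divsum a j"
  unfolding divsum_def by (simp add: sum_distrib_left)

lemma divsum_nonneg: "(\<And>d. a d \<ge> 0) \<Longrightarrow> divsum a j \<ge> 0"
  unfolding divsum_def by (rule sum_nonneg)

text \<open>In the recurrence for \<open>mn (Suc k)\<close> the first factor is bounded through Q *
  t and the second by a difference of consecutive values of \<open>t\<close>. The two resulting
  convolutions are instances of the recurrence for \<open>t\<close> itself, at n and at n -
  1.\<close>

lemma tn_step:
  assumes k: "k \<ge> 1" and Q: "\<And>n. tn k n \<le> Q * t n" and n: "n > 0"
  shows "tn (Suc k) (Suc n) \<le> Q * (t (Suc n) - (1 - 1 / real n) * t n)"
proof -
  let ?s = "divsum (\<lambda>d. real d * t d)"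
  have s: "divsum (\<lambda>d. real d * tn k d) j \<le> Q * ?s j" for j
    unfolding divsum_cmult[symmetric]
  proof (rule divsum_mono)
    fix d show "real d * tn k d \<le> Q * (real d * t d)"
      using mult_left_mono[OF Q[of d], of "real d"] by (simp add: mult_ac)
  qed
  have Q0: "Q \<ge> 0" using Q[of 1] order_trans[OF tn_nonneg Q[of 1]] by simp
  have s0: "?s j \<ge> 0" for j by (rule divsum_nonneg) simp
  have "real n * tn (Suc k) (Suc n) = (\<Sum>j=1..n. divsum (\<lambda>d. real d * tn k d) j * mn (Suc k) (Suc n - j))"
    using mn_rec[of n k] n by (simp add: mn_def)
  also have "\<dots> \<le> (\<Sum>j=1..n. (Q * ?s j) * (t (Suc n - j) - t (Suc n - j - 1)))"
  proof (rule sum_mono)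
    fix j assume j: "j \<in> {1..n}"
    show "divsum (\<lambda>d. real d * tn k d) j * mn (Suc k) (Suc n - j) \<le> (Q * ?s j) * (t (Suc n - j) - t (Suc n - j - 1))"
      by (intro mult_mono s mn_le mult_nonneg_nonneg Q0 s0) (use j k in \<open>auto simp: mn_def\<close>)
  qed
  also have "\<dots> = Q * ((\<Sum>j=1..n. ?s j * t (Suc n - j)) - (\<Sum>j=1..n. ?s j * t (n - j)))"
    by (simp add: sum_distrib_left sum_subtractf algebra_simps)
  also have "(\<Sum>j=1..n. ?s j * t (Suc n - j)) = real n * t (Suc n)" by (rule tn_0_rec[symmetric])
  also have "(\<Sum>j=1..n. ?s j * t (n - j)) = real (n - 1) * t n"
  proof -
    obtain m where m: "n = Suc m" using n by (cases n) auto
    have "(\<Sum>j=1..n. ?s j * t (n - j)) = (\<Sum>j=1..m. ?s j * t (Suc m - j))" by (simp add: m)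
    then show ?thesis using tn_0_rec[of m] by (simp add: m)
  qed
  finally have "real n * tn (Suc k) (Suc n) \<le> Q * (real n * t (Suc n) - real (n - 1) * t n)" .
  also have "\<dots> = real n * (Q * (t (Suc n) - (1 - 1 / real n) * t n))"
    using n by (simp add: field_simps of_nat_diff)
  finally show ?thesis using n by simp
qed

text \<open>For m >= 2 the gain (1 - 1/m) t m in \<open>tn_step\<close> is at least t m / 2, hence
  at least t (m + 1) / (2 C) by the growth bound. This fixed proportion of t (m + 1) is lost with
  every k. Small sizes need no estimate, as \<open>tn\<close> vanishes there.\<close>

lemma tn_decay: obtains q where "0 < q" "q < 1" "\<And>k n. tn (Suc k) n \<le> q ^ k * t n"
proof -
  obtain C where C: "C \<ge> 1" "\<And>n. n > 0 \<Longrightarrow> t (Suc n) \<le> C * t n" by (rule t_growth) blast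
  define q where "q = 1 - 1 / (2 * C)"
  have q: "0 < q" "q < 1" using C by (auto simp: q_def divide_simps)
  have "tn (Suc k) n \<le> q ^ k * t n" for k n
  proof (induction k arbitrary: n)
    case 0
    show ?case by (simp add: tn_antimono)
  next
    case (Suc k)
    show ?case
    proof (cases "n \<le> 2")
      case True
      then show ?thesis using q by (simp add: tn_zero)
    next
      case False
      then obtain m where m: "n = Suc m" "m \<ge> 2" by (cases n) auto
      have "tn (Suc (Suc k)) (Suc m) \<le> q ^ k * (t (Suc m) - (1 - 1 / real m) * t m)"
        by (rule tn_step) (use Suc m in auto)
      also have "\<dots> \<le> q ^ k * (t (Suc m) - 1 / (2 * C) * t (Suc m))"
      proof (intro mult_left_mono diff_left_mono)
        have "1 / (2 * C) * t (Suc m) \<le> 1 / (2 * C) * (C * t m)"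
          using C m by (intro mult_left_mono) auto
        also have "\<dots> = 1 / 2 * t m" using C by simp
        also have "\<dots> \<le> (1 - 1 / real m) * t m" using m by (intro mult_right_mono) (auto simp: field_simps)
        finally show "1 / (2 * C) * t (Suc m) \<le> (1 - 1 / real m) * t m" .
      qed (use q in auto)
      also have "\<dots> = q ^ Suc k * t n" by (simp add: q_def m algebra_simps)
      finally show ?thesis using m by simp
    qed
  qed
  then show ?thesis using that q by blast
qed

text \<open>The recurrence for S_k is linear and monotone in its inhomogeneous term
  \<open>tn k\<close>, so the bound by Q * t is inherited.\<close>

lemma sn_mono:
  assumes "\<And>n. tn k n \<le> Q * t n" "Q \<ge> 0"
  shows "sn k n \<le> Q * sn 0 n"
proof (induction n rule: less_induct)
  case (less n)
  have "divsum (sn k) j \<le> Q * divsum (sn 0) j" if "j \<in> {1..<n}" for j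
    unfolding divsum_cmult[symmetric] unfolding divsum_def
    by (intro sum_mono less.IH) (use that in \<open>auto dest: dvd_imp_le\<close>)
  then have "(\<Sum>j=1..<n. divsum (sn k) j * t (n - j)) \<le> (\<Sum>j=1..<n. Q * divsum (sn 0) j * t (n - j))"
    by (intro sum_mono mult_right_mono) auto
  then show ?case using assms(1)[of n] sn_rec[of k n] sn_rec[of 0 n]
    by (simp add: sum_distrib_left algebra_simps)
qed

lemma sn_decay: obtains q where "0 < q" "q < 1" "\<And>k n. sn (Suc k) n / (real n * t n) \<le> q ^ k"
proof -
  obtain q where q: "0 < q" "q < 1" "\<And>k n. tn (Suc k) n \<le> q ^ k * t n" by (rule tn_decay) blast
  have "sn (Suc k) n / (real n * t n) \<le> q ^ k" for k n
  proof (cases "n = 0")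
    case False
    then have "real n * t n > 0" using t_ge_1[of n] by auto
    moreover have "sn (Suc k) n \<le> q ^ k * (real n * t n)"
      using sn_mono[of "Suc k" "q ^ k" n] q by (simp add: sn_0)
    ultimately show ?thesis by (simp only: pos_divide_le_eq)
  qed (use q in simp)
  then show ?thesis using that q by blast
qed

text \<open>\<open>w\<close> is \<open>1\<close> for the first moment and
  \<open>2 k + 1\<close> for the second.\<close>
lemma weighted_limit:
  assumes w: "\<And>k. 0 \<le> w k" "\<And>k. w k \<le> 2 * real k + 1"
  shows "summable (\<lambda>k. w k * Uk (Suc k))"
    and "(\<lambda>n. \<Sum>k. w k * (sn (Suc k) n / (real n * t n))) \<longlonglongrightarrow> (\<Sum>k. w k * Uk (Suc k)) / GG"
proof -
  obtain q where q: "0 < q" "q < 1" "\<And>k n. sn (Suc k) n / (real n * t n) \<le> q ^ k" by (rule sn_decay) blast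
  define M where "M = (\<lambda>k. (2 * real k + 1) * q ^ k)"
  have "summable (\<lambda>k. real k * q ^ k)"
  proof -
    define s where "s = sqrt q"
    have s: "0 < s" "s < 1" "q = s\<^sup>2" using q by (auto simp: s_def)
    have "(\<lambda>n. real n * s ^ n) \<longlonglongrightarrow> 0" using s by (intro powser_times_n_limit_0) auto
    then have "Bseq (\<lambda>n. real n * s ^ n)" by (intro convergent_imp_Bseq convergentI)
    then obtain K where K: "K > 0" "\<And>n. norm (real n * s ^ n) \<le> K" by (auto simp: Bseq_def)
    show ?thesis
    proof (rule summable_comparison_test')
      show "summable (\<lambda>k. K * s ^ k)" using s by (intro summable_mult summable_geometric) auto
      fix k
      have "real k * s ^ k * s ^ k \<le> K * s ^ k" using K(2)[of k] s by (intro mult_right_mono) auto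
      then show "norm (real k * q ^ k) \<le> K * s ^ k"
        using q s by (simp add: power2_eq_square power_mult_distrib)
    qed
  qed
  then have sM: "summable M"
  proof -
    have "M = (\<lambda>k. 2 * (real k * q ^ k) + q ^ k)" by (rule ext) (simp add: M_def algebra_simps)
    then show ?thesis using \<open>summable (\<lambda>k. real k * q ^ k)\<close> q
      by (simp add: summable_add summable_mult summable_geometric)
  qed
  have lim: "(\<lambda>n. w k * (sn (Suc k) n / (real n * t n))) \<longlonglongrightarrow> w k * (Uk (Suc k) / GG)" for k
    by (intro tendsto_intros sn_ratio)
  have bound: "norm (w k * (sn (Suc k) n / (real n * t n))) \<le> M k" for k n
  proof -
    have "norm (w k * (sn (Suc k) n / (real n * t n))) = w k * (sn (Suc k) n / (real n * t n))" using w by simp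
    also have "\<dots> \<le> (2 * real k + 1) * q ^ k" by (intro mult_mono w q) auto
    finally show ?thesis by (simp add: M_def)
  qed
  have T: "summable (\<lambda>k. norm (w k * (Uk (Suc k) / GG)))"
    "(\<lambda>n. \<Sum>k. w k * (sn (Suc k) n / (real n * t n))) \<longlonglongrightarrow> (\<Sum>k. w k * (Uk (Suc k) / GG))"
    using tannerys_theorem[where a = "\<lambda>k n. w k * (sn (Suc k) n / (real n * t n))" and M = M and F = sequentially, OF lim _ sM]
      bound by (auto simp: always_eventually)
  have "summable (\<lambda>k. w k * (Uk (Suc k) / GG) * GG)" using summable_norm_cancel[OF T(1)] by (rule summable_mult2)
  then show s: "summable (\<lambda>k. w k * Uk (Suc k))" using GG_pos by simp
  show "(\<lambda>n. \<Sum>k. w k * (sn (Suc k) n / (real n * t n))) \<longlonglongrightarrow> (\<Sum>k. w k * Uk (Suc k)) / GG"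
    using T(2) suminf_divide[OF s, of GG] by simp
qed

subsection \<open>Moments of the protection number\<close>

lemma vertices_size_le: "v \<in># vertices s \<Longrightarrow> tree_size v \<le> tree_size s"
proof (induction s)
  case (Node B)
  show ?case
  proof (cases "v = Node B")
    case False
    then obtain c where c: "c \<in># B" "v \<in># vertices c" using Node.prems by auto
    then have "tree_size v \<le> tree_size c" using Node.IH by blast
    also have "\<dots> \<le> (\<Sum>c\<in>#B. tree_size c)" by (rule tree_size_le_sum[OF c(1)])
    finally show ?thesis by (simp add: tree_size_Node)
  qed simp
qed

lemma protection_less_size: "protection s < tree_size s"
  using protected_less_size[of "protection s" s] by (simp add: protected_def)

lemma polya_trees_nonempty: "n > 0 \<Longrightarrow> polya_trees n \<noteq> {}"
  using t_ge_1[of n] by (auto simp: tn_0)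

lemma expectation_vertex:
  fixes f :: "nat \<Rightarrow> real"
  assumes s: "tree_size s = n" "n > 0"
  shows "measure_pmf.expectation (pmf_of_multiset (vertices s) \<bind> (\<lambda>v. return_pmf (protection v))) f
    = (\<Sum>v\<in>#vertices s. f (protection v)) / real n"
proof -
  have ne: "vertices s \<noteq> {#}" using s by (auto simp: tree_size_def)
  have "measure_pmf.expectation (pmf_of_multiset (vertices s) \<bind> (\<lambda>v. return_pmf (protection v))) f
    = measure_pmf.expectation (pmf_of_multiset (vertices s)) (\<lambda>v. f (protection v))"
    by (simp flip: map_pmf_def)
  also have "\<dots> = (\<Sum>v\<in>set_mset (vertices s). f (protection v) * pmf (pmf_of_multiset (vertices s)) v)"
    by (rule integral_measure_pmf_real) (use ne in auto)
  also have "\<dots> = (\<Sum>v\<in>set_mset (vertices s). real (count (vertices s) v) * f (protection v)) / real n"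
    using ne s by (simp add: sum_divide_distrib tree_size_def mult.commute)
  also have "(\<Sum>v\<in>set_mset (vertices s). real (count (vertices s) v) * f (protection v)) = (\<Sum>v\<in>#vertices s. f (protection v))"
    by (rule sum_mset_count[symmetric]) auto
  finally show ?thesis .
qed

lemma expectation_Y:
  fixes f :: "nat \<Rightarrow> real"
  assumes n: "n > 0"
  shows "measure_pmf.expectation (Y n) f = (\<Sum>s\<in>polya_trees n. \<Sum>v\<in>#vertices s. f (protection v)) / (real n * t n)"
proof -
  note ne = polya_trees_nonempty[OF n]
  have size: "tree_size s = n" if "s \<in> polya_trees n" for s using that by (simp add: polya_trees_def)
  have "measure_pmf.expectation (Y n) f = (\<Sum>s\<in>polya_trees n. pmf (pmf_of_set (polya_trees n)) s *\<^sub>R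
      measure_pmf.expectation (pmf_of_multiset (vertices s) \<bind> (\<lambda>v. return_pmf (protection v))) f)"
    unfolding Y_def
  proof (rule pmf_expectation_bind)
    fix s assume "s \<in> polya_trees n"
    have "vertices s \<noteq> {#}" by (cases s) simp
    then show "finite (set_pmf (pmf_of_multiset (vertices s) \<bind> (\<lambda>v. return_pmf (protection v))))" by simp
  qed (use ne in auto)
  also have "\<dots> = (\<Sum>s\<in>polya_trees n. (\<Sum>v\<in>#vertices s. f (protection v)) / (real n * t n))"
  proof (rule sum.cong[OF refl])
    fix s assume s: "s \<in> polya_trees n"
    show "pmf (pmf_of_set (polya_trees n)) s *\<^sub>R measure_pmf.expectation (pmf_of_multiset (vertices s) \<bind> (\<lambda>v. return_pmf (protection v))) f
      = (\<Sum>v\<in>#vertices s. f (protection v)) / (real n * t n)"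
      using s ne by (simp add: expectation_vertex[OF size[OF s] n] tn_0 mult.commute)
  qed
  finally show ?thesis by (simp add: sum_divide_distrib)
qed

lemma sum_mset_protected:
  "(\<Sum>v\<in>#M. if protected k v then c else 0) = real (size {#v \<in># M. protected k v#}) * (c :: real)"
  by (induction M) (auto simp: algebra_simps)

lemma sum_mset_sum: "finite K \<Longrightarrow> (\<Sum>v\<in>#M. \<Sum>k\<in>K. g k v) = (\<Sum>k\<in>K. \<Sum>v\<in>#M. (g k v :: real))"
  by (induction M) (auto simp: sum.distrib)

text \<open>Summation by layers: \<open>w k\<close> is counted once for each vertex that is (k +
  1)-protected. Only k < n contribute, because such a vertex carries a subtree with more than k + 1
  vertices.\<close>

lemma expectation_Y_weighted:
  assumes n: "n > 0" and f: "\<And>m. f m = (\<Sum>k<m. w k)"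
  shows "measure_pmf.expectation (Y n) f = (\<Sum>k. w k * (sn (Suc k) n / (real n * t n)))"
proof -
  have "(\<Sum>s\<in>polya_trees n. \<Sum>v\<in>#vertices s. f (protection v)) = (\<Sum>k<n. w k * sn (Suc k) n)"
  proof -
    have "(\<Sum>v\<in>#vertices s. f (protection v)) = (\<Sum>k<n. real (size {#v \<in># vertices s. protected (Suc k) v#}) * w k)"
      if s: "s \<in> polya_trees n" for s
    proof -
      have "f (protection v) = (\<Sum>k<n. if protected (Suc k) v then w k else 0)" if v: "v \<in># vertices s" for v
      proof -
        have "protection v < n"
          using protection_less_size[of v] vertices_size_le[OF v] s by (simp add: polya_trees_def)
        then have "{k \<in> {..<n}. protected (Suc k) v} = {..<protection v}" by (auto simp: protected_def Suc_le_eq)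
        then show ?thesis by (simp add: f sum.If_cases Int_def)
      qed
      then have "(\<Sum>v\<in>#vertices s. f (protection v)) = (\<Sum>v\<in>#vertices s. \<Sum>k<n. if protected (Suc k) v then w k else 0)"
        by (intro arg_cong[of _ _ sum_mset] image_mset_cong) auto
      then show ?thesis by (simp add: sum_mset_sum sum_mset_protected)
    qed
    then have "(\<Sum>s\<in>polya_trees n. \<Sum>v\<in>#vertices s. f (protection v)) =
      (\<Sum>s\<in>polya_trees n. \<Sum>k<n. real (size {#v \<in># vertices s. protected (Suc k) v#}) * w k)" by simp
    also have "\<dots> = (\<Sum>k<n. \<Sum>s\<in>polya_trees n. real (size {#v \<in># vertices s. protected (Suc k) v#}) * w k)"
      by (rule sum.swap)
    finally show ?thesis by (simp add: sn_def sum_distrib_left mult.commute)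
  qed
  then have "measure_pmf.expectation (Y n) f = (\<Sum>k<n. w k * (sn (Suc k) n / (real n * t n)))"
    by (simp add: expectation_Y[OF n] sum_divide_distrib)
  also have "\<dots> = (\<Sum>k. w k * (sn (Suc k) n / (real n * t n)))"
  proof (rule suminf_finite[symmetric])
    fix k assume "k \<notin> {..<n}"
    then have "sn (Suc k) n \<le> 0 * sn 0 n" 
    proof -
      have *: "protected (Suc k) v = False" if "s \<in> polya_trees n" "v \<in># vertices s" for s v
        using that vertices_size_le[OF that(2)] protected_less_size[of "Suc k" v] \<open>k \<notin> {..<n}\<close>
        by (auto simp: polya_trees_def)
      have emp: "{#v \<in># vertices s. protected (Suc k) v#} = {#}" if "s \<in> polya_trees n" for s
      proof -
        have "{#v \<in># vertices s. protected (Suc k) v#} = {#v \<in># vertices s. False#}"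
          by (rule filter_mset_cong) (use * that in auto)
        then show ?thesis by simp
      qed
      show ?thesis unfolding sn_def by (simp only: emp cong: sum.cong) simp
    qed
    then show "w k * (sn (Suc k) n / (real n * t n)) = 0"
      using sn_nonneg[of "Suc k" n] by (simp add: order_antisym)
  qed simp
  finally show ?thesis .
qed

definition E1 :: real where "E1 = (\<Sum>k. Uk (Suc k))"
definition E2 :: real where "E2 = (\<Sum>k. (2 * real k + 1) * Uk (Suc k))"

lemma summable_Uk: "summable (\<lambda>k. Uk (Suc k))" "summable (\<lambda>k. (2 * real k + 1) * Uk (Suc k))"
  using weighted_limit(1)[of "\<lambda>_. 1"] weighted_limit(1)[of "\<lambda>k. 2 * real k + 1"] by auto

lemma expectation_limit: "(\<lambda>n. measure_pmf.expectation (Y n) real) \<longlonglongrightarrow> E1 / GG"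
proof -
  have "(\<lambda>n. \<Sum>k. 1 * (sn (Suc k) n / (real n * t n))) \<longlonglongrightarrow> (\<Sum>k. 1 * Uk (Suc k)) / GG"
    by (rule weighted_limit) auto
  moreover have "eventually (\<lambda>n. (\<Sum>k. 1 * (sn (Suc k) n / (real n * t n))) = measure_pmf.expectation (Y n) real) sequentially"
    using eventually_gt_at_top[of 0]
    by eventually_elim (rule expectation_Y_weighted[symmetric], auto)
  ultimately have "(\<lambda>n. measure_pmf.expectation (Y n) real) \<longlonglongrightarrow> (\<Sum>k. 1 * Uk (Suc k)) / GG"
    by (rule Lim_transform_eventually)
  then show ?thesis by (simp add: E1_def)
qed

lemma sum_odd_sq: "(real m)\<^sup>2 = (\<Sum>k<m. 2 * real k + 1)"
  by (induction m) (auto simp: power2_eq_square algebra_simps)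

lemma variance_limit: "(\<lambda>n. measure_pmf.variance (Y n) real) \<longlonglongrightarrow> E2 / GG - (E1 / GG)\<^sup>2"
proof -
  have "(\<lambda>n. \<Sum>k. (2 * real k + 1) * (sn (Suc k) n / (real n * t n))) \<longlonglongrightarrow> (\<Sum>k. (2 * real k + 1) * Uk (Suc k)) / GG"
    by (rule weighted_limit) auto
  moreover have "eventually (\<lambda>n. (\<Sum>k. (2 * real k + 1) * (sn (Suc k) n / (real n * t n))) = measure_pmf.expectation (Y n) (\<lambda>y. (real y)\<^sup>2)) sequentially"
    using eventually_gt_at_top[of 0]
    by eventually_elim (rule expectation_Y_weighted[symmetric], auto simp: sum_odd_sq)
  ultimately have "(\<lambda>n. measure_pmf.expectation (Y n) (\<lambda>y. (real y)\<^sup>2)) \<longlonglongrightarrow> E2 / GG"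
    unfolding E2_def by (rule Lim_transform_eventually)
  then have "(\<lambda>n. measure_pmf.expectation (Y n) (\<lambda>y. (real y)\<^sup>2) - (measure_pmf.expectation (Y n) real)\<^sup>2) \<longlonglongrightarrow> E2 / GG - (E1 / GG)\<^sup>2"
    by (intro tendsto_intros expectation_limit)
  moreover have "eventually (\<lambda>n. measure_pmf.expectation (Y n) (\<lambda>y. (real y)\<^sup>2) - (measure_pmf.expectation (Y n) real)\<^sup>2 = measure_pmf.variance (Y n) real) sequentially"
    using eventually_gt_at_top[of 0]
  proof eventually_elim
    case (elim n)
    have "vertices s \<noteq> {#}" for s by (cases s) simp
    then have "finite (set_pmf (Y n))" unfolding Y_def
      using polya_trees_nonempty[OF elim] by (auto intro!: finite_UN_I)
    then show ?case
      by (intro measure_pmf.variance_eq[symmetric] integrable_measure_pmf_finite)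
  qed
  ultimately show ?thesis by (rule Lim_transform_eventually)
qed

subsection \<open>Integer computations\<close>

text \<open>
  A list represents a sequence starting at index \<open>1\<close>. The rows of \<open>table\<close> are the coefficients of \<open>T\<^sub>0, T\<^sub>1, \<dots>\<close>;
  \<open>s_one\<close> and \<open>s_two\<close> are those of \<open>\<Sum>k. S\<^sub>k\<close> and \<open>\<Sum>k. (2 k - 1) S\<^sub>k\<close> for \<open>1 \<le> k \<le> 39\<close>. With \<open>lo \<le> \<rho> \<le> hi\<close>,
  \<open>pow_lo\<close> and \<open>pow_hi\<close> bound \<open>10\<^sup>3\<^sup>2 lo\<^sup>m\<close> from below and \<open>10\<^sup>3\<^sup>2 hi\<^sup>m\<close> from above, and \<open>pow_lo_div\<close>, \<open>pow_hi_div\<close>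
  bound the same powers divided by \<open>m\<close>. The lists \<open>A_lo\<close>, \<open>A_hi\<close> enclose \<open>10\<^sup>1\<^sup>6 \<Sum>i\<ge>2. T\<^sub>k(\<rho>\<^sup>i) / i\<close>,
  and \<open>T_lo\<close>, \<open>T_hi\<close> enclose \<open>10\<^sup>1\<^sup>6 T\<^sub>k(\<rho>)\<close> for \<open>k \<ge> 1\<close>. All of them were computed outside the logic;
  the checks below certify them.
\<close>

fun dot :: "int list \<Rightarrow> int list \<Rightarrow> int" where
  "dot (x # xs) (y # ys) = x * y + dot xs ys"
| "dot _ _ = 0"

fun lin :: "int \<Rightarrow> int list \<Rightarrow> int list" where
  "lin d [] = []"
| "lin d (x # xs) = d * x # lin (d + 1) xs"

fun pick :: "int list \<Rightarrow> nat list \<Rightarrow> int" where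
  "pick xs [] = 0"
| "pick xs (i # is) = xs ! i + pick xs is"

text \<open>Row \<open>m\<close> lists the positions of the proper divisors of \<open>m + 1\<close>.\<close>
definition dividx :: "nat list list" where
  "dividx = [[], [0], [0], [0,1], [0], [0,1,2], [0], [0,1,3], [0,2], [0,1,4], [0], [0,1,2,3,5], [0], [0,1,6], 
     [0,2,4], [0,1,3,7], [0], [0,1,2,5,8], [0], [0,1,3,4,9], [0,2,6], [0,1,10], [0], [0,1,2,3,5,7,11], 
     [0,4], [0,1,12], [0,2,8], [0,1,3,6,13], [0], [0,1,2,4,5,9,14], [0], [0,1,3,7,15], [0,2,10], 
     [0,1,16], [0,4,6], [0,1,2,3,5,8,11,17], [0], [0,1,18], [0,2,12], [0,1,3,4,7,9,19], [0], 
     [0,1,2,5,6,13,20], [0], [0,1,3,10,21], [0,2,4,8,14], [0,1,22], [0], [0,1,2,3,5,7,11,15,23], [0,6], 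
     [0,1,4,9,24], [0,2,16], [0,1,3,12,25], [0], [0,1,2,5,8,17,26], [0,4,10], [0,1,3,6,7,13,27], 
     [0,2,18], [0,1,28], [0], [0,1,2,3,4,5,9,11,14,19,29], [0], [0,1,30], [0,2,6,8,20], [0,1,3,7,15,31], 
     [0,4,12], [0,1,2,5,10,21,32], [0], [0,1,3,16,33], [0,2,22], [0,1,4,6,9,13,34], [0], 
     [0,1,2,3,5,7,8,11,17,23,35], [0], [0,1,36], [0,2,4,14,24], [0,1,3,18,37], [0,6,10], 
     [0,1,2,5,12,25,38], [0], [0,1,3,4,7,9,15,19,39]]"

definition table :: "int list list" where
  "table = [[1, 1, 2, 4, 9, 20, 48, 115, 286, 719, 1842, 4766, 12486, 32973, 87811, 235381, 634847, 1721159, 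
     4688676, 12826228, 35221832, 97055181, 268282855, 743724984, 2067174645, 5759636510, 16083734329, 
     45007066269, 126186554308, 354426847597, 997171512998, 2809934352700, 7929819784355, 22409533673568, 
     63411730258053, 179655930440464, 509588049810620, 1447023384581029, 4113254119923150, 
     11703780079612453],
     [0, 1, 2, 4, 9, 20, 48, 115, 286, 719, 1842, 4766, 12486, 32973, 87811, 235381, 634847, 1721159, 
     4688676, 12826228, 35221832, 97055181, 268282855, 743724984, 2067174645, 5759636510, 16083734329, 
     45007066269, 126186554308, 354426847597, 997171512998, 2809934352700, 7929819784355, 22409533673568, 
     63411730258053, 179655930440464, 509588049810620, 1447023384581029, 4113254119923150, 
     11703780079612453],
     [0, 0, 1, 2, 5, 11, 28, 67, 171, 433, 1123, 2924, 7720, 20487, 54838, 147570, 399466, 1086312, 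
     2967517, 8137552, 22395604, 61833349, 171227674, 475442129, 1323449661, 3692461865, 10324097819, 
     28923331940, 81179488039, 228240293289, 642744665401, 1812762839702, 5119885431655, 14479713889213, 
     41002196584485, 116244200182411, 329932119370156, 937435334770409, 2666230735342121, 
     7590525959689303],
     [0, 0, 0, 1, 2, 5, 12, 30, 75, 193, 500, 1309, 3461, 9220, 24723, 66696, 180865, 492752, 1348122, 
     3702257, 10202173, 28201628, 78180081, 217298416, 605434087, 1690625172, 4730723902, 13263080237, 
     37251266334, 104801215344, 295307153221, 833339447182, 2354897382190, 6663296890530, 18877370118450, 
     53542618766708, 152032526042336, 432142813849411, 1229557802947832, 3501709944225807],
     [0, 0, 0, 0, 1, 2, 5, 12, 31, 77, 201, 522, 1379, 3658, 9799, 26370, 71420, 194273, 530903, 1456281, 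
     4009140, 11072067, 30668691, 85177089, 237154299, 661805323, 1850766075, 5185933898, 14557920947, 
     40936906155, 115299306738, 325230173474, 918688352829, 2598500637286, 7359052237140, 20865808969432, 
     59229105674958, 168304683546130, 478734525738790, 1363041289387558],
     [0, 0, 0, 0, 0, 1, 2, 5, 12, 31, 78, 203, 530, 1401, 3728, 9999, 26960, 73109, 199147, 544813, 
     1496055, 4122443, 11394928, 31587591, 87792905, 244599162, 683000850, 1911123875, 5357887839, 
     15048014867, 42334466030, 119286701085, 336612983318, 951201060476, 2691419562097, 7624758481268, 
     21626039152314, 61405468662318, 174538545733806, 496600163063605],
     [0, 0, 0, 0, 0, 0, 1, 2, 5, 12, 31, 78, 204, 532, 1409, 3750, 10069, 27160, 73702, 200847, 549729, 
     1510115, 4162722, 11509868, 31915669, 88728074, 247265109, 690598508, 1932781372, 5419632899, 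
     15224112831, 42836883690, 120720778567, 340708258946, 962901778732, 2724867115045, 7720421560364, 
     21899788543698, 62189243582638, 176783757355489],
     [0, 0, 0, 0, 0, 0, 0, 1, 2, 5, 12, 31, 78, 204, 533, 1411, 3758, 10091, 27230, 73902, 201440, 551432, 
     1515042, 4176824, 11550297, 32031114, 89057792, 248205509, 693280797, 1940429452, 5441444319, 
     15286323923, 43014383138, 121227388385, 342154819856, 967034091621, 2736677382398, 7754192308983, 
     21996403066809, 62465788797463],
     [0, 0, 0, 0, 0, 0, 0, 0, 1, 2, 5, 12, 31, 78, 204, 533, 1412, 3760, 10099, 27252, 73972, 201640, 
     552025, 1516745, 4181754, 11564410, 32071585, 89173387, 248535732, 694222837, 1943116975, 
     5449108755, 15308185838, 43076748444, 121405354993, 342662835223, 968484858933, 2740822226959, 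
     7766039773804, 22030283886411],
     [0, 0, 0, 0, 0, 0, 0, 0, 0, 1, 2, 5, 12, 31, 78, 204, 533, 1412, 3761, 10101, 27260, 73994, 201710, 
     552225, 1517338, 4183457, 11569340, 32085701, 89213869, 248651369, 694553210, 1944059520, 
     5451797918, 15315855508, 43098626718, 121467770808, 342840956118, 968993341751, 2742274400948, 
     7770188828832],
     [0, 0, 0, 0, 0, 0, 0, 0, 0, 0, 1, 2, 5, 12, 31, 78, 204, 533, 1412, 3761, 10102, 27262, 74002, 
     201732, 552295, 1517538, 4184050, 11571043, 32090631, 89227985, 248691854, 694668858, 1944389935, 
     5452740613, 15318545176, 43106298028, 121489654316, 342903388292, 969171513158, 2742783038067],
     [0, 0, 0, 0, 0, 0, 0, 0, 0, 0, 0, 1, 2, 5, 12, 31, 78, 204, 533, 1412, 3761, 10102, 27263, 74004, 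
     201740, 552317, 1517608, 4184250, 11571636, 32092334, 89232915, 248705970, 694709343, 1944505586, 
     5453071039, 15319487913, 43108987846, 121497326131, 342925273440, 969233950566],
     [0, 0, 0, 0, 0, 0, 0, 0, 0, 0, 0, 0, 1, 2, 5, 12, 31, 78, 204, 533, 1412, 3761, 10102, 27263, 74005, 
     201742, 552325, 1517630, 4184320, 11571836, 32092927, 89234618, 248710900, 694723459, 1944546071, 
     5453186690, 15319818342, 43109930594, 121500015991, 342932945405],
     [0, 0, 0, 0, 0, 0, 0, 0, 0, 0, 0, 0, 0, 1, 2, 5, 12, 31, 78, 204, 533, 1412, 3761, 10102, 27263, 
     74005, 201743, 552327, 1517638, 4184342, 11571906, 32093127, 89235211, 248712603, 694728389, 
     1944560187, 5453227175, 15319933993, 43110261023, 121500958742],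
     [0, 0, 0, 0, 0, 0, 0, 0, 0, 0, 0, 0, 0, 0, 1, 2, 5, 12, 31, 78, 204, 533, 1412, 3761, 10102, 27263, 
     74005, 201743, 552328, 1517640, 4184350, 11571928, 32093197, 89235411, 248713196, 694730092, 
     1944565117, 5453241291, 15319974478, 43110376674],
     [0, 0, 0, 0, 0, 0, 0, 0, 0, 0, 0, 0, 0, 0, 0, 1, 2, 5, 12, 31, 78, 204, 533, 1412, 3761, 10102, 
     27263, 74005, 201743, 552328, 1517641, 4184352, 11571936, 32093219, 89235481, 248713396, 694730685, 
     1944566820, 5453246221, 15319988594],
     [0, 0, 0, 0, 0, 0, 0, 0, 0, 0, 0, 0, 0, 0, 0, 0, 1, 2, 5, 12, 31, 78, 204, 533, 1412, 3761, 10102, 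
     27263, 74005, 201743, 552328, 1517641, 4184353, 11571938, 32093227, 89235503, 248713466, 694730885, 
     1944567413, 5453247924],
     [0, 0, 0, 0, 0, 0, 0, 0, 0, 0, 0, 0, 0, 0, 0, 0, 0, 1, 2, 5, 12, 31, 78, 204, 533, 1412, 3761, 10102, 
     27263, 74005, 201743, 552328, 1517641, 4184353, 11571939, 32093229, 89235511, 248713488, 694730955, 
     1944567613],
     [0, 0, 0, 0, 0, 0, 0, 0, 0, 0, 0, 0, 0, 0, 0, 0, 0, 0, 1, 2, 5, 12, 31, 78, 204, 533, 1412, 3761, 
     10102, 27263, 74005, 201743, 552328, 1517641, 4184353, 11571939, 32093230, 89235513, 248713496, 
     694730977],
     [0, 0, 0, 0, 0, 0, 0, 0, 0, 0, 0, 0, 0, 0, 0, 0, 0, 0, 0, 1, 2, 5, 12, 31, 78, 204, 533, 1412, 3761, 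
     10102, 27263, 74005, 201743, 552328, 1517641, 4184353, 11571939, 32093230, 89235514, 248713498],
     [0, 0, 0, 0, 0, 0, 0, 0, 0, 0, 0, 0, 0, 0, 0, 0, 0, 0, 0, 0, 1, 2, 5, 12, 31, 78, 204, 533, 1412, 
     3761, 10102, 27263, 74005, 201743, 552328, 1517641, 4184353, 11571939, 32093230, 89235514],
     [0, 0, 0, 0, 0, 0, 0, 0, 0, 0, 0, 0, 0, 0, 0, 0, 0, 0, 0, 0, 0, 1, 2, 5, 12, 31, 78, 204, 533, 1412, 
     3761, 10102, 27263, 74005, 201743, 552328, 1517641, 4184353, 11571939, 32093230],
     [0, 0, 0, 0, 0, 0, 0, 0, 0, 0, 0, 0, 0, 0, 0, 0, 0, 0, 0, 0, 0, 0, 1, 2, 5, 12, 31, 78, 204, 533, 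
     1412, 3761, 10102, 27263, 74005, 201743, 552328, 1517641, 4184353, 11571939],
     [0, 0, 0, 0, 0, 0, 0, 0, 0, 0, 0, 0, 0, 0, 0, 0, 0, 0, 0, 0, 0, 0, 0, 1, 2, 5, 12, 31, 78, 204, 533, 
     1412, 3761, 10102, 27263, 74005, 201743, 552328, 1517641, 4184353],
     [0, 0, 0, 0, 0, 0, 0, 0, 0, 0, 0, 0, 0, 0, 0, 0, 0, 0, 0, 0, 0, 0, 0, 0, 1, 2, 5, 12, 31, 78, 204, 
     533, 1412, 3761, 10102, 27263, 74005, 201743, 552328, 1517641],
     [0, 0, 0, 0, 0, 0, 0, 0, 0, 0, 0, 0, 0, 0, 0, 0, 0, 0, 0, 0, 0, 0, 0, 0, 0, 1, 2, 5, 12, 31, 78, 204, 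
     533, 1412, 3761, 10102, 27263, 74005, 201743, 552328],
     [0, 0, 0, 0, 0, 0, 0, 0, 0, 0, 0, 0, 0, 0, 0, 0, 0, 0, 0, 0, 0, 0, 0, 0, 0, 0, 1, 2, 5, 12, 31, 78, 
     204, 533, 1412, 3761, 10102, 27263, 74005, 201743],
     [0, 0, 0, 0, 0, 0, 0, 0, 0, 0, 0, 0, 0, 0, 0, 0, 0, 0, 0, 0, 0, 0, 0, 0, 0, 0, 0, 1, 2, 5, 12, 31, 
     78, 204, 533, 1412, 3761, 10102, 27263, 74005],
     [0, 0, 0, 0, 0, 0, 0, 0, 0, 0, 0, 0, 0, 0, 0, 0, 0, 0, 0, 0, 0, 0, 0, 0, 0, 0, 0, 0, 1, 2, 5, 12, 31, 
     78, 204, 533, 1412, 3761, 10102, 27263],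
     [0, 0, 0, 0, 0, 0, 0, 0, 0, 0, 0, 0, 0, 0, 0, 0, 0, 0, 0, 0, 0, 0, 0, 0, 0, 0, 0, 0, 0, 1, 2, 5, 12, 
     31, 78, 204, 533, 1412, 3761, 10102],
     [0, 0, 0, 0, 0, 0, 0, 0, 0, 0, 0, 0, 0, 0, 0, 0, 0, 0, 0, 0, 0, 0, 0, 0, 0, 0, 0, 0, 0, 0, 1, 2, 5, 
     12, 31, 78, 204, 533, 1412, 3761],
     [0, 0, 0, 0, 0, 0, 0, 0, 0, 0, 0, 0, 0, 0, 0, 0, 0, 0, 0, 0, 0, 0, 0, 0, 0, 0, 0, 0, 0, 0, 0, 1, 2, 
     5, 12, 31, 78, 204, 533, 1412],
     [0, 0, 0, 0, 0, 0, 0, 0, 0, 0, 0, 0, 0, 0, 0, 0, 0, 0, 0, 0, 0, 0, 0, 0, 0, 0, 0, 0, 0, 0, 0, 0, 1, 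
     2, 5, 12, 31, 78, 204, 533],
     [0, 0, 0, 0, 0, 0, 0, 0, 0, 0, 0, 0, 0, 0, 0, 0, 0, 0, 0, 0, 0, 0, 0, 0, 0, 0, 0, 0, 0, 0, 0, 0, 0, 
     1, 2, 5, 12, 31, 78, 204],
     [0, 0, 0, 0, 0, 0, 0, 0, 0, 0, 0, 0, 0, 0, 0, 0, 0, 0, 0, 0, 0, 0, 0, 0, 0, 0, 0, 0, 0, 0, 0, 0, 0, 
     0, 1, 2, 5, 12, 31, 78],
     [0, 0, 0, 0, 0, 0, 0, 0, 0, 0, 0, 0, 0, 0, 0, 0, 0, 0, 0, 0, 0, 0, 0, 0, 0, 0, 0, 0, 0, 0, 0, 0, 0, 
     0, 0, 1, 2, 5, 12, 31],
     [0, 0, 0, 0, 0, 0, 0, 0, 0, 0, 0, 0, 0, 0, 0, 0, 0, 0, 0, 0, 0, 0, 0, 0, 0, 0, 0, 0, 0, 0, 0, 0, 0, 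
     0, 0, 0, 1, 2, 5, 12],
     [0, 0, 0, 0, 0, 0, 0, 0, 0, 0, 0, 0, 0, 0, 0, 0, 0, 0, 0, 0, 0, 0, 0, 0, 0, 0, 0, 0, 0, 0, 0, 0, 0, 
     0, 0, 0, 0, 1, 2, 5],
     [0, 0, 0, 0, 0, 0, 0, 0, 0, 0, 0, 0, 0, 0, 0, 0, 0, 0, 0, 0, 0, 0, 0, 0, 0, 0, 0, 0, 0, 0, 0, 0, 0, 
     0, 0, 0, 0, 0, 1, 2],
     [0, 0, 0, 0, 0, 0, 0, 0, 0, 0, 0, 0, 0, 0, 0, 0, 0, 0, 0, 0, 0, 0, 0, 0, 0, 0, 0, 0, 0, 0, 0, 0, 0, 
     0, 0, 0, 0, 0, 0, 1]]"

definition s_one :: "int list" where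
  "s_one = [0, 1, 4, 12, 36, 100, 288, 805, 2288, 6470, 18417, 52411, 149774, 428432, 1228590, 3528083, 
     10148767, 29230903, 84303374, 243403118, 703507707, 2035261260, 5893251828, 17078070398, 
     49527696257, 143733423120, 417395407571, 1212825514567, 3526086787462, 10256897951907, 
     29850630606517, 86914567192650, 253175442741706, 737784982370819, 2150836822496885, 
     6272569620874932, 18299345747834266, 53403531196771174, 155898377118254368, 455243550172032745]"

definition s_two :: "int list" where
  "s_two = [0, 1, 6, 22, 72, 212, 626, 1785, 5130, 14628, 41893, 119797, 343656, 986202, 2835718, 8162047, 
     23525737, 67878593, 196067790, 566869916, 1640435257, 4751052890, 13770772862, 39942583820, 
     115932480325, 336700943366, 978447073345, 2844904633749, 8276015934072, 24087112474393, 
     70136805164673, 204311988166634, 595412795137814, 1735839115901643, 5062430575687553, 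
     14769266677015656, 43102411289858232, 125828799188029888, 367441280683975008, 1073295346000467283]"

definition pow_lo :: "int list" where
  "pow_lo = [33832185689911000000000000000000, 11446167885566186470471879210000, 3872488773423711825123549287600, 
     1310147592645667040157940163375, 443251566355780825407906541686, 149961693002926841007360996190, 
     50735318440484480077688833911, 17164867145152367002102711361, 5807249725974473905822489905, 
     1964719510768531721562343224, 664707553169120597760941735, 224885093683040770652199272, 
     76083542483776665832081175, 25740725372573645356389925, 8708650005979150783394311, 
     2946326641107311697217731, 996806700250743334859207, 337241493798306022691642, 
     114096168405272582742009, 38601227559945386354054, 13059638986665824081363, 4418361312400792864277, 
     1494828203662624897306, 505733053608300239283, 171100545792017279789, 57887054368806487809, 
     19584455724474348913, 6625849427062566335, 2241669681697711548, 758405849266406629, 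
     256585275206957212, 86808406760986934, 29369181369830354, 9936235976647752, 3361645806207209, 
     1137318251393128, 384779622696571, 130179356447642, 44042521603297, 14900547691346, 5041180963749, 
     1705541704620, 577022036525, 195219166868, 66046911037, 22345113584, 7559840320, 2557659214, 
     865312014, 292753967, 99045065, 33509110, 11336864, 3835508, 1297636, 439018, 148529, 50250, 17000, 
     5751, 1945, 658, 222, 75, 25, 8, 2, 0, 0, 0, 0, 0, 0, 0, 0, 0, 0, 0, 0, 0]"

definition pow_hi :: "int list" where
  "pow_hi = [33832185689930000000000000000000, 11446167885579042701034049000000, 3872488773430236140818325677915, 
     1310147592648610131625744663603, 443251566357025465620921323344, 149961693003432147793007295777, 
     50735318440683929129383062640, 17164867145229484686132399354, 5807249726003825828640766390, 
     1964719510779565496041722611, 664707553173226861538459498, 224885093684556303873429550, 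
     76083542484332132013480159, 25740725372776027579397511, 8708650006052511850706435, 
     2946326641133785993236020, 996806700260259969910028, 337241493801715101606517, 
     114096168406490024534628, 38601227560378951793998, 13059638986819842979329, 4418361312455382155243, 
     1494828203681933136243, 505733053615116655893, 171100545794419511795, 57887054369651724507, 
     19584455724771309504, 6625849427166755641, 2241669681734219980, 758405849279184148, 
     256585275211424224, 86808406762546974, 29369181370374644, 9936235976837478, 3361645806273286, 
     1137318251416123, 384779622704568, 130179356450422, 44042521604263, 14900547691682, 5041180963867, 
     1705541704661, 577022036541, 195219166875, 66046911040, 22345113586, 7559840322, 2557659216, 
     865312016, 292753969, 99045067, 33509111, 11336865, 3835510, 1297637, 439019, 148530, 50251, 17002, 
     5753, 1947, 659, 223, 76, 26, 9, 4, 2, 1, 1, 1, 1, 1, 1, 1, 1, 1, 1, 1, 1]"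

definition pow_lo_div :: "int list" where
  "pow_lo_div = [33832185689911000000000000000000, 5723083942783093235235939605000, 1290829591141237275041183095866, 
     327536898161416760039485040843, 88650313271156165081581308337, 24993615500487806834560166031, 
     7247902634354925725384119130, 2145608393144045875262838920, 645249969552719322869165545, 
     196471951076853172156234322, 60427959379010963432812885, 18740424473586730887683272, 
     5852580191059743525544705, 1838623240898117525456423, 580576667065276718892954, 
     184145415069206981076108, 58635688250043725579953, 18735638544350334593980, 6005061495014346460105, 
     1930061377997269317702, 621887570793610670541, 200834605109126948376, 64992530594027169448, 
     21072210567012509970, 6844021831680691191, 2226425168031018761, 725350212017568478, 
     236637479537948797, 77298954541300398, 25280194975546887, 8276944361514748, 2712762711280841, 
     889975193025162, 292242234607286, 96047023034491, 31592173649809, 10399449262069, 3425772538095, 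
     1129295425725, 372513692283, 122955633262, 40608135824, 13419117128, 4436799247, 1467709134, 
     485763338, 160847666, 53284566, 17659428, 5855079, 1942060, 644405, 213903, 71027, 23593, 7839, 
     2605, 866, 288, 95, 31, 10, 3, 1, 0, 0, 0, 0, 0, 0, 0, 0, 0, 0, 0, 0, 0, 0, 0, 0]"

definition pow_hi_div :: "int list" where
  "pow_hi_div = [33832185689930000000000000000000, 5723083942789521350517024500000, 1290829591143412046939441892639, 
     327536898162152532906436165901, 88650313271405093124184264669, 24993615500572024632167882630, 
     7247902634383418447054723235, 2145608393153685585766549920, 645249969555980647626751822, 
     196471951077956549604172262, 60427959379384260139859955, 18740424473713025322785796, 
     5852580191102471693344628, 1838623240912573398528394, 580576667070167456713763, 
     184145415070861624577252, 58635688250603527641767, 18735638544539727867029, 6005061495078422343928, 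
     1930061378018947589700, 621887570800944903778, 200834605111608279784, 64992530594866658098, 
     21072210567296527329, 6844021831776780472, 2226425168063527866, 725350212028567019, 
     236637479541669845, 77298954542559310, 25280194975972805, 8276944361658846, 2712762711329593, 
     889975193041656, 292242234612867, 96047023036380, 31592173650448, 10399449262286, 3425772538169, 
     1129295425751, 372513692293, 122955633266, 40608135826, 13419117129, 4436799248, 1467709135, 
     485763339, 160847667, 53284567, 17659429, 5855080, 1942061, 644406, 213904, 71028, 23594, 7840, 
     2606, 867, 289, 96, 32, 11, 4, 2, 1, 1, 1, 1, 1, 1, 1, 1, 1, 1, 1, 1, 1, 1, 1, 1]"

definition A_lo :: "int list" where
  "A_lo = [837575972445622, 91034242011595, 10095530401676, 1140810831536, 129978313268, 14853870852, 
     1699277316, 194466373, 22257561, 2547584, 291598, 33376, 3820, 437, 50, 5, 0, 0, 0, 0, 0, 0, 0, 0, 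
     0, 0, 0, 0, 0, 0]"

definition A_hi :: "int list" where
  "A_hi = [837575972446909, 91034242011910, 10095530401762, 1140810831565, 129978313279, 14853870858, 
     1699277319, 194466376, 22257564, 2547586, 291600, 33378, 3822, 439, 52, 7, 2, 2, 2, 2, 2, 2, 2, 2, 
     2, 2, 2, 2, 2, 2]"

definition T_lo :: "int list" where
  "T_lo = [6616781431006999, 3233562862014217, 1296291109982283, 468697434806852, 162391496734712, 
     55394219206982, 18793656539347, 6364349228810, 2153891314784, 728787854846, 246573943890, 
     83422394336, 28223738375, 9548721198, 3230542645, 1092963364, 369773414, 125102430, 42324886, 
     14319434, 4844577, 1639026, 554518, 187605, 63470, 21473, 7264, 2457, 831, 281]"

definition T_hi :: "int list" where
  "T_hi = [6616781431008900, 3233562862017502, 1296291109984590, 468697434808016, 162391496735221, 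
     55394219207192, 18793656539431, 6364349228845, 2153891314800, 728787854854, 246573943895, 
     83422394340, 28223738378, 9548721201, 3230542648, 1092963367, 369773417, 125102433, 42324889, 
     14319437, 4844580, 1639029, 554521, 187608, 63473, 21476, 7267, 2460, 834, 284]"

text \<open>A proper divisor of a number up to 80 is at most 40, which is why 40 coefficients
  determine 80 entries.\<close>

definition lam :: "int list \<Rightarrow> int list" where
  "lam xs = map (pick xs) dividx"

fun vadd :: "int list \<Rightarrow> int list \<Rightarrow> int list" where
  "vadd (x # xs) (y # ys) = (x + y) # vadd xs ys"
| "vadd _ _ = []"

text \<open>The list \<open>rm\<close> is the reversed prefix accepted so far; each new entry is
  certified by the recurrence with \<open>S\<close> as divisor sums. Checking needs no division, in
  contrast to computing the entries.\<close>

fun check_euler :: "int list \<Rightarrow> int list \<Rightarrow> int list \<Rightarrow> int \<Rightarrow> bool" where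
  "check_euler S rm [] n \<longleftrightarrow> True"
| "check_euler S rm (b # bs) n \<longleftrightarrow> n * b = dot S rm \<and> check_euler S (b # rm) bs (n + 1)"

text \<open>The first entry of the row is replaced by 1, the value of \<open>mn\<close> at 1, since
  the recurrence holds for \<open>mn\<close>.\<close>

fun check_step :: "int list \<Rightarrow> int list \<Rightarrow> bool" where
  "check_step S (_ # bs) \<longleftrightarrow> check_euler S [1] bs 1"
| "check_step S [] \<longleftrightarrow> False"

definition divs :: "int list \<Rightarrow> int list" where
  "divs xs = vadd xs (lam xs)"

fun check_rows :: "int list \<Rightarrow> int list list \<Rightarrow> bool" where
  "check_rows a [] \<longleftrightarrow> True"
| "check_rows a (b # bs) \<longleftrightarrow> hd b = 0 \<and> check_step (divs (lin 1 a)) b \<and> check_rows b bs"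

fun check_sub :: "int list \<Rightarrow> int list \<Rightarrow> int list \<Rightarrow> int list \<Rightarrow> int list \<Rightarrow> bool" where
  "check_sub S rt (x # xs) (u # us) (s # ss) \<longleftrightarrow> s = u + dot S rt \<and> check_sub S (x # rt) xs us ss"
| "check_sub S rt [] [] [] \<longleftrightarrow> True"
| "check_sub S rt _ _ _ \<longleftrightarrow> False"

fun wsum :: "int \<Rightarrow> int \<Rightarrow> int list list \<Rightarrow> int list" where
  "wsum c d [] = replicate 40 0"
| "wsum c d (r # rs) = vadd (map ((*) c) r) (wsum (c + d) d rs)"

fun check_lower :: "int \<Rightarrow> int \<Rightarrow> int list \<Rightarrow> bool" where
  "check_lower x p [] \<longleftrightarrow> True"
| "check_lower x p (q # qs) \<longleftrightarrow> 0 \<le> q \<and> q * 100000000000000 \<le> p * x \<and> check_lower x q qs"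

fun check_upper :: "int \<Rightarrow> int \<Rightarrow> int list \<Rightarrow> bool" where
  "check_upper x p [] \<longleftrightarrow> True"
| "check_upper x p (q # qs) \<longleftrightarrow> p * x \<le> q * 100000000000000 \<and> check_upper x q qs"

fun check_le :: "int list \<Rightarrow> int list \<Rightarrow> bool" where
  "check_le (x # xs) (y # ys) \<longleftrightarrow> x \<le> y \<and> check_le xs ys"
| "check_le [] [] \<longleftrightarrow> True"
| "check_le _ _ \<longleftrightarrow> False"

text \<open>Powers are scaled by 10^32 and enclosures by 10^16, hence the factor 10^16. The one unit
  of slack in the upper bound pays for all indices above 80 at rho.\<close>

definition between_sums :: "int \<Rightarrow> int \<Rightarrow> int list \<Rightarrow> bool" where
  "between_sums l u a \<longleftrightarrow> l * 10000000000000000 \<le> dot a pow_lo_div \<and> dot a pow_hi_div \<le> (u - 1) * 10000000000000000"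

fun check_A :: "int list list \<Rightarrow> int list \<Rightarrow> int list \<Rightarrow> bool" where
  "check_A (r # rs) (l # ls) (u # us) \<longleftrightarrow> 0 \<le> l \<and> between_sums l u (lam (lin 1 r)) \<and> check_A rs ls us"
| "check_A rs [] [] \<longleftrightarrow> True"
| "check_A _ _ _ \<longleftrightarrow> False"

text \<open>Horner's scheme for the exponential series in fixed-point arithmetic. Here
  \<open>div\<close> rounds down; in \<open>exp_hi\<close> below, 1 is added at each level to round
  up. The innermost values 0 and 3 stand for a dropped remainder and for the bound exp <= 3 in
  Lagrange's remainder.\<close>

fun exp_lo :: "nat \<Rightarrow> int \<Rightarrow> int \<Rightarrow> int" where
  "exp_lo 0 i y = 0"
| "exp_lo (Suc n) i y = 10000000000000000 + (y * exp_lo n (i + 1) y) div (10000000000000000 * (i + 1))"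

fun exp_hi :: "nat \<Rightarrow> int \<Rightarrow> int \<Rightarrow> int" where
  "exp_hi 0 i y = 30000000000000000"
| "exp_hi (Suc n) i y = 10000000000000000 + (y * exp_hi n (i + 1) y) div (10000000000000000 * (i + 1)) + 1"

fun check_T_lo :: "nat list \<Rightarrow> int list \<Rightarrow> int list \<Rightarrow> bool" where
  "check_T_lo (n # ns) (a # as) (x # y # xs) \<longleftrightarrow>
     y * 100000000000000 \<le> 33832185689911 * (exp_lo n 0 (x + a) - 10000000000000000) \<and> check_T_lo ns as (y # xs)"
| "check_T_lo _ _ _ \<longleftrightarrow> True"

fun check_T_hi :: "nat list \<Rightarrow> int list \<Rightarrow> int list \<Rightarrow> bool" where
  "check_T_hi (n # ns) (a # as) (x # y # xs) \<longleftrightarrow>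
     33832185689930 * (exp_hi n 0 (x + a) - 10000000000000000) \<le> y * 100000000000000 \<and> check_T_hi ns as (y # xs)"
| "check_T_hi _ _ _ \<longleftrightarrow> True"

lemma dividx_eq: "dividx = map (\<lambda>m. filter (\<lambda>i. Suc i dvd Suc m) [0..<m]) [0..<80]"
  by code_simp

lemma check_row_0: "check_euler (divs (lin 1 (hd table))) [1] (tl (hd table)) 1"
  by code_simp

lemma check_rows: "check_rows (hd table) (tl table)"
  by code_simp

lemma check_s_one: "check_sub (divs s_one) [] (hd table) (wsum 1 0 (tl table)) s_one"
  by code_simp

lemma check_s_two: "check_sub (divs s_two) [] (hd table) (wsum 1 2 (tl table)) s_two"
  by code_simp

lemma check_pow_lo: "check_lower 33832185689911 100000000000000000000000000000000 pow_lo"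
  by code_simp

lemma check_pow_hi: "check_upper 33832185689930 100000000000000000000000000000000 pow_hi"
  by code_simp

lemma check_pow_lo_div: "check_le (lin 1 pow_lo_div) pow_lo"
  by code_simp

lemma check_pow_hi_div: "check_le pow_hi (lin 1 pow_hi_div)"
  by code_simp

lemma check_A: "check_A table A_lo A_hi"
  by code_simp

lemma lengths: "length table = 40 \<and> list_all (\<lambda>r. length r = 40) table \<and> length s_one = 40 \<and> length s_two = 40 \<and>
    length pow_lo = 80 \<and> length pow_hi = 80 \<and> length pow_lo_div = 80 \<and> length pow_hi_div = 80 \<and>
    length A_lo = 30 \<and> length A_hi = 30 \<and> length T_lo = 30 \<and> length T_hi = 30"
  by code_simp

lemma ranges: "list_all (\<lambda>x. 0 \<le> x) T_lo \<and> list_all (\<lambda>x. x \<le> 7000000000000000) T_hi \<and>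
    list_all (\<lambda>a. a \<le> 2000000000000000) A_hi"
  by code_simp

lemma check_sums_one: "241671579750320 * 10000000000000000 \<le> dot (lam s_one) pow_lo \<and>
    dot (lam s_one) pow_hi \<le> 241671579751117 * 10000000000000000"
  by code_simp

lemma check_sums_two: "301193934942222 * 10000000000000000 \<le> dot (lam s_two) pow_lo \<and>
    dot (lam s_two) pow_hi \<le> 301193934943367 * 10000000000000000"
  by code_simp

lemma check_sums_zero: "2160045618238600 * 10000000000000000 \<le> dot (lam (lin 1 (hd table))) pow_lo \<and>
    dot (lam (lin 1 (hd table))) pow_hi \<le> 2160045618242346 * 10000000000000000"
  by code_simp

abbreviation "ones \<equiv> [1, 1, 1, 1, 1, 1, 1, 1, 1, 1, 1, 1, 1, 1, 1, 1, 1, 1, 1, 1, 1, 1, 1, 1, 1, 1, 1, 1, 1, 1] :: int list"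
abbreviation "odds \<equiv> [1, 3, 5, 7, 9, 11, 13, 15, 17, 19, 21, 23, 25, 27, 29, 31, 33, 35, 37, 39,
  41, 43, 45, 47, 49, 51, 53, 55, 57, 59] :: int list"

lemma check_T_sums: "dot ones T_lo = 11861531889835306 \<and> dot ones T_hi = 11861531889844888 \<and>
    dot odds T_lo = 28549120145211596 \<and> dot odds T_hi = 28549120145254432"
  by code_simp

text \<open>Numbers of terms of the exponential series that suffice at the successive arguments.\<close>
abbreviation "exp_degrees \<equiv> [16, 14, 11, 9, 8, 7, 6, 6, 5, 5, 5, 4, 4, 4, 4, 4, 4, 3, 3, 3, 3, 3, 3, 3, 3, 3, 3, 3, 3] :: nat list"

lemma check_T_lo: "check_T_lo exp_degrees (tl A_lo) T_lo"
  by code_simp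

lemma check_T_hi: "check_T_hi exp_degrees (tl A_hi) T_hi"
  by code_simp

text \<open>The 600 units cover indices above 80 in a crude way, because this check precedes any
  enclosure of rho and can rely only on the bound for T(1/4).\<close>

lemma check_rho_lo: "exp_hi 22 0 (10000000000000000 + hd A_hi + 600) * 33832185689911 \<le> 10000000000000000 * 100000000000000"
  by code_simp

lemma check_rho_hi: "exp_lo 22 0 (10000000000000000 + hd A_lo) * 33832185689930 > 10000000000000000 * 100000000000000"
  by code_simp

subsection \<open>Correctness of the computed coefficients\<close>

definition corr :: "(nat \<Rightarrow> real) \<Rightarrow> int list \<Rightarrow> bool" where
  "corr a xs \<longleftrightarrow> (\<forall>i<length xs. a (Suc i) = real_of_int (xs ! i))"

lemma dot_eq_sum: "dot xs ys = (\<Sum>i<min (length xs) (length ys). xs ! i * ys ! i)"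
  by (induction xs ys rule: dot.induct) (auto simp: sum.lessThan_Suc_shift simp del: sum.lessThan_Suc)

lemma length_lin [simp]: "length (lin d xs) = length xs"
  by (induction d xs rule: lin.induct) auto

lemma lin_nth: "i < length xs \<Longrightarrow> lin d xs ! i = (d + int i) * xs ! i"
  by (induction d xs arbitrary: i rule: lin.induct) (auto simp: nth_Cons algebra_simps split: nat.splits)

lemma length_vadd [simp]: "length (vadd xs ys) = min (length xs) (length ys)"
  by (induction xs ys rule: vadd.induct) auto

lemma vadd_nth: "i < length xs \<Longrightarrow> i < length ys \<Longrightarrow> vadd xs ys ! i = xs ! i + ys ! i"
  by (induction xs ys arbitrary: i rule: vadd.induct) (auto simp: nth_Cons split: nat.splits)

lemma pick_eq: "pick xs is = sum_list (map ((!) xs) is)"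
  by (induction "is") auto

lemma length_lam [simp]: "length (lam xs) = 80"
  by (simp add: lam_def dividx_eq)

text \<open>A proper divisor of m + 1 is at most half of it, so only the first 40 entries are read.
  Agreement is required only up to index m, as the check of a row uses divisor sums of the prefix
  already verified.\<close>

lemma lam_nth:
  assumes m: "m < 80" and a: "\<And>i. i < 40 \<Longrightarrow> i \<le> m \<Longrightarrow> a (Suc i) = real_of_int (xs ! i)"
  shows "real_of_int (lam xs ! m) = (\<Sum>d | d dvd Suc m \<and> d < Suc m. a d)"
proof -
  have "lam xs ! m = sum_list (map ((!) xs) (filter (\<lambda>i. Suc i dvd Suc m) [0..<m]))"
    using m by (simp add: lam_def dividx_eq pick_eq)
  also have "\<dots> = (\<Sum>i | i < m \<and> Suc i dvd Suc m. xs ! i)"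
    by (subst sum_list_distinct_conv_sum_set) (auto intro!: sum.cong)
  finally have "real_of_int (lam xs ! m) = (\<Sum>i | i < m \<and> Suc i dvd Suc m. real_of_int (xs ! i))" by simp
  also have "\<dots> = (\<Sum>i | i < m \<and> Suc i dvd Suc m. a (Suc i))"
  proof (rule sum.cong[OF refl])
    fix i assume i: "i \<in> {i. i < m \<and> Suc i dvd Suc m}"
    then obtain q where q: "Suc m = Suc i * q" by (auto elim: dvdE)
    with i have "q \<ge> 2" by (cases q; cases "q - 1") auto
    then have "Suc i * 2 \<le> Suc m" unfolding q by (rule mult_le_mono2)
    then show "real_of_int (xs ! i) = a (Suc i)" using a[of i] i m by simp
  qed
  also have "\<dots> = (\<Sum>d | d dvd Suc m \<and> d < Suc m. a d)"
  proof (rule sum.reindex_bij_witness[where i = "\<lambda>d. d - 1" and j = Suc])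
    fix d assume "d \<in> {d. d dvd Suc m \<and> d < Suc m}"
    then have "d > 0" "d dvd Suc m" "d < Suc m" by (auto intro: Nat.gr0I)
    then show "Suc (d - 1) = d" "d - 1 \<in> {i. i < m \<and> Suc i dvd Suc m}" by auto
  qed auto
  finally show ?thesis .
qed

lemma divs_nth:
  assumes m: "m < 40" and len: "length xs = 40" and a: "\<And>i. i \<le> m \<Longrightarrow> a (Suc i) = real_of_int (xs ! i)"
  shows "real_of_int (divs xs ! m) = divsum a (Suc m)"
proof -
  have "divs xs ! m = xs ! m + lam xs ! m" unfolding divs_def using m len by (simp add: vadd_nth)
  moreover have "real_of_int (lam xs ! m) = (\<Sum>d | d dvd Suc m \<and> d < Suc m. a d)"
    by (rule lam_nth) (use m a in auto)
  ultimately show ?thesis using a[of m] by (simp add: divsum_split)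
qed

lemma length_divs [simp]: "length xs = 40 \<Longrightarrow> length (divs xs) = 40"
  by (simp add: divs_def)

lemma check_euler_nth:
  "check_euler S rm bs n \<Longrightarrow> i < length bs \<Longrightarrow> (n + int i) * bs ! i = dot S (rev (take i bs) @ rm)"
proof (induction S rm bs n arbitrary: i rule: check_euler.induct)
  case (2 S rm b bs n)
  show ?case
  proof (cases i)
    case (Suc j)
    then have "(n + 1 + int j) * bs ! j = dot S (rev (take j bs) @ b # rm)" using 2 by auto
    then show ?thesis by (simp add: Suc algebra_simps)
  qed (use 2 in simp)
qed simp

text \<open>The assumption on \<open>S\<close> may use agreement of the row up to index i: for T the
  divisor sums come from the row under verification, for later rows from the preceding one.\<close>

lemma corr_euler:
  assumes m1: "m 1 = 1" and rec: "\<And>n. n > 0 \<Longrightarrow> real n * m (Suc n) = (\<Sum>j=1..n. s j * m (Suc n - j))"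
    and chk: "check_euler S [1] bs 1" and len: "length bs = 39" "length S = 40"
    and S: "\<And>i. i < 39 \<Longrightarrow> (\<And>j. j \<le> i \<Longrightarrow> m (Suc j) = real_of_int ((1 # bs) ! j)) \<Longrightarrow> real_of_int (S ! i) = s (Suc i)"
  shows "corr m (1 # bs)"
  unfolding corr_def
proof (intro allI impI)
  fix i assume "i < length (1 # bs)"
  then show "m (Suc i) = real_of_int ((1 # bs) ! i)"
  proof (induction i rule: less_induct)
    case (less i)
    show ?case
    proof (cases i)
      case (Suc j)
      have j: "j < 39" using less.prems len Suc by simp
      have IH: "m (Suc l) = real_of_int ((1 # bs) ! l)" if "l \<le> j" for l
        using less.IH[of l] less.prems that Suc by simp
      have Sl: "real_of_int (S ! l) = s (Suc l)" if "l \<le> j" for l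
        by (rule S) (use that j IH in auto)
      have rv: "rev (take j bs) @ [1] = rev (take i (1 # bs))" by (simp add: Suc)
      have "(1 + int j) * bs ! j = dot S (rev (take i (1 # bs)))"
        using check_euler_nth[OF chk, of j] j len rv by simp
      also have "\<dots> = (\<Sum>l<i. S ! l * (1 # bs) ! (j - l))"
      proof -
        have "rev (take i (1 # bs)) ! l = (1 # bs) ! (j - l)" if "l < i" for l
          by (subst rev_nth) (use that j len Suc in \<open>auto simp del: take_Suc_Cons\<close>)
        moreover have "min (length S) (length (rev (take i (1 # bs)))) = i" using j len Suc by simp
        ultimately show ?thesis unfolding dot_eq_sum by (intro sum.cong) auto
      qed
      finally have "real_of_int ((1 + int j) * bs ! j) = (\<Sum>l<i. real_of_int (S ! l) * real_of_int ((1 # bs) ! (j - l)))"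
        by simp
      also have "\<dots> = (\<Sum>l<i. s (Suc l) * m (Suc (j - l)))"
        by (intro sum.cong) (use Sl IH Suc in auto)
      also have "\<dots> = (\<Sum>l=1..i. s l * m (Suc i - l))"
        by (rule sum.reindex_bij_witness[where i = "\<lambda>l. l - 1" and j = Suc]) (auto simp: Suc Suc_diff_le)
      also have "\<dots> = real i * m (Suc i)" using rec[of i] Suc by simp
      finally show ?thesis using Suc by simp
    qed (use m1 in simp)
  qed
qed

lemma divs_lin_nth:
  assumes "m < 40" "length xs = 40" "\<And>i. i \<le> m \<Longrightarrow> a (Suc i) = real_of_int (xs ! i)"
  shows "real_of_int (divs (lin 1 xs) ! m) = divsum (\<lambda>d. real d * a d) (Suc m)"
  by (rule divs_nth) (use assms in \<open>auto simp: lin_nth\<close>)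

lemma table_nth_length: "k < 40 \<Longrightarrow> length (table ! k) = 40"
  using lengths by (auto simp: list_all_length)

lemma hd_table: "hd table = table ! 0" and tl_table: "i < 39 \<Longrightarrow> tl table ! i = table ! Suc i"
proof -
  have "table \<noteq> []" using lengths by auto
  then show "hd table = table ! 0" by (rule hd_conv_nth)
  show "i < 39 \<Longrightarrow> tl table ! i = table ! Suc i" using lengths by (simp add: nth_tl)
qed

lemma corr_row_0: "corr (tn 0) (table ! 0)"
proof -
  define r where "r = table ! 0"
  have len: "length r = 40" unfolding r_def by (rule table_nth_length) simp
  have hd: "hd r = 1" unfolding r_def table_def by simp
  then have r: "r = 1 # tl r" using len by (cases r) auto
  have "corr (tn 0) (1 # tl r)"
  proof (rule corr_euler[where S = "divs (lin 1 r)" and s = "divsum (\<lambda>d. real d * tn 0 d)"])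
    show "check_euler (divs (lin 1 r)) [1] (tl r) 1"
      using check_row_0 by (simp add: hd_table r_def)
    show "real_of_int (divs (lin 1 r) ! i) = divsum (\<lambda>d. real d * t d) (Suc i)"
      if "i < 39" "\<And>j. j \<le> i \<Longrightarrow> t (Suc j) = real_of_int ((1 # tl r) ! j)" for i
      by (rule divs_lin_nth) (use that len r in auto)
  qed (use tn_0_rec len in auto)
  then show ?thesis using r by (simp add: r_def)
qed

lemma corr_rows: 
  "check_rows a bs \<Longrightarrow> corr (tn k) a \<Longrightarrow> length a = 40 \<Longrightarrow> \<forall>b\<in>set bs. length b = 40 \<Longrightarrow> i < length bs \<Longrightarrow> corr (tn (Suc k + i)) (bs ! i)"
proof (induction a bs arbitrary: k i rule: check_rows.induct)
  case (2 a b bs)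
  have lb: "length b = 40" using 2 by simp
  then obtain b0 bt where b: "b = b0 # bt" by (cases b) auto
  have b0: "b0 = 0" using 2 b by simp
  \<comment> \<open>The entry 0 of \<open>tn (Suc k)\<close> at size 1 becomes the entry 1 of
    \<open>mn (Suc k)\<close>; all other entries coincide.\<close>
  have "corr (mn (Suc k)) (1 # bt)"
  proof (rule corr_euler[where S = "divs (lin 1 a)" and s = "divsum (\<lambda>d. real d * tn k d)"])
    show "check_euler (divs (lin 1 a)) [1] bt 1" using 2 b by simp
    show "real_of_int (divs (lin 1 a) ! i) = divsum (\<lambda>d. real d * tn k d) (Suc i)" if "i < 39" for i
      by (rule divs_lin_nth) (use that 2 in \<open>auto simp: corr_def\<close>)
  qed (use mn_rec 2 lb b in auto)
  then have row: "corr (tn (Suc k)) b"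
    unfolding corr_def
  proof (intro allI impI)
    fix i assume m: "\<forall>i<length (1 # bt). mn (Suc k) (Suc i) = real_of_int ((1 # bt) ! i)" and i: "i < length b"
    show "tn (Suc k) (Suc i) = real_of_int (b ! i)"
    proof (cases i)
      case 0
      then show ?thesis by (simp add: b b0 tn_zero)
    next
      case (Suc j)
      then show ?thesis using m[rule_format, of i] i by (simp add: b mn_def)
    qed
  qed
  show ?case
  proof (cases i)
    case (Suc j)
    have "corr (tn (Suc (Suc k) + j)) (bs ! j)" by (rule 2(1)) (use 2 row lb Suc in auto)
    then show ?thesis by (simp add: Suc)
  qed (use row in simp)
qed simp

lemma corr_table: "k < 40 \<Longrightarrow> corr (tn k) (table ! k)"
proof (cases k)
  case (Suc i)
  assume k: "k < 40"
  have "\<forall>b\<in>set (tl table). length b = 40"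
    using lengths by (auto simp: list_all_iff dest: list.set_sel(2)[rotated])
  moreover have "i < length (tl table)" using k Suc lengths by simp
  ultimately have "corr (tn (Suc 0 + i)) (tl table ! i)"
    using corr_rows[OF check_rows, of 0 i] corr_row_0 table_nth_length[of 0] hd_table by simp
  then show ?thesis using Suc k tl_table[of i] by simp
qed (use corr_row_0 in simp)

lemma check_sub_nth:
  "check_sub S rt ts us ss \<Longrightarrow> length us = length ts \<and> length ss = length ts \<and>
    (\<forall>i<length ss. ss ! i = us ! i + dot S (rev (take i ts) @ rt))"
proof (induction S rt ts us ss rule: check_sub.induct)
  case (1 S rt t ts u us s ss)
  then show ?case by (auto simp: nth_Cons split: nat.splits)
qed auto

lemma corr_sub:
  assumes rec: "\<And>n. sg n = ta n + (\<Sum>j=1..<n. divsum sg j * tn 0 (n - j))"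
    and chk: "check_sub (divs ss) [] (table ! 0) us ss" and len: "length ss = 40"
    and us: "corr ta us"
  shows "corr sg ss"
  unfolding corr_def
proof (intro allI impI)
  fix i assume "i < length ss"
  then show "sg (Suc i) = real_of_int (ss ! i)"
  proof (induction i rule: less_induct)
    case (less i)
    define ts where "ts = table ! 0"
    have lt: "length ts = 40" "length us = 40" using check_sub_nth[OF chk] len by (auto simp: ts_def)
    have i: "i < 40" using less.prems len by simp
    have D: "real_of_int (divs ss ! j) = divsum sg (Suc j)" if "j < i" for j
      by (rule divs_nth) (use that i len less.IH in auto)
    have T: "tn 0 (Suc j) = real_of_int (ts ! j)" if "j < 40" for j
      using corr_row_0 that lt by (simp add: corr_def ts_def)
    have "ss ! i = us ! i + dot (divs ss) (rev (take i ts))"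
      using check_sub_nth[OF chk] less.prems by (simp add: ts_def)
    also have "dot (divs ss) (rev (take i ts)) = (\<Sum>j<i. divs ss ! j * ts ! (i - Suc j))"
      unfolding dot_eq_sum using i len lt by (intro sum.cong) (auto simp: rev_nth min_def)
    finally have "real_of_int (ss ! i) = real_of_int (us ! i) + (\<Sum>j<i. real_of_int (divs ss ! j) * real_of_int (ts ! (i - Suc j)))"
      by simp
    also have "(\<Sum>j<i. real_of_int (divs ss ! j) * real_of_int (ts ! (i - Suc j))) = (\<Sum>j<i. divsum sg (Suc j) * tn 0 (Suc (i - Suc j)))"
      by (intro sum.cong) (use D T i in auto)
    also have "\<dots> = (\<Sum>j=1..<Suc i. divsum sg j * tn 0 (Suc i - j))"
      by (rule sum.reindex_bij_witness[where i = "\<lambda>j. j - 1" and j = Suc]) (auto simp: Suc_diff_Suc)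
    also have "real_of_int (us ! i) = ta (Suc i)" using us i lt by (simp add: corr_def)
    finally show ?case using rec[of "Suc i"] by simp
  qed
qed

lemma wsum_nth:
  "\<forall>r\<in>set rs. length r = 40 \<Longrightarrow> length (wsum c d rs) = 40 \<and>
    (\<forall>n<40. wsum c d rs ! n = (\<Sum>i<length rs. (c + int i * d) * (rs ! i ! n)))"
proof (induction c d rs rule: wsum.induct)
  case (2 c d r rs)
  then show ?case
    by (auto simp: vadd_nth sum.lessThan_Suc_shift algebra_simps simp del: sum.lessThan_Suc)
qed auto

text \<open>The weighted sum of S_1 to S_39. The recurrence is linear, so one list per weight
  suffices in place of a table of all S_k.\<close>

definition wsn :: "(nat \<Rightarrow> real) \<Rightarrow> nat \<Rightarrow> real" where
  "wsn w n = (\<Sum>k<39. w k * sn (Suc k) n)"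

lemma wsn_rec: "wsn w n = (\<Sum>k<39. w k * tn (Suc k) n) + (\<Sum>j=1..<n. divsum (wsn w) j * tn 0 (n - j))"
proof -
  have "divsum (wsn w) j = (\<Sum>k<39. w k * divsum (sn (Suc k)) j)" for j
    unfolding divsum_def wsn_def by (subst sum.swap) (simp add: sum_distrib_left)
  then have "(\<Sum>j=1..<n. divsum (wsn w) j * tn 0 (n - j)) = (\<Sum>k<39. w k * (\<Sum>j=1..<n. divsum (sn (Suc k)) j * tn 0 (n - j)))"
    by (simp add: sum_distrib_right sum_distrib_left mult.assoc) (rule sum.swap)
  moreover have "wsn w n = (\<Sum>k<39. w k * (tn (Suc k) n + (\<Sum>j=1..<n. divsum (sn (Suc k)) j * tn 0 (n - j))))"
    unfolding wsn_def by (intro sum.cong refl arg_cong2[of _ _ _ _ "(*)"] sn_rec)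
  ultimately show ?thesis by (simp add: distrib_left sum.distrib)
qed

lemma corr_wsum: "corr (\<lambda>n. \<Sum>k<39. real_of_int (c + int k * d) * tn (Suc k) n) (wsum c d (tl table))"
proof -
  have len: "\<forall>b\<in>set (tl table). length b = 40"
    using lengths by (auto simp: list_all_iff dest: list.set_sel(2)[rotated])
  have lt: "length (tl table) = 39" using lengths by simp
  have "(\<Sum>k<39. real_of_int (c + int k * d) * tn (Suc k) (Suc n)) = real_of_int (wsum c d (tl table) ! n)" if n: "n < 40" for n
  proof -
    have "tn (Suc k) (Suc n) = real_of_int (tl table ! k ! n)" if "k < 39" for k
      using corr_table[of "Suc k"] that n table_nth_length[of "Suc k"] by (simp add: corr_def tl_table)
    then show ?thesis using wsum_nth[OF len, of c d] n lt by simp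
  qed
  then show ?thesis using wsum_nth[OF len, of c d] by (simp add: corr_def)
qed

lemma corr_s_one: "corr (wsn (\<lambda>_. 1)) s_one"
proof (rule corr_sub[OF wsn_rec])
  show "check_sub (divs s_one) [] (table ! 0) (wsum 1 0 (tl table)) s_one"
    using check_s_one by (simp only: hd_table)
  show "corr (\<lambda>n. \<Sum>k<39. 1 * tn (Suc k) n) (wsum 1 0 (tl table))"
    using corr_wsum[of 1 0] by simp
qed (use lengths in simp)

lemma corr_s_two: "corr (wsn (\<lambda>k. 2 * real k + 1)) s_two"
proof (rule corr_sub[OF wsn_rec])
  show "check_sub (divs s_two) [] (table ! 0) (wsum 1 2 (tl table)) s_two"
    using check_s_two by (simp only: hd_table)
  show "corr (\<lambda>n. \<Sum>k<39. (2 * real k + 1) * tn (Suc k) n) (wsum 1 2 (tl table))"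
    using corr_wsum[of 1 2] by (simp add: algebra_simps)
qed (use lengths in simp)

abbreviation "lo \<equiv> 33832185689911 / 100000000000000 :: real"
abbreviation "hi \<equiv> 33832185689930 / 100000000000000 :: real"
abbreviation "FF \<equiv> 10000000000000000 :: real"

lemma check_lower_nth:
  "check_lower x p qs \<Longrightarrow> 0 \<le> x \<Longrightarrow> real_of_int p \<le> P \<Longrightarrow> i < length qs \<Longrightarrow>
    0 \<le> qs ! i \<and> real_of_int (qs ! i) \<le> P * (real_of_int x / 100000000000000) ^ Suc i"
proof (induction x p qs arbitrary: P i rule: check_lower.induct)
  case (2 x p q qs)
  have "real_of_int (q * 100000000000000) \<le> real_of_int (p * x)" using 2 by (simp only: of_int_le_iff check_lower.simps)
  also have "\<dots> \<le> P * real_of_int x" using 2 by (simp add: mult_right_mono)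
  finally have q: "real_of_int q \<le> P * (real_of_int x / 100000000000000)" by simp
  show ?case
  proof (cases i)
    case (Suc j)
    have "0 \<le> qs ! j \<and> real_of_int (qs ! j) \<le> (P * (real_of_int x / 100000000000000)) * (real_of_int x / 100000000000000) ^ Suc j"
      by (rule 2(1)) (use 2 q Suc in auto)
    then show ?thesis by (simp add: Suc mult_ac)
  qed (use 2 q in auto)
qed simp

lemma check_upper_nth:
  "check_upper x p qs \<Longrightarrow> 0 \<le> x \<Longrightarrow> P \<le> real_of_int p \<Longrightarrow> i < length qs \<Longrightarrow>
    P * (real_of_int x / 100000000000000) ^ Suc i \<le> real_of_int (qs ! i)"
proof (induction x p qs arbitrary: P i rule: check_upper.induct)
  case (2 x p q qs)
  have "P * real_of_int x \<le> real_of_int (p * x)" using 2 by (simp add: mult_right_mono)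
  also have "\<dots> \<le> real_of_int (q * 100000000000000)" using 2 by (simp only: of_int_le_iff check_upper.simps)
  finally have q: "P * (real_of_int x / 100000000000000) \<le> real_of_int q" by simp
  show ?case
  proof (cases i)
    case (Suc j)
    have "(P * (real_of_int x / 100000000000000)) * (real_of_int x / 100000000000000) ^ Suc j \<le> real_of_int (qs ! j)"
      by (rule 2(1)) (use 2 q Suc in auto)
    then show ?thesis by (simp add: Suc mult_ac)
  qed (use 2 q in auto)
qed simp

lemma check_le_nth: "check_le xs ys \<Longrightarrow> length xs = length ys \<and> (\<forall>i<length xs. xs ! i \<le> ys ! i)"
  by (induction xs ys rule: check_le.induct) (auto simp: nth_Cons split: nat.splits)

abbreviation "DD \<equiv> 100000000000000000000000000000000 :: real"

lemma pow_lo_le: "m < 80 \<Longrightarrow> 0 \<le> pow_lo ! m \<and> real_of_int (pow_lo ! m) \<le> DD * lo ^ Suc m"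
  using check_lower_nth[OF check_pow_lo, of DD m] lengths by simp

lemma pow_hi_ge: "m < 80 \<Longrightarrow> DD * hi ^ Suc m \<le> real_of_int (pow_hi ! m)"
  using check_upper_nth[OF check_pow_hi, of DD m] lengths by simp

lemma pow_lo_div_le: "m < 80 \<Longrightarrow> real (Suc m) * real_of_int (pow_lo_div ! m) \<le> DD * lo ^ Suc m"
proof -
  assume m: "m < 80"
  have "(1 + int m) * pow_lo_div ! m \<le> pow_lo ! m"
    using check_le_nth[OF check_pow_lo_div] m lengths lin_nth[of m pow_lo_div 1] by auto
  then have "real_of_int ((1 + int m) * pow_lo_div ! m) \<le> real_of_int (pow_lo ! m)" by (simp only: of_int_le_iff)
  then show ?thesis using pow_lo_le[OF m] by simp
qed

lemma pow_hi_div_ge: "m < 80 \<Longrightarrow> DD * hi ^ Suc m \<le> real (Suc m) * real_of_int (pow_hi_div ! m)"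
proof -
  assume m: "m < 80"
  have "pow_hi ! m \<le> (1 + int m) * pow_hi_div ! m"
    using check_le_nth[OF check_pow_hi_div] m lengths lin_nth[of m pow_hi_div 1] by auto
  then have "real_of_int (pow_hi ! m) \<le> real_of_int ((1 + int m) * pow_hi_div ! m)" by (simp only: of_int_le_iff)
  then show ?thesis using pow_hi_ge[OF m] by simp
qed

lemma Ac_divisors: "(\<Sum>d | d dvd Suc m \<and> d < Suc m. real d * tn k d) = real (Suc m) * Ac k (Suc m)"
proof -
  have "(\<Sum>d | d dvd Suc m \<and> d < Suc m. real d * tn k d) / real (Suc m) = Ac k (Suc m)"
    unfolding Ac_def lamb_def sum_divide_distrib
    by (intro sum.cong) (auto simp: real_of_nat_div)
  then show ?thesis by (simp add: field_simps)
qed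

lemma lam_table:
  assumes "k < 40" "m < 80"
  shows "real_of_int (lam (lin 1 (table ! k)) ! m) = real (Suc m) * Ac k (Suc m)"
  unfolding Ac_divisors[symmetric]
  by (rule lam_nth) (use assms corr_table[of k] table_nth_length[of k] in \<open>auto simp: corr_def lin_nth\<close>)

lemma check_A_nth:
  "check_A rs ls us \<Longrightarrow> length us = length ls \<and> (\<forall>i<length ls. i < length rs \<longrightarrow> 0 \<le> ls ! i \<and> between_sums (ls ! i) (us ! i) (lam (lin 1 (rs ! i))))"
  by (induction rs ls us rule: check_A.induct) (auto simp: nth_Cons split: nat.splits)

lemma suminf_split_81:
  fixes a :: "nat \<Rightarrow> real"
  assumes "a 0 = 0" "summable a"
  shows "suminf a = (\<Sum>m<80. a (Suc m)) + (\<Sum>m. a (m + 81))"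
proof -
  have "suminf a = (\<Sum>m. a (m + 81)) + (\<Sum>m<81. a m)" by (rule suminf_split_initial_segment) fact
  also have "(\<Sum>m<81. a m) = a 0 + (\<Sum>m<80. a (Suc m))"
    using sum.lessThan_Suc_shift[of a 80] by simp
  finally show ?thesis using assms by simp
qed

lemma Ac_0 [simp]: "Ac k 0 = 0" by (simp add: Ac_def lamb_def)

lemma A_lower:
  assumes k: "k < 30" and x: "lo \<le> x" "x < 1" "x\<^sup>2 < rho"
  shows "real_of_int (A_lo ! k) \<le> FF * pser (Ac k) x" and "0 \<le> A_lo ! k"
proof -
  have b: "between_sums (A_lo ! k) (A_hi ! k) (lam (lin 1 (table ! k)))" "0 \<le> A_lo ! k"
    using check_A_nth[OF check_A] k lengths by auto
  show "0 \<le> A_lo ! k" by (rule b)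
  have x0: "x \<ge> 0" using x by simp
  have sm: "summable (\<lambda>n. Ac k n * x ^ n)" by (rule summable_Ac) (use x x0 in auto)
  have "real_of_int (A_lo ! k) * FF = real_of_int (A_lo ! k * 10000000000000000)" by simp
  also have "\<dots> \<le> real_of_int (dot (lam (lin 1 (table ! k))) pow_lo_div)"
    using b(1) by (simp only: of_int_le_iff between_sums_def)
  also have "\<dots> = (\<Sum>m<80. Ac k (Suc m) * (real (Suc m) * real_of_int (pow_lo_div ! m)))"
    unfolding dot_eq_sum using lengths k by (auto simp: lam_table mult_ac intro!: sum.cong)
  also have "\<dots> \<le> (\<Sum>m<80. Ac k (Suc m) * (DD * x ^ Suc m))"
  proof (intro sum_mono mult_left_mono)
    fix m assume "m \<in> {..<80::nat}"
    then have "real (Suc m) * real_of_int (pow_lo_div ! m) \<le> DD * lo ^ Suc m" by (intro pow_lo_div_le) simp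
    also have "\<dots> \<le> DD * x ^ Suc m" using x by (intro mult_left_mono power_mono) auto
    finally show "real (Suc m) * real_of_int (pow_lo_div ! m) \<le> DD * x ^ Suc m" .
  qed simp
  also have "\<dots> = DD * (\<Sum>m<80. Ac k (Suc m) * x ^ Suc m)"
    unfolding sum_distrib_left by (rule sum.cong) simp_all
  also have "\<dots> \<le> DD * pser (Ac k) x"
  proof (rule mult_left_mono)
    have "0 \<le> (\<Sum>m. Ac k (m + 81) * x ^ (m + 81))"
      by (rule suminf_nonneg) (use sm x0 in \<open>auto intro: summable_ignore_initial_segment\<close>)
    then show "(\<Sum>m<80. Ac k (Suc m) * x ^ Suc m) \<le> pser (Ac k) x"
      unfolding pser_def by (subst suminf_split_81[OF _ sm]) auto
  qed simp
  finally show "real_of_int (A_lo ! k) \<le> FF * pser (Ac k) x" by simp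
qed

text \<open>The proper divisors of m are distinct numbers up to M = m div 2, and the hypothesis
  bounds the sum of \<open>t\<close> up to M by s^(-2 M) <= s^-m. For W_k there is a further factor
  d <= m.\<close>

lemma Ac_pow_bound:
  assumes s: "0 < s" "s \<le> 1" and ps: "\<And>N. (\<Sum>n\<le>N. t n * (s\<^sup>2) ^ n) \<le> 1"
  shows "Ac 0 m \<le> (1 / s) ^ m" and "Wc k m \<le> real m * (1 / s) ^ m"
proof -
  define M where "M = m div 2"
  have "(\<Sum>d\<le>M. t d) * (s\<^sup>2) ^ M \<le> (\<Sum>d\<le>M. t d * (s\<^sup>2) ^ d)"
    unfolding sum_distrib_right
    by (intro sum_mono mult_left_mono power_decreasing) (use s in \<open>auto simp: power_le_one\<close>)
  also have "\<dots> \<le> 1" by (rule ps)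
  finally have "(\<Sum>d\<le>M. t d) \<le> 1 / (s\<^sup>2) ^ M" using s by (simp add: pos_le_divide_eq)
  also have "\<dots> = (1 / s) ^ (2 * M)" by (simp add: power_divide power_mult)
  also have "\<dots> \<le> (1 / s) ^ m" using s by (intro power_increasing) (auto simp: M_def)
  finally have sum: "(\<Sum>d\<le>M. t d) \<le> (1 / s) ^ m" .
  have sub: "{d. d dvd m \<and> d < m} \<subseteq> {..M}"
  proof
    fix d assume d: "d \<in> {d. d dvd m \<and> d < m}"
    then obtain q where q: "m = d * q" by (auto elim: dvdE)
    with d have "q \<ge> 2" by (cases q; cases "q - 1") auto
    then have "d * 2 \<le> m" unfolding q by (rule mult_le_mono2)
    then show "d \<in> {..M}" by (simp add: M_def)
  qed
  have "Ac 0 m \<le> (\<Sum>d | d dvd m \<and> d < m. t d)"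
    unfolding Ac_def lamb_def by (intro sum_mono mult_left_le one_div_nat_le) auto
  also have "\<dots> \<le> (\<Sum>d\<le>M. t d)" by (rule sum_mono2[OF _ sub]) auto
  finally show "Ac 0 m \<le> (1 / s) ^ m" using sum by simp
  have "Wc k m \<le> (\<Sum>d | d dvd m \<and> d < m. real m * t d)"
    unfolding Wc_def lamb_def
  proof (rule sum_mono)
    fix d assume "d \<in> {d. d dvd m \<and> d < m}"
    then have "real d * t d \<le> real m * t d" by (intro mult_right_mono) auto
    then show "sn k d * 1 \<le> real m * t d" using sn_le[of k d] by simp
  qed
  also have "\<dots> \<le> (\<Sum>d\<le>M. real m * t d)" by (rule sum_mono2[OF _ sub]) auto
  also have "\<dots> = real m * (\<Sum>d\<le>M. t d)" by (simp add: sum_distrib_left)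
  also have "\<dots> \<le> real m * (1 / s) ^ m" using sum by (intro mult_left_mono) auto
  finally show "Wc k m \<le> real m * (1 / s) ^ m" .
qed

lemma geometric_tail:
  fixes a :: "nat \<Rightarrow> real"
  assumes "\<And>m. m \<ge> M \<Longrightarrow> 0 \<le> a m \<and> a m \<le> C * r ^ m" "0 \<le> r" "r < 1"
  shows "summable a" "(\<Sum>m. a (m + M)) \<le> C * r ^ M / (1 - r)"
proof -
  have g: "(\<lambda>m. C * r ^ M * r ^ m) sums (C * r ^ M * (1 / (1 - r)))"
    using assms by (intro sums_mult geometric_sums) auto
  have le: "a (m + M) \<le> C * r ^ M * r ^ m" for m using assms(1)[of "m + M"] by (simp add: power_add mult_ac)
  have "summable (\<lambda>m. a (m + M))"
    by (rule summable_comparison_test'[OF sums_summable[OF g]]) (use le assms(1) in auto)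
  then show s: "summable a" by (simp only: summable_iff_shift)
  have "(\<Sum>m. a (m + M)) \<le> (\<Sum>m. C * r ^ M * r ^ m)"
    by (rule suminf_le[OF le]) (use s g in \<open>auto simp: summable_iff_shift sums_iff\<close>)
  then show "(\<Sum>m. a (m + M)) \<le> C * r ^ M / (1 - r)" using g by (simp add: sums_iff)
qed

text \<open>The parameter s is 1/2 before rho is enclosed and sqrt rho afterwards, which improves
  the ratio r of the geometric tail from 677/1000 to 582/1000.\<close>

lemma A_upper:
  assumes k: "k < 30" and x: "0 < x" "x \<le> hi" "x\<^sup>2 < rho"
    and s: "0 < s" "s \<le> 1" "\<And>N. (\<Sum>n\<le>N. t n * (s\<^sup>2) ^ n) \<le> 1" and r: "x \<le> s * r" "r < 1"
  shows "FF * pser (Ac k) x \<le> real_of_int (A_hi ! k) - 1 + FF * (r ^ 81 / (1 - r))"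
proof -
  have b: "between_sums (A_lo ! k) (A_hi ! k) (lam (lin 1 (table ! k)))"
    using check_A_nth[OF check_A] k lengths by auto
  have sm: "summable (\<lambda>n. Ac k n * x ^ n)" by (rule summable_Ac) (use x in auto)
  have r0: "0 \<le> r" using r(1) s(1) x(1) by (smt (verit) mult_pos_neg)
  have tail: "(\<Sum>m. Ac k (m + 81) * x ^ (m + 81)) \<le> 1 * r ^ 81 / (1 - r)"
  proof (rule geometric_tail(2))
    fix m :: nat
    have "Ac k m * x ^ m \<le> (1 / s) ^ m * (s * r) ^ m"
      by (intro mult_mono power_mono order_trans[OF Ac_le Ac_pow_bound(1)] s r) (use x s in auto)
    also have "\<dots> = r ^ m" using s by (simp flip: power_mult_distrib)
    finally show "0 \<le> Ac k m * x ^ m \<and> Ac k m * x ^ m \<le> 1 * r ^ m" using x by simp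
  qed (use r r0 in auto)
  have "DD * (\<Sum>m<80. Ac k (Suc m) * x ^ Suc m) = (\<Sum>m<80. Ac k (Suc m) * (DD * x ^ Suc m))"
    unfolding sum_distrib_left by (rule sum.cong) simp_all
  also have "\<dots> \<le> (\<Sum>m<80. Ac k (Suc m) * (real (Suc m) * real_of_int (pow_hi_div ! m)))"
  proof (intro sum_mono mult_left_mono)
    fix m assume "m \<in> {..<80::nat}"
    have "DD * x ^ Suc m \<le> DD * hi ^ Suc m" using x by (intro mult_left_mono power_mono) auto
    also have "\<dots> \<le> real (Suc m) * real_of_int (pow_hi_div ! m)"
      by (rule pow_hi_div_ge) (use \<open>m \<in> {..<80}\<close> in simp)
    finally show "DD * x ^ Suc m \<le> real (Suc m) * real_of_int (pow_hi_div ! m)" .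
  qed simp
  also have "\<dots> = real_of_int (dot (lam (lin 1 (table ! k))) pow_hi_div)"
    unfolding dot_eq_sum using lengths k by (auto simp: lam_table mult_ac intro!: sum.cong)
  also have "\<dots> \<le> real_of_int ((A_hi ! k - 1) * 10000000000000000)"
    using b(1) by (simp only: of_int_le_iff between_sums_def)
  finally have "FF * (\<Sum>m<80. Ac k (Suc m) * x ^ Suc m) \<le> real_of_int (A_hi ! k) - 1" by simp
  moreover have "pser (Ac k) x = (\<Sum>m<80. Ac k (Suc m) * x ^ Suc m) + (\<Sum>m. Ac k (m + 81) * x ^ (m + 81))"
    unfolding pser_def by (rule suminf_split_81[OF _ sm]) simp
  ultimately show ?thesis using tail by (simp add: distrib_left)
qed

subsection \<open>Enclosing the exponential function\<close>

fun horner :: "nat \<Rightarrow> nat \<Rightarrow> real \<Rightarrow> real \<Rightarrow> real" where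
  "horner 0 i B x = B"
| "horner (Suc n) i B x = 1 + x / (real i + 1) * horner n (Suc i) B x"

lemma horner_eq: "horner n i B x = (\<Sum>j<n. x ^ j * fact i / fact (i + j)) + B * x ^ n * fact i / fact (i + n)"
proof (induction n arbitrary: i)
  case (Suc n)
  have f: "x / (real i + 1) * (y * fact (Suc i) / z) = x * y * fact i / z" for y z :: real
  proof -
    have "fact (Suc i) = (real i + 1) * fact i" by simp
    moreover have "real i + 1 \<noteq> 0" by linarith
    ultimately show ?thesis by (simp del: fact_Suc)
  qed
  have "horner (Suc n) i B x = 1 + (\<Sum>j<n. x / (real i + 1) * (x ^ j * fact (Suc i) / fact (Suc i + j)))
      + x / (real i + 1) * (B * x ^ n * fact (Suc i) / fact (Suc i + n))"
    by (simp only: horner.simps Suc distrib_left sum_distrib_left add.assoc)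
  also have "\<dots> = 1 + (\<Sum>j<n. x * x ^ j * fact i / fact (Suc i + j)) + x * (B * x ^ n) * fact i / fact (Suc i + n)"
    by (simp only: f)
  also have "\<dots> = (\<Sum>j<Suc n. x ^ j * fact i / fact (i + j)) + B * x ^ Suc n * fact i / fact (i + Suc n)"
    by (simp add: sum.lessThan_Suc_shift mult_ac del: sum.lessThan_Suc fact_Suc)
  finally show ?case .
qed simp

lemma exp_ge_horner: "0 \<le> x \<Longrightarrow> horner n 0 0 x \<le> exp x"
proof -
  assume x: "0 \<le> x"
  obtain u where "exp x = (\<Sum>m<n. x ^ m / fact m) + exp u / fact n * x ^ n" using Maclaurin_exp_le by blast
  then show ?thesis using x by (simp add: horner_eq)
qed

lemma exp_le_horner: "0 \<le> x \<Longrightarrow> exp x \<le> 3 \<Longrightarrow> exp x \<le> horner n 0 3 x"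
proof -
  assume x: "0 \<le> x" "exp x \<le> 3"
  obtain u where u: "\<bar>u\<bar> \<le> \<bar>x\<bar>" "exp x = (\<Sum>m<n. x ^ m / fact m) + exp u / fact n * x ^ n" using Maclaurin_exp_le by blast
  have "u \<le> x" using u x by simp
  then have "exp u \<le> exp x" by (simp only: exp_le_cancel_iff)
  then have "exp u \<le> 3" using x by linarith
  then have "exp u / fact n * x ^ n \<le> 3 / fact n * x ^ n" using x by (intro mult_right_mono divide_right_mono) auto
  then show ?thesis using u by (simp add: horner_eq)
qed

lemma div_bounds:
  fixes a b :: int
  assumes "b > 0"
  shows "real_of_int (a div b) \<le> real_of_int a / real_of_int b" "real_of_int a / real_of_int b \<le> real_of_int (a div b) + 1"
proof -
  have "a div b = \<lfloor>real_of_int a / real_of_int b\<rfloor>" by (simp add: floor_divide_of_int_eq)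
  then show "real_of_int (a div b) \<le> real_of_int a / real_of_int b" "real_of_int a / real_of_int b \<le> real_of_int (a div b) + 1"
    by linarith+
qed

lemma exp_lo_le: "0 \<le> y \<Longrightarrow> 0 \<le> exp_lo n (int i) y \<and> real_of_int (exp_lo n (int i) y) \<le> FF * horner n i 0 (real_of_int y / FF)"
proof (induction n arbitrary: i)
  case (Suc n)
  define e where "e = exp_lo n (int (Suc i)) y"
  define b where "b = 10000000000000000 * (int i + 1)"
  have b: "b > 0" "real_of_int b = FF * (real i + 1)" by (auto simp: b_def)
  have IH: "0 \<le> e" "real_of_int e \<le> FF * horner n (Suc i) 0 (real_of_int y / FF)"
    using Suc.IH[of "Suc i"] Suc.prems unfolding e_def by blast+
  have eq: "exp_lo (Suc n) (int i) y = 10000000000000000 + (y * e) div b"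
    by (simp add: e_def b_def add.commute)
  have "real_of_int ((y * e) div b) \<le> real_of_int (y * e) / real_of_int b" by (rule div_bounds) (rule b)
  also have "\<dots> = real_of_int y / (FF * (real i + 1)) * real_of_int e" unfolding b(2) by simp
  also have "\<dots> \<le> real_of_int y / (FF * (real i + 1)) * (FF * horner n (Suc i) 0 (real_of_int y / FF))"
    using IH Suc.prems by (intro mult_left_mono) auto
  also have "\<dots> = FF * (real_of_int y / FF / (real i + 1) * horner n (Suc i) 0 (real_of_int y / FF))" by simp
  finally show ?case using IH Suc.prems b unfolding eq by (simp add: pos_imp_zdiv_nonneg_iff distrib_left)
qed simp

lemma exp_hi_ge: "0 \<le> y \<Longrightarrow> FF * horner n i 3 (real_of_int y / FF) \<le> real_of_int (exp_hi n (int i) y)"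
proof (induction n arbitrary: i)
  case (Suc n)
  define e where "e = exp_hi n (int (Suc i)) y"
  define b where "b = 10000000000000000 * (int i + 1)"
  have b: "b > 0" "real_of_int b = FF * (real i + 1)" by (auto simp: b_def)
  have IH: "FF * horner n (Suc i) 3 (real_of_int y / FF) \<le> real_of_int e"
    using Suc.IH[of "Suc i"] Suc.prems unfolding e_def by blast
  have eq: "exp_hi (Suc n) (int i) y = 10000000000000000 + (y * e) div b + 1"
    by (simp add: e_def b_def add.commute)
  have "FF * (real_of_int y / FF / (real i + 1) * horner n (Suc i) 3 (real_of_int y / FF)) =
      real_of_int y / (FF * (real i + 1)) * (FF * horner n (Suc i) 3 (real_of_int y / FF))" by simp
  also have "\<dots> \<le> real_of_int y / (FF * (real i + 1)) * real_of_int e"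
    using IH Suc.prems by (intro mult_left_mono) auto
  also have "\<dots> = real_of_int (y * e) / real_of_int b" unfolding b(2) by simp
  also have "\<dots> \<le> real_of_int ((y * e) div b) + 1" by (rule div_bounds) (rule b)
  finally show ?case unfolding eq by (simp add: distrib_left)
qed simp

text \<open>The largest argument that occurs is 1 + A_0(rho), about 1.084.\<close>

lemma exp_109: "x \<le> 109/100 \<Longrightarrow> exp x \<le> (3 :: real)"
proof -
  assume "x \<le> 109/100"
  then have "exp x \<le> exp (1 + 9/100)" by simp
  also have "\<dots> = exp 1 * exp (9/100 :: real)" by (rule exp_add)
  also have "\<dots> \<le> 272/100 * (1 + 9/100 + (9/100)\<^sup>2)"
    by (intro mult_mono exp_bound) (use e_less_272 in auto)
  also have "\<dots> \<le> 3" by (simp add: power2_eq_square)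
  finally show ?thesis .
qed

lemma exp_int_lower: "0 \<le> y \<Longrightarrow> real_of_int (exp_lo n 0 y) \<le> FF * exp (real_of_int y / FF)"
  using exp_lo_le[of y n 0] exp_ge_horner[of "real_of_int y / FF" n] by simp

lemma exp_int_upper: "0 \<le> y \<Longrightarrow> y \<le> 10900000000000000 \<Longrightarrow> FF * exp (real_of_int y / FF) \<le> real_of_int (exp_hi n 0 y)"
proof -
  assume y: "0 \<le> y" "y \<le> 10900000000000000"
  then have "real_of_int y \<le> real_of_int 10900000000000000" by (simp only: of_int_le_iff)
  then have "real_of_int y / FF \<le> 109/100" by simp
  then have "exp (real_of_int y / FF) \<le> horner n 0 3 (real_of_int y / FF)"
    using y by (intro exp_le_horner exp_109) auto
  then show ?thesis using exp_hi_ge[of y n 0] y by simp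
qed

subsection \<open>Enclosing the radius of convergence\<close>

lemma quarter_sums: "(\<Sum>n\<le>N. t n * ((1/2)\<^sup>2) ^ n) \<le> (1 :: real)"
  using t_partial_sums_quarter[of N] by (simp add: power2_eq_square)

lemma hd_A: "hd A_lo = A_lo ! 0" "hd A_hi = A_hi ! 0"
proof -
  have "A_lo \<noteq> []" "A_hi \<noteq> []" using lengths by auto
  then show "hd A_lo = A_lo ! 0" "hd A_hi = A_hi ! 0" by (auto intro: hd_conv_nth)
qed

lemma A_hi_range: "i < 30 \<Longrightarrow> A_hi ! i \<le> 2000000000000000"
  using ranges lengths by (auto simp: list_all_length)

text \<open>The numerical check gives e Phi(lo) <= 1, which places lo at or below rho. The ratio
  677/1000 is admissible for s = 1/2 because lo <= 677/2000.\<close>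

lemma lo_le_rho: "lo \<le> rho"
proof (rule rho_geI')
  have lo2: "lo\<^sup>2 < 1/4" by (simp add: power2_eq_square)
  then show lo_rho: "lo\<^sup>2 < rho" using rho_ge_quarter by linarith
  define y where "y = 10000000000000000 + A_hi ! 0 + 600"
  have "FF * pser (Ac 0) lo \<le> real_of_int (A_hi ! 0) - 1 + FF * ((677/1000) ^ 81 / (1 - 677/1000))"
    by (rule A_upper[where s = "1/2"]) (use quarter_sums lo_rho in auto)
  also have "FF * ((677/1000) ^ 81 / (1 - 677/1000)) \<le> 601"
  proof -
    have "(677/1000 :: real) ^ 9 \<le> 299/10000" by (simp add: power_divide)
    then have "((677/1000 :: real) ^ 9) ^ 9 \<le> (299/10000) ^ 9" by (intro power_mono) auto
    then show ?thesis by (simp flip: power_mult add: power_divide)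
  qed
  finally have A: "1 + pser (Ac 0) lo \<le> real_of_int y / FF" by (simp add: y_def field_simps)
  have "0 \<le> pser (Ac 0) lo" by (rule pser_Ac_nonneg) (use lo_rho in auto)
  then have "0 \<le> real_of_int y / FF" using A by linarith
  then have y0: "0 \<le> y" by (simp add: zero_le_divide_iff)
  have "FF * (exp 1 * (lo * exp (pser (Ac 0) lo))) = lo * (FF * exp (1 + pser (Ac 0) lo))" by (simp add: exp_add)
  also have "\<dots> \<le> lo * (FF * exp (real_of_int y / FF))" using A by (intro mult_left_mono) auto
  also have "\<dots> \<le> lo * real_of_int (exp_hi 22 0 y)"
  proof (intro mult_left_mono exp_int_upper y0)
    show "y \<le> 10900000000000000" by (simp add: y_def A_hi_def)
  qed simp
  also have "\<dots> = real_of_int (exp_hi 22 0 y * 33832185689911) / 100000000000000" by simp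
  also have "\<dots> \<le> real_of_int (10000000000000000 * 100000000000000) / 100000000000000"
    by (intro divide_right_mono of_int_le_iff[THEN iffD2])
       (use check_rho_lo in \<open>simp_all add: hd_A y_def\<close>)
  finally show "exp 1 * (lo * exp (pser (Ac 0) lo)) \<le> 1" by simp
qed auto

text \<open>If hi were inside the disc, then e Phi(hi) <= 1 would hold, against the numerical
  check.\<close>

lemma rho_le_hi: "rho \<le> hi"
proof (rule ccontr)
  assume "\<not> ?thesis"
  then have hi: "hi < rho" by simp
  have hi2: "hi\<^sup>2 < rho" using hi by (intro sq_less_rho) auto
  define y where "y = 10000000000000000 + A_lo ! 0"
  have A: "real_of_int (A_lo ! 0) \<le> FF * pser (Ac 0) hi" "0 \<le> A_lo ! 0" using A_lower[of 0 hi] hi2 by auto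
  have "real_of_int y / FF \<le> 1 + pser (Ac 0) hi" using A by (simp add: y_def field_simps)
  have "real_of_int (10000000000000000 * 100000000000000) / 100000000000000 < real_of_int (exp_lo 22 0 y * 33832185689930) / 100000000000000"
    by (intro divide_strict_right_mono of_int_less_iff[THEN iffD2])
       (use check_rho_hi in \<open>simp_all add: hd_A y_def\<close>)
  also have "\<dots> = hi * real_of_int (exp_lo 22 0 y)" by simp
  also have "\<dots> \<le> hi * (FF * exp (real_of_int y / FF))"
    by (intro mult_left_mono exp_int_lower) (use A in \<open>auto simp: y_def\<close>)
  also have "\<dots> \<le> hi * (FF * exp (1 + pser (Ac 0) hi))"
    using \<open>real_of_int y / FF \<le> 1 + pser (Ac 0) hi\<close> by (intro mult_left_mono) auto
  also have "\<dots> = FF * (exp 1 * (hi * exp (pser (Ac 0) hi)))" by (simp add: exp_add)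
  also have "\<dots> \<le> FF * 1" by (intro mult_left_mono Phi_le_interior hi) auto
  finally show False by simp
qed

subsection \<open>Enclosing the values at the singularity\<close>

abbreviation "Tr k \<equiv> pser (tn k) rho"

lemma check_T_lo_nth:
  "check_T_lo ns as xs \<Longrightarrow> Suc i < length xs \<Longrightarrow> i < length ns \<Longrightarrow> i < length as \<Longrightarrow>
    xs ! Suc i * 100000000000000 \<le> 33832185689911 * (exp_lo (ns ! i) 0 (xs ! i + as ! i) - 10000000000000000)"
proof (induction ns as xs arbitrary: i rule: check_T_lo.induct)
  case (1 n ns a as x y xs)
  then show ?case by (cases i) auto
qed auto

lemma check_T_hi_nth:
  "check_T_hi ns as xs \<Longrightarrow> Suc i < length xs \<Longrightarrow> i < length ns \<Longrightarrow> i < length as \<Longrightarrow>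
    33832185689930 * (exp_hi (ns ! i) 0 (xs ! i + as ! i) - 10000000000000000) \<le> xs ! Suc i * 100000000000000"
proof (induction ns as xs arbitrary: i rule: check_T_hi.induct)
  case (1 n ns a as x y xs)
  then show ?case by (cases i) auto
qed auto

lemma sqrt_rho: "0 < sqrt rho" "sqrt rho \<le> 1" "(sqrt rho)\<^sup>2 = rho" "sqrt rho \<le> 582/1000"
proof -
  show "sqrt rho \<le> 582/1000"
    by (rule real_le_lsqrt) (use rho_pos rho_le_hi in \<open>auto simp: power2_eq_square\<close>)
qed (use rho_pos rho_lt_1 in auto)

lemma rho_partial_sums: "(\<Sum>n\<le>N. t n * ((sqrt rho)\<^sup>2) ^ n) \<le> 1"
proof -
  have "(\<Sum>n\<le>N. t n * rho ^ n) \<le> (\<Sum>n. t n * rho ^ n)"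
    by (rule sum_le_suminf[OF summable_t_rho]) (use rho_pos in auto)
  then show ?thesis using T_rho sqrt_rho(3) by (simp add: pser_def)
qed

lemma A_rho_upper: "k < 30 \<Longrightarrow> FF * pser (Ac k) rho \<le> real_of_int (A_hi ! k)"
proof -
  assume k: "k < 30"
  have "FF * pser (Ac k) rho \<le> real_of_int (A_hi ! k) - 1 + FF * ((582/1000) ^ 81 / (1 - 582/1000))"
  proof (rule A_upper[where s = "sqrt rho"])
    have "sqrt rho * sqrt rho \<le> sqrt rho * (582/1000)" using sqrt_rho by (intro mult_left_mono) auto
    then show "rho \<le> sqrt rho * (582/1000)" using rho_pos by simp
  qed (use k rho_pos rho_le_hi rho_sq_less sqrt_rho rho_partial_sums in auto)
  also have "FF * ((582/1000) ^ 81 / (1 - 582/1000)) \<le> 1" unfolding power_divide by simp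
  finally show ?thesis by simp
qed

lemma tl_A: "i < 29 \<Longrightarrow> tl A_lo ! i = A_lo ! Suc i" "i < 29 \<Longrightarrow> tl A_hi ! i = A_hi ! Suc i"
  using lengths by (simp_all add: nth_tl)

lemma T_1_rho: "Tr 1 = 1 - rho"
proof -
  have "Tr 1 = rho * (exp (1 + pser (Ac 0) rho) - 1)" using tn_rho_Suc[of 0] unfolding T_rho One_nat_def .
  also have "\<dots> = exp 1 * (rho * exp (pser (Ac 0) rho)) - rho" by (simp add: exp_add algebra_simps)
  finally show ?thesis by (simp only: Phi_rho)
qed

lemma T_enclosure: "i < 30 \<Longrightarrow> real_of_int (T_lo ! i) \<le> FF * Tr (Suc i) \<and> FF * Tr (Suc i) \<le> real_of_int (T_hi ! i)"
proof (induction i)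
  case 0
  have "T_lo ! 0 = 6616781431006999" "T_hi ! 0 = 6616781431008900" by (simp_all add: T_lo_def T_hi_def)
  moreover have "Tr (Suc 0) = 1 - rho" using T_1_rho by simp
  ultimately show ?case using rho_le_hi lo_le_rho by (simp only: of_int_numeral) auto
next
  case (Suc i)
  have i: "Suc i < 30" "i < 29" using Suc.prems by auto
  have IH: "real_of_int (T_lo ! i) \<le> FF * Tr (Suc i)" "FF * Tr (Suc i) \<le> real_of_int (T_hi ! i)" using Suc by auto
  define x where "x = Tr (Suc i) + pser (Ac (Suc i)) rho"
  have eq: "Tr (Suc (Suc i)) = rho * (exp x - 1)" unfolding x_def by (rule tn_rho_Suc)
  have x0: "x \<ge> 0" unfolding x_def
    by (intro add_nonneg_nonneg pser_tn_nonneg pser_Ac_nonneg) (use rho_pos rho_lt_1 rho_sq_less in auto)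
  define yl where "yl = T_lo ! i + A_lo ! Suc i"
  define yu where "yu = T_hi ! i + A_hi ! Suc i"
  have Al: "real_of_int (A_lo ! Suc i) \<le> FF * pser (Ac (Suc i)) rho" "0 \<le> A_lo ! Suc i"
    using A_lower[OF i(1), of rho] lo_le_rho rho_lt_1 rho_sq_less by auto
  have yl: "real_of_int yl / FF \<le> x" using IH Al by (simp add: yl_def x_def)
  have yu: "x \<le> real_of_int yu / FF" using IH A_rho_upper[OF i(1)] by (simp add: yu_def x_def)
  have yl0: "0 \<le> yl" using ranges lengths i Al by (auto simp: yl_def list_all_length)
  have yu0: "0 \<le> yu"
  proof -
    have "0 \<le> real_of_int yu / FF" using x0 yu by linarith
    then show ?thesis by (simp add: zero_le_divide_iff)
  qed
  have "T_hi ! i \<le> 7000000000000000" using ranges lengths i by (auto simp: list_all_length)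
  then have yu1: "yu \<le> 10900000000000000" using A_hi_range[OF i(1)] by (simp add: yu_def)
  have "real_of_int (T_lo ! Suc i * 100000000000000) \<le> real_of_int (33832185689911 * (exp_lo (exp_degrees ! i) 0 yl - 10000000000000000))"
    using check_T_lo_nth[OF check_T_lo, of i] lengths i by (simp only: of_int_le_iff) (simp add: tl_A yl_def)
  also have "\<dots> = 33832185689911 * (real_of_int (exp_lo (exp_degrees ! i) 0 yl) - FF)" by simp
  also have "\<dots> \<le> 33832185689911 * (FF * exp (real_of_int yl / FF) - FF)"
    using exp_int_lower[OF yl0, of "exp_degrees ! i"] by (intro mult_left_mono diff_right_mono) auto
  also have "\<dots> \<le> 33832185689911 * (FF * exp x - FF)"
    using yl by (intro mult_left_mono diff_right_mono) auto
  also have "\<dots> = 100000000000000 * FF * (lo * (exp x - 1))" by (simp add: algebra_simps)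
  also have "\<dots> \<le> 100000000000000 * FF * (rho * (exp x - 1))"
    using lo_le_rho x0 by (intro mult_left_mono mult_right_mono) auto
  finally have lower: "real_of_int (T_lo ! Suc i) \<le> FF * Tr (Suc (Suc i))" by (simp add: eq)
  have "100000000000000 * FF * (rho * (exp x - 1)) \<le> 100000000000000 * FF * (hi * (exp x - 1))"
    using rho_le_hi x0 by (intro mult_left_mono mult_right_mono) auto
  also have "\<dots> = 33832185689930 * (FF * exp x - FF)" by (simp add: field_simps)
  also have "\<dots> \<le> 33832185689930 * (FF * exp (real_of_int yu / FF) - FF)"
    using yu by (intro mult_left_mono diff_right_mono) auto
  also have "\<dots> \<le> 33832185689930 * (real_of_int (exp_hi (exp_degrees ! i) 0 yu) - FF)"
    using exp_int_upper[OF yu0 yu1, of "exp_degrees ! i"] by (intro mult_left_mono diff_right_mono) auto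
  also have "\<dots> = real_of_int (33832185689930 * (exp_hi (exp_degrees ! i) 0 yu - 10000000000000000))" by simp
  also have "\<dots> \<le> real_of_int (T_hi ! Suc i * 100000000000000)"
    using check_T_hi_nth[OF check_T_hi, of i] lengths i by (simp only: of_int_le_iff) (simp add: tl_A yu_def)
  finally have upper: "FF * Tr (Suc (Suc i)) \<le> real_of_int (T_hi ! Suc i)" by (simp add: eq)
  show ?case using lower upper by simp
qed

text \<open>A tree counted by T_k has d >= 4 vertices. With y = rho^d <= 0.014 the terms with i >= 2
  add up to at most y^2 / (1 - y) <= y / 50.\<close>

lemma A_le_T: "k \<ge> 3 \<Longrightarrow> pser (Ac k) rho \<le> Tr k / 50"
proof -
  assume k: "k \<ge> 3"
  define h where "h = (\<lambda>d. \<Sum>\<^sub>\<infinity>i\<in>{2..}. 1 / real i * (rho ^ d) ^ i)"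
  have "summable (\<lambda>n. tn k n * (rho\<^sup>2) ^ n)"
  proof (rule summable_comparison_test')
    show "summable (\<lambda>n. t n * (rho\<^sup>2) ^ n)" by (rule summable_t) (use rho_sq_less in auto)
  qed (auto intro!: mult_right_mono tn_antimono)
  then have sums: "(\<lambda>d. tn k d * h d) sums pser (Ac k) rho"
    unfolding h_def pser_def Ac_def
    by (intro lambert(2)) (use rho_pos rho_lt_1 one_div_nat_le in auto)
  have le: "tn k d * h d \<le> tn k d * rho ^ d * (1/50)" for d
  proof (cases "d \<le> k")
    case False
    define y where "y = rho ^ d"
    have "y \<le> rho ^ 4" unfolding y_def using False k rho_pos rho_lt_1 by (intro power_decreasing) auto
    also have "\<dots> \<le> (2/5) ^ 4" using rho_pos rho_le_hi by (intro power_mono) auto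
    also have "\<dots> \<le> (3/100 :: real)" by (simp add: power_divide)
    finally have y: "0 \<le> y" "y \<le> rho ^ 4" "y \<le> 3/100" using rho_pos \<open>y \<le> rho ^ 4\<close> by (auto simp: y_def)
    have "rho ^ 4 \<le> (34/100) ^ 4" using rho_pos rho_le_hi by (intro power_mono) auto
    also have "\<dots> \<le> (14/1000 :: real)" by (simp add: power_divide)
    finally have y': "y \<le> 14/1000" using y by linarith
    have "h d \<le> y\<^sup>2 / (1 - y)"
      unfolding h_def y_def[symmetric] by (rule weighted_geometric) (use y one_div_nat_le in auto)
    also have "\<dots> = y * (y / (1 - y))" by (simp add: power2_eq_square)
    also have "\<dots> \<le> y * (1/50)" using y y' by (intro mult_left_mono) (auto simp: field_simps)
    finally have "tn k d * h d \<le> tn k d * (y * (1/50))" by (intro mult_left_mono) auto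
    then show ?thesis by (simp add: y_def)
  qed (simp add: tn_zero)
  have "pser (Ac k) rho = (\<Sum>d. tn k d * h d)" using sums by (simp add: sums_iff)
  also have "\<dots> \<le> (\<Sum>d. tn k d * rho ^ d * (1/50))"
    by (rule suminf_le[OF le sums_summable[OF sums] summable_mult2[OF summable_tn_rho]])
  also have "\<dots> = Tr k * (1/50)" unfolding pser_def by (rule suminf_mult2[OF summable_tn_rho, symmetric])
  finally show ?thesis by simp
qed

text \<open>For small x the map is nearly x -> rho x: the factors 35/100 for rho, 102/100 for exp x
  - 1 and 51/50 for A_k multiply to less than 2/5.\<close>

lemma T_contract: "k \<ge> 3 \<Longrightarrow> Tr k \<le> 1/100 \<Longrightarrow> Tr (Suc k) \<le> 2/5 * Tr k"
proof -
  assume k: "k \<ge> 3" "Tr k \<le> 1/100"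
  define x where "x = Tr k + pser (Ac k) rho"
  have T0: "Tr k \<ge> 0" by (rule pser_tn_nonneg)
  have x: "0 \<le> x" "x \<le> 51/50 * Tr k"
  proof -
    show "0 \<le> x" unfolding x_def
      by (intro add_nonneg_nonneg pser_tn_nonneg pser_Ac_nonneg) (use rho_pos rho_lt_1 rho_sq_less in auto)
    show "x \<le> 51/50 * Tr k" using A_le_T[OF k(1)] by (simp add: x_def)
  qed
  have x1: "x \<le> 2/100" using x k by linarith
  have "exp x \<le> 1 + x + x\<^sup>2" using x x1 by (intro exp_bound) auto
  also have "x\<^sup>2 \<le> 2/100 * x" unfolding power2_eq_square using x x1 by (intro mult_right_mono) auto
  finally have "exp x - 1 \<le> 102/100 * x" by simp
  then have "exp x - 1 \<le> 102/100 * (51/50 * Tr k)" using x by linarith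
  then have "rho * (exp x - 1) \<le> 35/100 * (102/100 * (51/50 * Tr k))"
    using rho_pos rho_le_hi x T0 by (intro mult_mono) auto
  also have "\<dots> \<le> 2/5 * Tr k" using T0 by simp
  finally show ?thesis using tn_rho_Suc[of k] by (simp add: x_def)
qed

lemma T_30: "FF * Tr 30 \<le> 290" and T_30_small: "Tr 30 \<le> 1/100"
proof -
  have "T_hi ! 29 = 284" by (simp add: T_hi_def)
  then show "FF * Tr 30 \<le> 290" using T_enclosure[of 29] by (simp add: numeral_eq_Suc)
  then show "Tr 30 \<le> 1/100" by simp
qed

lemma T_tail: "Tr (30 + j) \<le> (2/5) ^ j * Tr 30"
proof (induction j)
  case (Suc j)
  have "(2/5) ^ j * Tr 30 \<le> 1 * Tr 30"
    by (intro mult_right_mono power_le_one pser_tn_nonneg) auto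
  then have "Tr (30 + j) \<le> 1/100" using Suc T_30_small by linarith
  then have "Tr (Suc (30 + j)) \<le> 2/5 * Tr (30 + j)" by (intro T_contract) auto
  then show ?case using Suc by simp
qed simp

section \<open>Tails of the weighted sums over k\<close>

lemma telescope_bound:
  fixes x f :: "nat \<Rightarrow> real"
  assumes "\<And>k. 0 \<le> x k" "\<And>k. x k \<le> f k - f (Suc k)" "\<And>k. 0 \<le> f k"
  shows "summable x" "suminf x \<le> f 0"
proof -
  have "(\<Sum>k<n. x k) \<le> f 0 - f n" for n
  proof (induction n)
    case (Suc n)
    then show ?case using assms(2)[of n] by simp
  qed simp
  note partial = this
  have b: "(\<Sum>k<n. x k) \<le> f 0" for n using partial[of n] assms(3)[of n] by linarith
  show s: "summable x"
    by (rule summable_bounded_nonneg[OF assms(1)]) (use b[of "Suc _"] in \<open>simp add: lessThan_Suc_atMost\<close>)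
  show "suminf x \<le> f 0" by (rule suminf_le_const[OF s b])
qed

lemma suminf_split_bound:
  fixes a f :: "nat \<Rightarrow> real"
  assumes "\<And>k. 0 \<le> a k" "\<And>k. a (k + N) \<le> f k - f (Suc k)" "\<And>k. 0 \<le> f k"
  shows "summable a" "(\<Sum>k<N. a k) \<le> suminf a" "suminf a \<le> (\<Sum>k<N. a k) + f 0"
proof -
  have t: "summable (\<lambda>k. a (k + N))" "(\<Sum>k. a (k + N)) \<le> f 0"
    using telescope_bound[of "\<lambda>k. a (k + N)" f] assms by auto
  show s: "summable a" using t(1) by (simp only: summable_iff_shift)
  show "(\<Sum>k<N. a k) \<le> suminf a" by (rule sum_le_suminf[OF s]) (use assms in auto)
  show "suminf a \<le> (\<Sum>k<N. a k) + f 0" using suminf_split_initial_segment[OF s, of N] t(2) by simp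
qed

lemma weighted_T:
  assumes w: "\<And>k. 0 \<le> w k" "\<And>k. w k \<le> 2 * real k + 1"
  shows "summable (\<lambda>k. w k * Tr (Suc k))"
    and "(\<Sum>k<30. w k * Tr (Suc k)) \<le> (\<Sum>k. w k * Tr (Suc k))"
    and "(\<Sum>k. w k * Tr (Suc k)) \<le> (\<Sum>k<30. w k * Tr (Suc k)) + 42 * Tr 30"
proof -
  \<comment> \<open>The coefficients are chosen so that f j - f (j + 1) is exactly (2 j + 61)
    (2/5)^(j + 1) T_30(rho), the largest possible term; f 0 then bounds the tail.\<close>
  define f where "f = (\<lambda>j. (4/3 * real j + 374/9) * (2/5) ^ j * Tr 30)"
  have T0: "Tr 30 \<ge> 0" by (rule pser_tn_nonneg)
  have step: "w (j + 30) * Tr (Suc (j + 30)) \<le> f j - f (Suc j)" for j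
  proof -
    have "w (j + 30) * Tr (Suc (j + 30)) \<le> (2 * real (j + 30) + 1) * ((2/5) ^ Suc j * Tr 30)"
    proof (intro mult_mono w)
      show "Tr (Suc (j + 30)) \<le> (2/5) ^ Suc j * Tr 30" using T_tail[of "Suc j"] by (simp add: add.commute)
    qed (use pser_tn_nonneg in auto)
    also have "\<dots> = f j - f (Suc j)" by (simp add: f_def field_simps)
    finally show ?thesis .
  qed
  note sb = suminf_split_bound[of "\<lambda>k. w k * Tr (Suc k)" 30 f, OF _ step]
  have 1: "0 \<le> w k * Tr (Suc k)" and 2: "0 \<le> f k" for k using w T0 pser_tn_nonneg by (auto simp: f_def)
  show "summable (\<lambda>k. w k * Tr (Suc k))" by (rule sb) (use 1 2 in auto)
  show "(\<Sum>k<30. w k * Tr (Suc k)) \<le> (\<Sum>k. w k * Tr (Suc k))" by (rule sb) (use 1 2 in auto)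
  have "(\<Sum>k. w k * Tr (Suc k)) \<le> (\<Sum>k<30. w k * Tr (Suc k)) + f 0" by (rule sb) (use 1 2 in auto)
  also have "f 0 \<le> 42 * Tr 30" using T0 by (simp add: f_def)
  finally show "(\<Sum>k. w k * Tr (Suc k)) \<le> (\<Sum>k<30. w k * Tr (Suc k)) + 42 * Tr 30" by simp
qed

text \<open>Since 582/1000 = 97/100 * 3/5, the factor m is absorbed by (97/100)^m: the product
  decreases from m = 81 on, where it is below 7.\<close>

lemma n_pow_bound: "m \<ge> 81 \<Longrightarrow> real m * (582/1000) ^ m \<le> 7 * (3/5) ^ m"
proof -
  assume "m \<ge> 81"
  then have "real m * (97/100) ^ m \<le> 7"
  proof (induction m rule: dec_induct)
    case base
    show ?case unfolding power_divide by simp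
  next
    case (step m)
    have "real (Suc m) * (97/100) ^ Suc m = (real (Suc m) * (97/100)) * (97/100) ^ m" by simp
    also have "\<dots> \<le> real m * (97/100) ^ m" using step by (intro mult_right_mono) auto
    finally show ?case using step by linarith
  qed
  then have "real m * (97/100) ^ m * (3/5) ^ m \<le> 7 * (3/5) ^ m" by (intro mult_right_mono) auto
  moreover have "(97/100 :: real) ^ m * (3/5) ^ m = (582/1000) ^ m" by (simp flip: power_mult_distrib)
  ultimately show ?thesis by (simp add: mult.assoc)
qed

lemma Wc_rho_bound: "m \<ge> 81 \<Longrightarrow> Wc k m * rho ^ m \<le> 7 * (3/5) ^ m"
proof -
  assume m: "m \<ge> 81"
  have "Wc k m * rho ^ m \<le> real m * (1 / sqrt rho) ^ m * (sqrt rho * sqrt rho) ^ m"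
  proof (rule mult_mono)
    show "Wc k m \<le> real m * (1 / sqrt rho) ^ m"
      by (rule Ac_pow_bound(2)) (use sqrt_rho rho_partial_sums in auto)
  qed (use rho_pos in auto)
  also have "\<dots> = real m * (1 / sqrt rho * (sqrt rho * sqrt rho)) ^ m" by (simp only: power_mult_distrib mult.assoc)
  also have "1 / sqrt rho * (sqrt rho * sqrt rho) = sqrt rho" using sqrt_rho(1) by (simp del: real_sqrt_mult_self)
  also have "real m * sqrt rho ^ m \<le> real m * (582/1000) ^ m"
    using sqrt_rho by (intro mult_left_mono power_mono) auto
  also have "\<dots> \<le> 7 * (3/5) ^ m" by (rule n_pow_bound) fact
  finally show ?thesis .
qed

text \<open>A (k + 1)-vertex tree is the smallest that can contain a k-protected vertex, and proper
  divisors of m < 2 k + 2 are at most k.\<close>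

lemma Wc_zero: "m < 2 * k + 2 \<Longrightarrow> Wc k m = 0"
proof -
  assume m: "m < 2 * k + 2"
  have "sn k d = 0" if dm: "d dvd m" "d < m" for d
  proof -
    obtain q where q: "m = d * q" using dm by (auto elim: dvdE)
    have "q \<noteq> 0" "q \<noteq> 1" using dm unfolding q by auto
    then have "2 \<le> q" by simp
    then have "d * 2 \<le> m" unfolding q by (rule mult_le_mono2)
    then have dk: "d \<le> k" using m by simp
    have "sn k n = 0" if "n \<le> d" for n using that
    proof (induction n rule: less_induct)
      case (less n)
      have "divsum (sn k) j = 0" if "j \<in> {1..<n}" for j
        unfolding divsum_def by (rule sum.neutral) (use less that in \<open>auto dest!: dvd_imp_le\<close>)
      then show ?case using sn_rec[of k n] tn_zero[of n k] less.prems dk by simp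
    qed
    then show ?thesis by simp
  qed
  then show ?thesis by (auto simp: Wc_def lamb_def intro!: sum.neutral)
qed

abbreviation "Wr k \<equiv> pser (Wc k) rho"

text \<open>The coefficients vanish below M = 2 k + 4, which exceeds 80, so the geometric bound
  applies to the whole series. The constant is 7 * 5/2 * (3/5)^4 = 2.268.\<close>

lemma Wr_tail: "k \<ge> 39 \<Longrightarrow> Wr (Suc k) \<le> 2268/1000 * (9/25) ^ k"
proof -
  assume k: "k \<ge> 39"
  define M where "M = 2 * k + 4"
  have g: "(\<Sum>m. Wc (Suc k) (m + M) * rho ^ (m + M)) \<le> 7 * (3/5) ^ M / (1 - 3/5)"
    by (rule geometric_tail(2)) (use k Wc_rho_bound rho_pos in \<open>auto simp: M_def\<close>)
  have "Wr (Suc k) = (\<Sum>m. Wc (Suc k) (m + M) * rho ^ (m + M)) + (\<Sum>m<M. Wc (Suc k) m * rho ^ m)"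
    unfolding pser_def by (rule suminf_split_initial_segment[OF summable_Wc_rho])
  also have "(\<Sum>m<M. Wc (Suc k) m * rho ^ m) = 0"
    by (rule sum.neutral) (auto simp: M_def intro!: Wc_zero)
  finally have "Wr (Suc k) \<le> 7 * (3/5) ^ M / (1 - 3/5)" using g by simp
  moreover have "(3/5 :: real) ^ M = (9/25) ^ k * (81/625)"
  proof -
    have "(3/5 :: real) ^ M = ((3/5)\<^sup>2) ^ k * (3/5) ^ 4" by (simp only: M_def power_add power_mult)
    then show ?thesis by (simp add: power_divide)
  qed
  ultimately show ?thesis by simp
qed

lemma weighted_W:
  assumes w: "\<And>k. 0 \<le> w k" "\<And>k. w k \<le> 2 * real k + 1"
  shows "summable (\<lambda>k. w k * Wr (Suc k))"
    and "(\<Sum>k<39. w k * Wr (Suc k)) \<le> (\<Sum>k. w k * Wr (Suc k))"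
    and "(\<Sum>k. w k * Wr (Suc k)) \<le> (\<Sum>k<39. w k * Wr (Suc k)) + 100 / FF"
proof -
  \<comment> \<open>The slope 8 makes the decrease of f, (5.12 k + 2.24) (9/25)^k, dominate 2.268 (2
    k + 1) (9/25)^k for k >= 39.\<close>
  define f where "f = (\<lambda>j. (8 * real (j + 39) + 8) * (9/25 :: real) ^ (j + 39))"
  have step: "w (j + 39) * Wr (Suc (j + 39)) \<le> f j - f (Suc j)" for j
  proof -
    define k where "k = j + 39"
    have "w k * Wr (Suc k) \<le> (2 * real k + 1) * (2268/1000 * (9/25) ^ k)"
      by (intro mult_mono w Wr_tail pser_Wc_nonneg) (auto simp: k_def)
    also have "\<dots> = (9/25) ^ k * (2268/1000 * (2 * real k + 1))" by simp
    also have "\<dots> \<le> (9/25) ^ k * ((8 * real k + 8) - (9/25) * (8 * real (Suc k) + 8))"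
      by (intro mult_left_mono) (auto simp: k_def field_simps)
    also have "\<dots> = (8 * real k + 8) * (9/25) ^ k - (8 * real (Suc k) + 8) * ((9/25) * (9/25) ^ k)"
      by (simp only: right_diff_distrib mult_ac)
    also have "\<dots> = f j - f (Suc j)" unfolding f_def k_def add_Suc power_Suc by simp
    finally show ?thesis by (simp add: k_def)
  qed
  note sb = suminf_split_bound[of "\<lambda>k. w k * Wr (Suc k)" 39 f, OF _ step]
  have 1: "0 \<le> w k * Wr (Suc k)" and 2: "0 \<le> f k" for k using w pser_Wc_nonneg by (auto simp: f_def)
  show "summable (\<lambda>k. w k * Wr (Suc k))" by (rule sb) (use 1 2 in auto)
  show "(\<Sum>k<39. w k * Wr (Suc k)) \<le> (\<Sum>k. w k * Wr (Suc k))" by (rule sb) (use 1 2 in auto)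
  have "(\<Sum>k. w k * Wr (Suc k)) \<le> (\<Sum>k<39. w k * Wr (Suc k)) + f 0" by (rule sb) (use 1 2 in auto)
  also have "f 0 \<le> 100 / FF" unfolding f_def power_divide by simp
  finally show "(\<Sum>k. w k * Wr (Suc k)) \<le> (\<Sum>k<39. w k * Wr (Suc k)) + 100 / FF" by simp
qed

text \<open>The indices above 80 contribute at most 11000 (3/5)^81 / (2/5), which is less than 1000
  units of 10^-16; the lower bound simply drops them.\<close>

lemma enclosure_from_lists:
  assumes V: "\<And>m. m < 80 \<Longrightarrow> V (Suc m) = real_of_int (lam s ! m)" "V 0 = 0" "\<And>m. 0 \<le> V m"
    and sm: "summable (\<lambda>m. V m * rho ^ m)" and tail: "\<And>m. m \<ge> 81 \<Longrightarrow> V m * rho ^ m \<le> C * (3/5) ^ m" and C: "0 \<le> C" "C \<le> 11000"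
    and chk: "l * 10000000000000000 \<le> dot (lam s) pow_lo \<and> dot (lam s) pow_hi \<le> u * 10000000000000000"
  shows "real_of_int l \<le> FF * pser V rho" "FF * pser V rho \<le> real_of_int u + 1000"
proof -
  have split: "pser V rho = (\<Sum>m<80. V (Suc m) * rho ^ Suc m) + (\<Sum>m. V (m + 81) * rho ^ (m + 81))"
    unfolding pser_def by (rule suminf_split_81[OF _ sm]) (simp add: V)
  have "(\<Sum>m. V (m + 81) * rho ^ (m + 81)) \<le> C * (3/5) ^ 81 / (1 - 3/5)"
    by (rule geometric_tail(2)) (use tail V rho_pos in auto)
  also have "\<dots> \<le> 11000 * (3/5) ^ 81 / (1 - 3/5)" using C by (intro divide_right_mono mult_right_mono) auto
  also have "\<dots> \<le> 1000 / FF" unfolding power_divide by simp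
  finally have tl: "(\<Sum>m. V (m + 81) * rho ^ (m + 81)) \<le> 1000 / FF" .
  have tl0: "0 \<le> (\<Sum>m. V (m + 81) * rho ^ (m + 81))"
    by (rule suminf_nonneg) (use sm V rho_pos in \<open>auto intro: summable_ignore_initial_segment\<close>)
  have "real_of_int (l * 10000000000000000) \<le> real_of_int (dot (lam s) pow_lo)" using chk by (simp only: of_int_le_iff)
  also have "\<dots> = (\<Sum>m<80. V (Suc m) * real_of_int (pow_lo ! m))"
    unfolding dot_eq_sum using lengths by (auto simp: V intro!: sum.cong)
  also have "\<dots> \<le> (\<Sum>m<80. V (Suc m) * (DD * rho ^ Suc m))"
  proof (intro sum_mono mult_left_mono V)
    fix m assume "m \<in> {..<80::nat}"
    then have "real_of_int (pow_lo ! m) \<le> DD * lo ^ Suc m" using pow_lo_le by auto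
    also have "\<dots> \<le> DD * rho ^ Suc m" using lo_le_rho by (intro mult_left_mono power_mono) auto
    finally show "real_of_int (pow_lo ! m) \<le> DD * rho ^ Suc m" .
  qed
  also have "\<dots> = DD * (\<Sum>m<80. V (Suc m) * rho ^ Suc m)"
    unfolding sum_distrib_left by (rule sum.cong) simp_all
  finally have "real_of_int l \<le> FF * (\<Sum>m<80. V (Suc m) * rho ^ Suc m)" by simp
  then show "real_of_int l \<le> FF * pser V rho" using split tl0 by simp
  have "DD * (\<Sum>m<80. V (Suc m) * rho ^ Suc m) = (\<Sum>m<80. V (Suc m) * (DD * rho ^ Suc m))"
    unfolding sum_distrib_left by (rule sum.cong) simp_all
  also have "\<dots> \<le> (\<Sum>m<80. V (Suc m) * real_of_int (pow_hi ! m))"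
  proof (intro sum_mono mult_left_mono V)
    fix m assume "m \<in> {..<80::nat}"
    have "DD * rho ^ Suc m \<le> DD * hi ^ Suc m" using rho_le_hi rho_pos by (intro mult_left_mono power_mono) auto
    also have "\<dots> \<le> real_of_int (pow_hi ! m)" by (rule pow_hi_ge) (use \<open>m \<in> {..<80}\<close> in simp)
    finally show "DD * rho ^ Suc m \<le> real_of_int (pow_hi ! m)" .
  qed
  also have "\<dots> = real_of_int (dot (lam s) pow_hi)"
    unfolding dot_eq_sum using lengths by (auto simp: V intro!: sum.cong)
  also have "\<dots> \<le> real_of_int (u * 10000000000000000)" using chk by (simp only: of_int_le_iff)
  finally have "FF * (\<Sum>m<80. V (Suc m) * rho ^ Suc m) \<le> real_of_int u" by simp
  then show "FF * pser V rho \<le> real_of_int u + 1000" using split tl by simp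
qed

lemma weighted_W_enclosure:
  assumes w: "\<And>k. 0 \<le> w k" "\<And>k. w k \<le> 2 * real k + 1" and s: "corr (wsn w) s" "length s = 40"
    and chk: "l * 10000000000000000 \<le> dot (lam s) pow_lo \<and> dot (lam s) pow_hi \<le> u * 10000000000000000"
  shows "real_of_int l \<le> FF * (\<Sum>k<39. w k * Wr (Suc k))" "FF * (\<Sum>k<39. w k * Wr (Suc k)) \<le> real_of_int u + 1000"
proof -
  define V where "V = (\<lambda>m. \<Sum>k<39. w k * Wc (Suc k) m)"
  have V: "V m = (\<Sum>d | d dvd m \<and> d < m. wsn w d)" for m
    unfolding V_def wsn_def Wc_def lamb_def by (subst sum.swap) (simp add: sum_distrib_left)
  have ss: "(\<lambda>m. V m * rho ^ m) sums (\<Sum>k<39. w k * Wr (Suc k))"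
  proof -
    have "(\<lambda>m. \<Sum>k<39. w k * (Wc (Suc k) m * rho ^ m)) sums (\<Sum>k<39. w k * Wr (Suc k))"
      unfolding pser_def by (intro sums_sum sums_mult summable_sums summable_Wc_rho)
    then show ?thesis by (simp add: V_def sum_distrib_right mult.assoc)
  qed
  \<comment> \<open>The factor 1521 = 39^2 is the sum of the first 39 odd numbers, the largest total
    weight.\<close>
  have bound: "V m * rho ^ m \<le> (1521 * 7) * (3/5) ^ m" if m: "m \<ge> 81" for m
  proof -
    have "V m * rho ^ m = (\<Sum>k<39. w k * (Wc (Suc k) m * rho ^ m))" by (simp add: V_def sum_distrib_right mult.assoc)
    also have "\<dots> \<le> (\<Sum>k<39. (2 * real k + 1) * (7 * (3/5) ^ m))"
      by (intro sum_mono mult_mono w Wc_rho_bound m) (use rho_pos in auto)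
    also have "\<dots> = (\<Sum>k<39. 2 * real k + 1) * (7 * (3/5) ^ m)" by (simp only: sum_distrib_right)
    also have "(\<Sum>k<39. 2 * real k + 1) = 1521" using sum_odd_sq[of 39] by simp
    finally show ?thesis by simp
  qed
  have evV: "pser V rho = (\<Sum>k<39. w k * Wr (Suc k))" using ss by (simp add: sums_iff pser_def)
  have lst: "V (Suc m) = real_of_int (lam s ! m)" if "m < 80" for m
    unfolding V by (rule lam_nth[symmetric]) (use that s in \<open>auto simp: corr_def\<close>)
  have V0: "V 0 = 0" by (simp add: V)
  have nonneg: "0 \<le> V m" for m unfolding V_def by (intro sum_nonneg mult_nonneg_nonneg w) auto
  note enc = enclosure_from_lists[of V s "1521 * 7" l u, OF lst V0 nonneg sums_summable[OF ss] bound _ _ chk]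
  show "real_of_int l \<le> FF * (\<Sum>k<39. w k * Wr (Suc k))" "FF * (\<Sum>k<39. w k * Wr (Suc k)) \<le> real_of_int u + 1000"
    unfolding evV[symmetric] by (rule enc; simp)+
qed

lemma GG_enclosure: "FF + 2160045618238600 \<le> FF * GG" "FF * GG \<le> FF + 2160045618242346 + 1000"
proof -
  have lst: "Wc 0 (Suc m) = real_of_int (lam (lin 1 (hd table)) ! m)" if "m < 80" for m
  proof -
    have "Wc 0 (Suc m) = (\<Sum>d | d dvd Suc m \<and> d < Suc m. real d * tn 0 d)"
      by (simp add: Wc_def lamb_def sn_0)
    then show ?thesis using lam_table[of 0 m] that Ac_divisors[of 0 m] by (simp add: hd_table del: of_nat_Suc)
  qed
  have V0: "Wc 0 0 = 0" by (simp add: Wc_def lamb_def)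
  note enc = enclosure_from_lists[of "Wc 0" "lin 1 (hd table)" 7, OF lst V0 _ summable_Wc_rho Wc_rho_bound _ _ check_sums_zero]
  have "2160045618238600 \<le> FF * Wr 0" "FF * Wr 0 \<le> 2160045618242346 + 1000"
    using enc by simp_all
  then show "FF + 2160045618238600 \<le> FF * GG" "FF * GG \<le> FF + 2160045618242346 + 1000"
    by (simp_all add: GG_def distrib_left)
qed

lemma weighted_U:
  assumes w: "\<And>k. 0 \<le> w k" "\<And>k. w k \<le> 2 * real k + 1"
  shows "(\<Sum>k. w k * Uk (Suc k)) = (\<Sum>k. w k * Tr (Suc k)) + (\<Sum>k. w k * Wr (Suc k))"
  using suminf_add[OF weighted_T(1)[OF w] weighted_W(1)[OF w]] by (simp add: Uk_def distrib_left)

lemma T_sums: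
  fixes cs :: "int list"
  assumes "length cs = 30" "\<And>k. k < 30 \<Longrightarrow> w k = real_of_int (cs ! k)" "\<And>k. 0 \<le> w k"
  shows "real_of_int (dot cs T_lo) \<le> FF * (\<Sum>k<30. w k * Tr (Suc k))" "FF * (\<Sum>k<30. w k * Tr (Suc k)) \<le> real_of_int (dot cs T_hi)"
proof -
  have l: "length T_lo = 30" "length T_hi = 30" using lengths by auto
  have "real_of_int (dot cs T_lo) = (\<Sum>k<30. w k * real_of_int (T_lo ! k))"
    unfolding dot_eq_sum using assms l by (auto intro!: sum.cong)
  also have "\<dots> \<le> (\<Sum>k<30. w k * (FF * Tr (Suc k)))"
    by (intro sum_mono mult_left_mono assms) (use T_enclosure in auto)
  finally show "real_of_int (dot cs T_lo) \<le> FF * (\<Sum>k<30. w k * Tr (Suc k))"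
    by (simp add: sum_distrib_left mult.left_commute)
  have "(\<Sum>k<30. w k * (FF * Tr (Suc k))) \<le> (\<Sum>k<30. w k * real_of_int (T_hi ! k))"
    by (intro sum_mono mult_left_mono assms) (use T_enclosure in auto)
  also have "\<dots> = real_of_int (dot cs T_hi)"
    unfolding dot_eq_sum using assms l by (auto intro!: sum.cong)
  finally show "FF * (\<Sum>k<30. w k * Tr (Suc k)) \<le> real_of_int (dot cs T_hi)"
    by (simp add: sum_distrib_left mult.left_commute)
qed

text \<open>The lower bound adds the two checked lower sums. The upper one adds three tails: 1000
  units for indices above 80, 100 for W_k with k >= 40, and 42 * 290 for T_k(rho) with k > 30. The
  same budget gives \<open>E2_enclosure\<close>.\<close>

lemma E1_enclosure: "12103203469585626 \<le> FF * E1" "FF * E1 \<le> 12103203469609285"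
proof -
  define w where "w = (\<lambda>_ :: nat. 1 :: real)"
  have w: "0 \<le> w k" "w k \<le> 2 * real k + 1" for k by (auto simp: w_def)
  have E: "E1 = (\<Sum>k. w k * Tr (Suc k)) + (\<Sum>k. w k * Wr (Suc k))"
    using weighted_U[of w] w by (simp add: E1_def w_def)
  have T: "real_of_int 11861531889835306 \<le> FF * (\<Sum>k<30. w k * Tr (Suc k))" "FF * (\<Sum>k<30. w k * Tr (Suc k)) \<le> real_of_int 11861531889844888"
    using T_sums[of "ones" w] check_T_sums by (auto simp: w_def nth_Cons' numeral_eq_Suc split: if_splits)
  have W: "real_of_int 241671579750320 \<le> FF * (\<Sum>k<39. w k * Wr (Suc k))" "FF * (\<Sum>k<39. w k * Wr (Suc k)) \<le> real_of_int 241671579751117 + 1000"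
    using weighted_W_enclosure[of w s_one 241671579750320 241671579751117, OF w] corr_s_one lengths check_sums_one by (simp_all add: w_def)
  note b = weighted_T(2,3)[of w] weighted_W(2,3)[of w]
  show "12103203469585626 \<le> FF * E1" using E T W b w by simp
  show "FF * E1 \<le> 12103203469609285" using E T W b w T_30 by (simp add: field_simps)
qed

lemma E2_enclosure: "28850314080153818 \<le> FF * E2" "FF * E2 \<le> 28850314080211079"
proof -
  define w where "w = (\<lambda>k :: nat. 2 * real k + 1)"
  have w: "0 \<le> w k" "w k \<le> 2 * real k + 1" for k by (auto simp: w_def)
  have E: "E2 = (\<Sum>k. w k * Tr (Suc k)) + (\<Sum>k. w k * Wr (Suc k))"
    using weighted_U[of w] w by (simp add: E2_def w_def)
  have T: "real_of_int 28549120145211596 \<le> FF * (\<Sum>k<30. w k * Tr (Suc k))" "FF * (\<Sum>k<30. w k * Tr (Suc k)) \<le> real_of_int 28549120145254432"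
    using T_sums[of "odds" w] check_T_sums w by (auto simp: w_def nth_Cons' numeral_eq_Suc split: if_splits)
  have W: "real_of_int 301193934942222 \<le> FF * (\<Sum>k<39. w k * Wr (Suc k))" "FF * (\<Sum>k<39. w k * Wr (Suc k)) \<le> real_of_int 301193934943367 + 1000"
    using weighted_W_enclosure[of w s_two 301193934942222 301193934943367, OF w] corr_s_two lengths check_sums_two by (simp_all add: w_def)
  note b = weighted_T(2,3)[of w] weighted_W(2,3)[of w]
  show "28850314080153818 \<le> FF * E2" using E T W b w by simp
  show "FF * E2 \<le> 28850314080211079" using E T W b w T_30 by (simp add: field_simps)
qed

lemma E_value: "99532549873 / 100000000000 \<le> E1 / GG" "E1 / GG \<le> 99532549874 / 100000000000"
  using E1_enclosure GG_enclosure GG_pos by (simp_all add: pos_le_divide_eq pos_divide_le_eq)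

lemma E2_value: "237254982307 / 100000000000 \<le> E2 / GG" "E2 / GG \<le> 237254982309 / 100000000000"
  using E2_enclosure GG_enclosure GG_pos by (simp_all add: pos_le_divide_eq pos_divide_le_eq)

lemma V_value: "\<bar>E2 / GG - (E1 / GG)\<^sup>2 - 1.3818769746\<bar> < 1 / 10 ^ 10"
proof -
  define p where "p = E1 / GG"
  have p: "99532549873 / 100000000000 \<le> p" "p \<le> 99532549874 / 100000000000" using E_value by (auto simp: p_def)
  have "(99532549873 / 100000000000)\<^sup>2 \<le> p\<^sup>2" "p\<^sup>2 \<le> (99532549874 / 100000000000)\<^sup>2"
    using p by (auto intro!: power_mono)
  then show ?thesis using E2_value unfolding p_def[symmetric] by (simp add: power2_eq_square abs_less_iff)
qed

theorem theorem4:
  fixes b :: real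
  assumes "b > 0"
    and "(\<lambda>z. eval_fps gf_T z - (1 - b * sqrt (1 - z / rho))) \<in> O[at_left rho](\<lambda>z. 1 - z / rho)"
  shows "(\<forall>k\<ge>1. summable (\<lambda>n. fps_nth (gf_Tk k) n * rho ^ n) \<and>
            (\<forall>i\<ge>2. summable (\<lambda>n. fps_nth (gf_Sk k) n * (rho ^ i) ^ n)) \<and>
            (\<lambda>i. eval_fps (gf_Sk k) (rho ^ i)) summable_on {2..}) \<and>
    (\<exists>E. (\<lambda>n. measure_pmf.expectation (Y n) real) \<longlonglongrightarrow> E \<and>
         ((\<lambda>k. 2 / b\<^sup>2 * ((\<Sum>\<^sub>\<infinity>i\<in>{2..}. eval_fps (gf_Sk k) (rho ^ i)) + eval_fps (gf_Tk k) rho))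
            has_sum E) {1..} \<and>
         \<bar>E - 0.9953254987\<bar> < 1 / 10 ^ 10) \<and>
    (\<exists>V. (\<lambda>n. measure_pmf.variance (Y n) real) \<longlonglongrightarrow> V \<and>
         \<bar>V - 1.3818769746\<bar> < 1 / 10 ^ 10)"
proof -
  have Tk: "fps_nth (gf_Tk k) n = tn k n" and Sk: "fps_nth (gf_Sk k) n = sn k n" for k n
    by (simp_all add: gf_Tk_def tn_def gf_Sk_def sn_def)
  have evT: "eval_fps (gf_Tk k) x = pser (tn k) x" and evS: "eval_fps (gf_Sk k) x = pser (sn k) x" for k x
    by (simp_all add: eval_fps_def pser_def Tk Sk)
  have W: "(\<Sum>\<^sub>\<infinity>i\<in>{2..}. pser (sn k) (rho ^ i)) = Wr k" for k
    by (rule infsumI[OF Wc_has_sum])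
  \<comment> \<open>Here b^2 = 2 G turns the factor 2 / b^2 into 1 / G.\<close>
  have summand: "2 / b\<^sup>2 * ((\<Sum>\<^sub>\<infinity>i\<in>{2..}. eval_fps (gf_Sk k) (rho ^ i)) + eval_fps (gf_Tk k) rho) = Uk k / GG" for k
    using GG_pos by (simp add: evS evT W b_sq_eq[OF assms] Uk_def add.commute)
  have 1: "summable (\<lambda>n. sn k n * (rho ^ i) ^ n)" if "i \<ge> 2" for k i
  proof (rule summable_sn)
    have "rho ^ i \<le> rho\<^sup>2" using that rho_pos rho_lt_1 by (intro power_decreasing) auto
    then show "rho ^ i < rho" using rho_sq_less by linarith
  qed (use rho_pos in auto)
  have "(\<lambda>k. Uk (Suc k) / GG) sums (E1 / GG)"
    unfolding E1_def by (intro sums_divide summable_sums summable_Uk)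
  then have "((\<lambda>k. Uk (Suc k) / GG) has_sum (E1 / GG)) UNIV"
    by (rule sums_nonneg_imp_has_sum) (use GG_pos Uk_nonneg in \<open>simp add: less_imp_le\<close>)
  also have "?this \<longleftrightarrow> ((\<lambda>k. Uk k / GG) has_sum (E1 / GG)) {1..}"
    by (rule has_sum_reindex_bij_witness[where j = Suc and i = "\<lambda>k. k - 1"]) auto
  finally have 2: "((\<lambda>k. Uk k / GG) has_sum (E1 / GG)) {1..}" .
  have 3: "\<bar>E1 / GG - 0.9953254987\<bar> < 1 / 10 ^ 10"
  proof -
    have "\<bar>p - 0.9953254987\<bar> < 1 / 10 ^ 10"
      if "99532549873 / 100000000000 \<le> p" "p \<le> 99532549874 / 100000000000" for p :: real
      using that by (simp add: abs_less_iff)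
    then show ?thesis using E_value by blast
  qed
  have 4: "(\<lambda>i. pser (sn k) (rho ^ i)) summable_on {2..}" for k
    by (rule has_sum_imp_summable[OF Wc_has_sum])
  show ?thesis
    unfolding Tk Sk summand
    using summable_tn_rho 1 4 expectation_limit 2 3 variance_limit V_value
    by (auto simp: evS)
qed

end
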